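(* Let $\Omega\subseteq\mathbb{R}^{p+q+1}$ be a p-symmetric slice domain and let $f:\Omega\to\mathbb{R}_{p+q}$ be a generalized partial-slice monogenic function. If $U$ is a domain in $\mathbb{R}^{p+q+1}$ such that, for some $\underline{\omega}\in\mathbb{S}$, $U_{\underline{\omega}}\subset\Omega_{\underline{\omega}}$ is a bounded domain in $\mathbb{R}^{p+2}$ with smooth boundary $\partial U_{\underline{\omega}}\subset\Omega_{\underline{\omega}}$, then $$f(\mathbf{x})=\int_{\partial U_{\underline{\omega}}}E(\mathbf{y}-\mathbf{x})\,n(\mathbf{y})\,f(\mathbf{y})\,dS(\mathbf{y}),\qquad \mathbf{x}\in U_{\underline{\omega}},$$ where $n(\mathbf{y})=\sum_{i=0}^pn_i(\mathbf{y})e_i+n_{p+1}(\mathbf{y})\underline{\omega}$ is the unit exterior normal to $\partial U_{\underline{\omega}}$ at $\mathbf{y}$ and $dS$ is the classical Lebesgue surface element in $\mathbb{R}^{p+2}$.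
   Context: Fix integers $p\ge 0$, $q\ge 1$. $\mathbb{R}_{p+q}$ is the real Clifford algebra generated by $e_1,\dots,e_{p+q}$ with $e_ie_j+e_je_i=-2\delta_{ij}$; put $e_0=1$. A point $\mathbf{x}=(x_0,\dots,x_{p+q})\in\mathbb{R}^{p+q+1}$ is identified with the paravector $\mathbf{x}=\mathbf{x}_p+\underline{\mathbf{x}}_q$, where $\mathbf{x}_p=\sum_{i=0}^p x_ie_i\in\mathbb{R}^{p+1}$ and $\underline{\mathbf{x}}_q=\sum_{i=p+1}^{p+q}x_ie_i\in\mathbb{R}^q$; its conjugate is $\overline{\mathbf{x}}=x_0-\sum_{i\ge1}x_ie_i$. $\mathbb{R}^{p+1}$ is regarded as the subspace $\{\underline{\mathbf{x}}_q=0\}$. Let $\mathbb{S}=\{\sum_{i=p+1}^{p+q}x_ie_i:\sum_{i=p+1}^{p+q} x_i^2=1\}$, so that $\underline{\omega}^2=-1$ for $\underline{\omega}\in\mathbb{S}$. For an open set $\Omega\subseteq\mathbb{R}^{p+q+1}$ and $\underline{\omega}\in\mathbb{S}$, put $\Omega_{\underline{\omega}}=\Omega\cap(\mathbb{R}^{p+1}\oplus\underline{\omega}\mathbb{R})$, viewed as an open subset of $\mathbb{R}^{p+2}$ via $(\mathbf{x}_p,r)\leftrightarrow\mathbf{x}_p+r\underline{\omega}$. A domain is a nonempty open connected set. Generalized partial-slice monogenic: a function $f:\Omega\to\mathbb{R}_{p+q}$ on a domain $\Omega$ is (left) generalized partial-slice monogenic (of type $(p,q)$) if for every $\underline{\omega}\in\mathbb{S}$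 the restriction $f_{\underline{\omega}}$ of $f$ to $\Omega_{\underline{\omega}}$ has continuous partial derivatives and $(D_{\mathbf{x}_p}+\underline{\omega}\partial_r)f_{\underline{\omega}}(\mathbf{x}_p+r\underline{\omega})=0$ on $\Omega_{\underline{\omega}}$, where $D_{\mathbf{x}_p}=\sum_{i=0}^p e_i\partial_{x_i}$. Slice domain: a domain $\Omega\subseteq\mathbb{R}^{p+q+1}$ such that $\Omega\cap\mathbb{R}^{p+1}\ne\emptyset$ and $\Omega_{\underline{\omega}}$ is a domain in $\mathbb{R}^{p+2}$ for every $\underline{\omega}\in\mathbb{S}$. p-symmetric: $\Omega$ is p-symmetric if for $\mathbf{x}_p\in\mathbb{R}^{p+1}$, $r>0$, $\underline{\omega}\in\mathbb{S}$, $\mathbf{x}_p+r\underline{\omega}\in\Omega$ implies $\mathbf{x}_p+r\underline{\eta}\in\Omega$ for all $\underline{\eta}\in\mathbb{S}$. Cauchy kernel: $E(\mathbf{x})=\frac{1}{\sigma_{p+1}}\frac{\overline{\mathbf{x}}}{|\mathbf{x}|^{p+2}}$ for $\mathbf{x}\ne0$, with $\sigma_{p+1}=2\,\Gamma(\tfrac12)^{p+2}/\Gamma(\tfrac{p+2}{2})$ (the surface area of the unit sphere in $\mathbb{R}^{p+2}$). *)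

theory Defs
  imports "HOL-Analysis.Analysis"
begin

section \<open>The real Clifford algebra\<close>

text \<open>
  Elements are coefficient families over the basis \<open>e\<^sub>A\<close>, where \<open>A\<close> is a set of generators and
  \<open>e\<^sub>A\<close> is the product of the generators in \<open>A\<close> in increasing order. The componentwise operations
  \<open>*\<close> and \<open>1\<close> that the type \<open>vec\<close> already carries are not the Clifford ones; the Clifford product
  is \<open>\<star>\<close> and its unit is \<open>cl_one\<close>. The Euclidean norm of the coefficient family provides the topology.
\<close>

type_synonym 'g clifford = "real ^ ('g set)"

text \<open>
  \<open>e\<^sub>A e\<^sub>B = cl_sign A B e\<^sub>C\<close> with \<open>C\<close> the symmetric difference: every pair \<open>b < a\<close> contributes a
  transposition, and every common generator contributes \<open>e\<^sub>a e\<^sub>a = -1\<close>.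
\<close>

definition cl_sign :: "'g::{finite,linorder} set \<Rightarrow> 'g set \<Rightarrow> real" where
  "cl_sign A B = (-1) ^ card {(a, b). a \<in> A \<and> b \<in> B \<and> b \<le> a}"

definition cl_basis :: "'g::finite set \<Rightarrow> 'g clifford" where
  "cl_basis A = axis A 1"

definition cl_one :: "'g::finite clifford" where
  "cl_one = cl_basis {}"

definition cl_gen :: "'g::finite \<Rightarrow> 'g clifford" where
  "cl_gen a = cl_basis {a}"

definition cl_mult :: "'g::{finite,linorder} clifford \<Rightarrow> 'g clifford \<Rightarrow> 'g clifford"
    (infixl "\<star>" 70) where
  "x \<star> y = (\<Sum>A\<in>UNIV. \<Sum>B\<in>UNIV. (x $ A * y $ B * cl_sign A B) *\<^sub>R cl_basis (sym_diff A B))"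

lemma cl_mult_add_left: "(x + y) \<star> z = x \<star> z + y \<star> z"
  by (simp add: cl_mult_def sum.distrib algebra_simps)

lemma cl_mult_add_right: "x \<star> (y + z) = x \<star> y + x \<star> z"
  by (simp add: cl_mult_def sum.distrib algebra_simps)

lemma cl_mult_scaleR_left: "(c *\<^sub>R x) \<star> y = c *\<^sub>R (x \<star> y)"
  by (simp add: cl_mult_def scaleR_sum_right algebra_simps)

lemma cl_mult_scaleR_right: "x \<star> (c *\<^sub>R y) = c *\<^sub>R (x \<star> y)"
  by (simp add: cl_mult_def scaleR_sum_right algebra_simps)

lemma cl_mult_sum_left: "(\<Sum>i\<in>I. x i) \<star> y = (\<Sum>i\<in>I. x i \<star> y)"
proof (induction I rule: infinite_finite_induct)
  case (insert a I)
  then show ?case by (simp add: cl_mult_add_left)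
qed (simp_all add: cl_mult_def)

lemma cl_mult_sum_right: "x \<star> (\<Sum>i\<in>I. y i) = (\<Sum>i\<in>I. x \<star> y i)"
proof (induction I rule: infinite_finite_induct)
  case (insert a I)
  then show ?case by (simp add: cl_mult_add_right)
qed (simp_all add: cl_mult_def)

lemma cl_mult_basis: "cl_basis A \<star> cl_basis B = cl_sign A B *\<^sub>R cl_basis (sym_diff A B)"
proof -
  have "cl_basis A \<star> cl_basis B = (\<Sum>A'\<in>UNIV. \<Sum>B'\<in>UNIV.
      if A' = A then if B' = B then cl_sign A B *\<^sub>R cl_basis (sym_diff A B) else 0 else 0)"
    unfolding cl_mult_def by (intro sum.cong refl) (auto simp: cl_basis_def axis_def)
  also have "\<dots> = (\<Sum>A'\<in>UNIV. if A' = A then cl_sign A B *\<^sub>R cl_basis (sym_diff A B) else 0)"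
    by (intro sum.cong refl) auto
  finally show ?thesis by simp
qed

lemma cl_expand: "x = (\<Sum>A\<in>UNIV. x $ A *\<^sub>R cl_basis A)" for x :: "'g::finite clifford"
  by (simp add: vec_eq_iff cl_basis_def axis_def if_distrib sum.If_cases cong: if_cong)

lemma cl_sign_prod: "cl_sign A B = (\<Prod>a\<in>A. \<Prod>b\<in>B. if b \<le> a then -1 else 1)"
proof -
  let ?S = "{(a, b). a \<in> A \<and> b \<in> B \<and> b \<le> a}"
  have "(\<Prod>a\<in>A. \<Prod>b\<in>B. if b \<le> a then -1 else (1 :: real))
      = (\<Prod>p\<in>A \<times> B. if p \<in> ?S then -1 else (1 :: real))"
    by (subst prod.cartesian_product) (rule prod.cong, auto split: if_split_asm)
  also have "\<dots> = (\<Prod>p\<in>?S. -1)"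
    by (rule prod.mono_neutral_cong_right) (auto split: if_split_asm)
  finally show ?thesis by (simp add: cl_sign_def)
qed

lemma prod_sym_diff:
  fixes s :: "'g::finite \<Rightarrow> real"
  assumes "\<And>a. s a * s a = 1"
  shows "prod s (sym_diff A B) = prod s A * prod s B"
proof -
  have A: "prod s A = prod s (A - B) * prod s (A \<inter> B)"
    by (subst prod.union_disjoint [symmetric]) (auto intro: prod.cong)
  have B: "prod s B = prod s (B - A) * prod s (A \<inter> B)"
    by (subst prod.union_disjoint [symmetric]) (auto intro: prod.cong)
  have "prod s (A \<inter> B) * prod s (A \<inter> B) = 1"
    by (simp add: prod.distrib [symmetric] assms)
  moreover have "prod s (sym_diff A B) = prod s (A - B) * prod s (B - A)"
    by (rule prod.union_disjoint) auto
  ultimately show ?thesis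
    by (simp add: A B algebra_simps)
qed

lemma cl_sign_sym_diff_left: "cl_sign (sym_diff A B) C = cl_sign A C * cl_sign B C"
  unfolding cl_sign_prod by (rule prod_sym_diff) (auto simp flip: prod.distrib intro!: prod.neutral)

lemma cl_sign_sym_diff_right: "cl_sign A (sym_diff B C) = cl_sign A B * cl_sign A C"
  unfolding cl_sign_prod by (subst prod_sym_diff) (auto simp: prod.distrib)

lemma cl_mult_assoc: "(x \<star> y) \<star> z = x \<star> (y \<star> z)"
proof -
  have sd: "sym_diff (sym_diff A B) C = sym_diff A (sym_diff B C)" for A B C :: "'a set"
    by auto
  have b: "(cl_basis A \<star> cl_basis B) \<star> cl_basis C = cl_basis A \<star> (cl_basis B \<star> cl_basis C)"
    for A B C :: "'a set"
    by (simp only: cl_mult_basis cl_mult_scaleR_left cl_mult_scaleR_right scaleR_scaleR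
        cl_sign_sym_diff_left cl_sign_sym_diff_right sd) (simp add: algebra_simps)
  show ?thesis
    by (subst (1 2) cl_expand [of x], subst (1 2) cl_expand [of y], subst (1 2) cl_expand [of z])
      (simp only: cl_mult_sum_left cl_mult_sum_right cl_mult_scaleR_left cl_mult_scaleR_right b)
qed

lemma cl_one_left: "cl_one \<star> x = x"
  by (subst (1 2) cl_expand [of x])
    (simp add: cl_one_def cl_mult_sum_right cl_mult_scaleR_right cl_mult_basis, simp add: cl_sign_def)

lemma cl_one_right: "x \<star> cl_one = x"
  by (subst (1 2) cl_expand [of x])
    (simp add: cl_one_def cl_mult_sum_left cl_mult_scaleR_left cl_mult_basis, simp add: cl_sign_def)

lemma cl_gen_relations:
  "cl_gen a \<star> cl_gen b + cl_gen b \<star> cl_gen a = (if a = b then -2 else 0) *\<^sub>R cl_one"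
proof -
  have s: "cl_sign {a} {b} = (if b \<le> a then -1 else 1)" for a b :: 'a
    by (simp add: cl_sign_prod)
  have "sym_diff {a} {b} = sym_diff {b} {a}"
    by auto
  then show ?thesis
    by (cases "a = b")
      (simp_all add: cl_gen_def cl_one_def cl_mult_basis s vec_eq_iff linorder_not_le less_imp_le)
qed


section \<open>Paravectors\<close>

text \<open>
  The type \<open>'m\<close> stands for the index set \<open>{0, \<dots>, p}\<close>, with least element in the role of the
  index \<open>0\<close>, and \<open>'q\<close> stands for \<open>{p+1, \<dots>, p+q}\<close>. Thus \<open>CARD('m) = p + 1 \<ge> 1\<close> and
  \<open>CARD('q) = q \<ge> 1\<close>, and every \<open>p \<ge> 0\<close>, \<open>q \<ge> 1\<close> arises. The type \<open>('m, 'q) gen\<close> stands for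
  \<open>{1, \<dots>, p+q}\<close>, so \<open>('m, 'q) gen clifford\<close> is the algebra \<open>\<real>\<^bsub>p+q\<^esub>\<close>. The spaces \<open>\<real>\<^bsup>p+q+1\<^esup>\<close> and
  \<open>\<real>\<^bsup>p+2\<^esup>\<close> are \<open>('m, 'q) pv\<close> and \<open>'m hp\<close>.
\<close>

type_synonym ('m, 'q) pv = "(real, 'm) vec \<times> (real, 'q) vec"
type_synonym 'm hp = "(real, 'm) vec \<times> real"

definition ix0 :: "'m::{finite,linorder}" where
  "ix0 = Min UNIV"

typedef (overloaded) ('m::"{finite,linorder}", 'q::"{finite,linorder}") gen =
  "{i :: 'm + 'q. i \<noteq> Inl ix0}"
  by (rule exI [of _ "Inr undefined"]) simp

instance gen :: ("{finite,linorder}", "{finite,linorder}") finite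
proof
  have "inj (Rep_gen :: ('a, 'b) gen \<Rightarrow> _)"
    by (simp add: inj_def Rep_gen_inject)
  then show "finite (UNIV :: ('a, 'b) gen set)"
    by (rule finite_imageD [rotated]) simp
qed

fun sum_le :: "'a::linorder + 'b::linorder \<Rightarrow> 'a + 'b \<Rightarrow> bool" where
  "sum_le (Inl i) (Inl j) = (i \<le> j)"
| "sum_le (Inl i) (Inr j) = True"
| "sum_le (Inr i) (Inl j) = False"
| "sum_le (Inr i) (Inr j) = (i \<le> j)"

lemma sum_le_refl: "sum_le x x"
  by (cases x) auto

lemma sum_le_trans: "sum_le x y \<Longrightarrow> sum_le y z \<Longrightarrow> sum_le x z"
  by (cases x; cases y; cases z) auto

lemma sum_le_antisym: "sum_le x y \<Longrightarrow> sum_le y x \<Longrightarrow> x = y"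
  by (cases x; cases y) auto

lemma sum_le_linear: "sum_le x y \<or> sum_le y x"
  by (cases x; cases y) auto

instantiation gen :: ("{finite,linorder}", "{finite,linorder}") linorder
begin

definition less_eq_gen :: "('a, 'b) gen \<Rightarrow> ('a, 'b) gen \<Rightarrow> bool" where
  "a \<le> b \<longleftrightarrow> sum_le (Rep_gen a) (Rep_gen b)"

definition less_gen :: "('a, 'b) gen \<Rightarrow> ('a, 'b) gen \<Rightarrow> bool" where
  "a < b \<longleftrightarrow> a \<le> b \<and> \<not> b \<le> (a :: ('a, 'b) gen)"

instance
  by standard
    (auto simp: less_eq_gen_def less_gen_def sum_le_refl sum_le_linear
      intro: sum_le_trans sum_le_antisym dest: Rep_gen_inject [THEN iffD1, OF sum_le_antisym])

end

definition eP :: "'m::{finite,linorder} \<Rightarrow> ('m, 'q::{finite,linorder}) gen clifford" where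
  "eP i = (if i = ix0 then cl_one else cl_gen (Abs_gen (Inl i)))"

definition eQ :: "'q::{finite,linorder} \<Rightarrow> ('m::{finite,linorder}, 'q) gen clifford" where
  "eQ j = cl_gen (Abs_gen (Inr j))"

definition para ::
    "('m::{finite,linorder}, 'q::{finite,linorder}) pv \<Rightarrow> ('m, 'q) gen clifford" where
  "para x = (\<Sum>i\<in>UNIV. fst x $ i *\<^sub>R eP i) + (\<Sum>j\<in>UNIV. snd x $ j *\<^sub>R eQ j)"

definition conj_pv ::
    "('m::{finite,linorder}, 'q::finite) pv \<Rightarrow> ('m, 'q) pv" where
  "conj_pv x = ((\<chi> i. if i = ix0 then fst x $ i else - (fst x $ i)), - snd x)"

definition pv_sphere :: "(real^'q) set" where
  "pv_sphere = sphere 0 1"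

text \<open>The identification \<open>(x\<^sub>p, r) \<mapsto> x\<^sub>p + r w\<close>.\<close>

definition lift :: "(real, 'q) vec \<Rightarrow> ('m::finite) hp \<Rightarrow> ('m, 'q::finite) pv" where
  "lift w z = (fst z, snd z *\<^sub>R w)"

definition slice :: "(real, 'q) vec \<Rightarrow> ('m::finite, 'q::finite) pv set \<Rightarrow> 'm hp set" where
  "slice w \<Omega> = {z. lift w z \<in> \<Omega>}"


section \<open>Partial derivatives and monogenic functions\<close>

definition has_partial ::
    "'a::euclidean_space \<Rightarrow> ('a \<Rightarrow> 'b::real_normed_vector) \<Rightarrow> 'a \<Rightarrow> bool" where
  "has_partial b f x \<longleftrightarrow> (\<lambda>t::real. f (x + t *\<^sub>R b)) differentiable (at 0)"

definition partial_deriv ::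
    "'a::euclidean_space \<Rightarrow> ('a \<Rightarrow> 'b::real_normed_vector) \<Rightarrow> 'a \<Rightarrow> 'b" where
  "partial_deriv b f x = vector_derivative (\<lambda>t::real. f (x + t *\<^sub>R b)) (at 0)"

text \<open>Continuous partial derivatives of all orders up to \<open>k\<close>; used for open \<open>W\<close>.\<close>

primrec C_k_on ::
    "nat \<Rightarrow> 'a::euclidean_space set \<Rightarrow> ('a \<Rightarrow> 'b::real_normed_vector) \<Rightarrow> bool" where
  "C_k_on 0 W f \<longleftrightarrow> continuous_on W f"
| "C_k_on (Suc k) W f \<longleftrightarrow> continuous_on W f \<and>
     (\<forall>b\<in>Basis. (\<forall>x\<in>W. has_partial b f x) \<and> C_k_on k W (partial_deriv b f))"

definition smooth_on :: "'a::euclidean_space set \<Rightarrow> ('a \<Rightarrow> 'b::real_normed_vector) \<Rightarrow> bool" where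
  "smooth_on W f \<longleftrightarrow> (\<forall>k. C_k_on k W f)"

definition is_domain :: "'a::topological_space set \<Rightarrow> bool" where
  "is_domain \<Omega> \<longleftrightarrow> \<Omega> \<noteq> {} \<and> open \<Omega> \<and> connected \<Omega>"

definition slice_domain :: "('m::finite, 'q::finite) pv set \<Rightarrow> bool" where
  "slice_domain \<Omega> \<longleftrightarrow> is_domain \<Omega> \<and> (\<exists>x. (x, 0) \<in> \<Omega>) \<and>
     (\<forall>w\<in>pv_sphere. is_domain (slice w \<Omega>))"

definition p_symmetric :: "('m::finite, 'q::finite) pv set \<Rightarrow> bool" where
  "p_symmetric \<Omega> \<longleftrightarrow> (\<forall>x. \<forall>r>0. \<forall>w\<in>pv_sphere.
     (x, r *\<^sub>R w) \<in> \<Omega> \<longrightarrow> (\<forall>\<eta>\<in>pv_sphere. (x, r *\<^sub>R \<eta>) \<in> \<Omega>))"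

definition slice_dirac :: "(real, 'q::{finite,linorder}) vec \<Rightarrow>
    ('m::{finite,linorder} hp \<Rightarrow> ('m, 'q) gen clifford) \<Rightarrow> 'm hp \<Rightarrow> ('m, 'q) gen clifford" where
  "slice_dirac w g z = (\<Sum>i\<in>UNIV. eP i \<star> partial_deriv (axis i 1, 0) g z)
     + para (0, w) \<star> partial_deriv (0, 1) g z"

definition gen_partial_slice_monogenic ::
    "('m::{finite,linorder}, 'q::{finite,linorder}) pv set \<Rightarrow>
     (('m, 'q) pv \<Rightarrow> ('m, 'q) gen clifford) \<Rightarrow> bool" where
  "gen_partial_slice_monogenic \<Omega> f \<longleftrightarrow> is_domain \<Omega> \<and>
     (\<forall>w\<in>pv_sphere. C_k_on 1 (slice w \<Omega>) (\<lambda>z. f (lift w z)) \<and>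
        (\<forall>z\<in>slice w \<Omega>. slice_dirac w (\<lambda>z. f (lift w z)) z = 0))"


section \<open>Cauchy kernel\<close>

text \<open>The exponent \<open>p + 2\<close> is \<open>CARD('m) + 1\<close>.\<close>

definition sigma_const :: "nat \<Rightarrow> real" where
  "sigma_const n = 2 * Gamma (1/2) ^ n / Gamma (real n / 2)"

definition cauchy_E ::
    "('m::{finite,linorder}, 'q::{finite,linorder}) pv \<Rightarrow> ('m, 'q) gen clifford" where
  "cauchy_E x = (1 / sigma_const (CARD('m) + 1)) *\<^sub>R
     ((1 / norm x ^ (CARD('m) + 1)) *\<^sub>R para (conj_pv x))"


section \<open>Smooth boundary, exterior normal and surface element\<close>

definition grad :: "('a::euclidean_space \<Rightarrow> real) \<Rightarrow> 'a \<Rightarrow> 'a" where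
  "grad \<rho> x = (\<Sum>b\<in>Basis. partial_deriv b \<rho> x *\<^sub>R b)"

definition local_defining_function ::
    "'a::euclidean_space set \<Rightarrow> 'a \<Rightarrow> 'a set \<Rightarrow> ('a \<Rightarrow> real) \<Rightarrow> bool" where
  "local_defining_function G y W \<rho> \<longleftrightarrow> open W \<and> y \<in> W \<and> smooth_on W \<rho> \<and>
     (\<forall>x\<in>W. grad \<rho> x \<noteq> 0) \<and>
     G \<inter> W = {x \<in> W. \<rho> x < 0} \<and> frontier G \<inter> W = {x \<in> W. \<rho> x = 0}"

definition smooth_boundary :: "'a::euclidean_space set \<Rightarrow> bool" where
  "smooth_boundary G \<longleftrightarrow> (\<forall>y\<in>frontier G. \<exists>W \<rho>. local_defining_function G y W \<rho>)"

text \<open>The normalised gradient at \<open>y\<close> does not depend on the local defining function.\<close>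

definition exterior_normal :: "'a::euclidean_space set \<Rightarrow> 'a \<Rightarrow> 'a" where
  "exterior_normal G y =
     (THE n. \<exists>W \<rho>. local_defining_function G y W \<rho> \<and> n = sgn (grad \<rho> y))"

text \<open>
  A regular \<open>C\<^sup>1\<close> parametrisation, defined on an open \<open>V\<close>, of a relatively open piece of the
  hypersurface \<open>M\<close>, and its area density, the square root of the Gram determinant of the
  coordinate tangent vectors.
\<close>

definition gram_det :: "((real, 'm) vec \<Rightarrow> 'm::finite hp) \<Rightarrow> (real, 'm) vec \<Rightarrow> real" where
  "gram_det \<phi> u = det (\<chi> i j. partial_deriv (axis i 1) \<phi> u \<bullet> partial_deriv (axis j 1) \<phi> u)"

definition regular_parametrization ::
    "'m::finite hp set \<Rightarrow> (real, 'm) vec set \<Rightarrow> ((real, 'm) vec \<Rightarrow> 'm hp) \<Rightarrow> bool" where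
  "regular_parametrization M V \<phi> \<longleftrightarrow> open V \<and> C_k_on 1 V \<phi> \<and> (\<forall>u\<in>V. gram_det \<phi> u \<noteq> 0) \<and>
     openin (top_of_set M) (\<phi> ` V) \<and> (\<exists>\<psi>. homeomorphism V (\<phi> ` V) \<phi> \<psi>)"

text \<open>
  The surface element of \<open>M\<close> is the Borel measure carried by \<open>M\<close> that is given by the area
  formula in each parametrisation. For the boundaries considered here such a measure exists, and it
  is unique because countably many parametrised pieces cover \<open>M\<close>.
\<close>

definition is_surface_measure :: "'m::finite hp set \<Rightarrow> 'm hp measure \<Rightarrow> bool" where
  "is_surface_measure M \<mu> \<longleftrightarrow> sets \<mu> = sets borel \<and> emeasure \<mu> (- M) = 0 \<and>
     (\<forall>V \<phi>. regular_parametrization M V \<phi> \<longrightarrow> (\<forall>A\<in>sets borel. A \<subseteq> V \<longrightarrow>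
        emeasure \<mu> (\<phi> ` A) = (\<integral>\<^sup>+u\<in>A. ennreal (sqrt (gram_det \<phi> u)) \<partial>lborel)))"

definition surface_measure :: "'m::finite hp set \<Rightarrow> 'm hp measure" where
  "surface_measure M = (SOME \<mu>. is_surface_measure M \<mu>)"

end

(*
  On the slice the claim is the Cauchy formula for a null solution g of a Dirac operator in R^(p+2),
  with Cauchy kernel E. Near each boundary point the domain lies below a graph, in every direction
  transversal to the boundary; Fubini and the one-dimensional fundamental theorem of calculus give the
  divergence theorem in such directions, these span the space, and a partition of unity makes the
  result global. To avoid the singularity at x, the kernel |z|^(-n) conj(z) is replaced inside the
  ball of radius r by k(|z|^2) conj(z) with k continuously differentiable. The divergence theorem then
  equates the boundary integral, which does not depend on r, with the integral of g against a
  nonnegative function of total mass one supported in the ball; letting r tend to 0 gives g(x).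
*)

theory Submission
  imports Defs
begin

section \<open>Continuously differentiable functions and exterior normals\<close>

text \<open>The surface element is chosen among all Borel measures that obey the area formula in
  every regular parametrisation, so nothing is known about it until one such measure has been built.
  It is glued from graphs over finitely many charts; the real work is the comparison of a graph with
  an arbitrary parametrisation. Charts exist only for directions \<open>v\<close> with
  \<open>v \<bullet> grad \<rho> y > 0\<close>. Adding a large multiple of the gradient moves any
  direction, tangential ones included, into this half space, so every direction is a difference of
  two transversal ones. One continuous derivative is all that the divergence theorem asks for. Hence
  the cutoffs are squares of truncated quadratics, and the kernel is continued into the ball by a
  profile that is merely C^1: linear in |z|^2 and tangent to the power at |z| = r. With this choice
  the Dirac derivative inside the ball is a positive multiple of 1 - |z|^2/r^2, whose integral is
  explicit. Its mass is one because \<open>sigma_const n\<close> is n times the volume of the unit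
  ball, where n = p + 2 is \<open>CARD('m) + 1\<close>.\<close>

lemma has_derivative_imp_partial:
  fixes f :: "'a::euclidean_space \<Rightarrow> 'b::real_normed_vector"
  assumes "(f has_derivative f') (at x)"
  shows "has_partial b f x" "partial_deriv b f x = f' b"
proof -
  interpret bounded_linear f' using assms by (rule has_derivative_bounded_linear)
  have "((\<lambda>t::real. f (x + t *\<^sub>R b)) has_derivative (\<lambda>t. f' (t *\<^sub>R b))) (at 0)"
    by (rule has_derivative_compose [of "\<lambda>t. x + t *\<^sub>R b" "\<lambda>t. t *\<^sub>R b" 0 UNIV f f'])
      (use assms in \<open>auto intro!: derivative_eq_intros\<close>)
  then have *: "((\<lambda>t::real. f (x + t *\<^sub>R b)) has_vector_derivative f' b) (at 0)"
    by (simp add: has_vector_derivative_def scaleR)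
  show "has_partial b f x"
    unfolding has_partial_def using * by (rule differentiableI_vector)
  show "partial_deriv b f x = f' b"
    unfolding partial_deriv_def using * by (rule vector_derivative_at)
qed

text \<open>Partial derivatives are defined at parameter value 0 of a line through the point.
  Shifting the parameter gives derivatives along a whole line, which the mean value inequality
  needs.\<close>

lemma has_partial_vector_derivative:
  assumes "has_partial b f (p + t *\<^sub>R b)"
  shows "((\<lambda>t. f (p + t *\<^sub>R b)) has_vector_derivative partial_deriv b f (p + t *\<^sub>R b)) (at t)"
proof -
  have "((\<lambda>s. f (p + t *\<^sub>R b + s *\<^sub>R b)) has_vector_derivative partial_deriv b f (p + t *\<^sub>R b)) (at (t - t))"
    using assms unfolding has_partial_def partial_deriv_def by (simp add: vector_derivative_works)
  then have "((\<lambda>s. f (p + t *\<^sub>R b + s *\<^sub>R b)) \<circ> (\<lambda>s. s - t) has_vector_derivative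
      1 *\<^sub>R partial_deriv b f (p + t *\<^sub>R b)) (at t)"
    by (intro vector_diff_chain_at) (auto intro!: derivative_eq_intros)
  then show ?thesis
    by (simp add: o_def algebra_simps)
qed

lemma C_1_onD:
  assumes "C_k_on 1 W f"
  shows "continuous_on W f"
    and "\<And>b x. b \<in> Basis \<Longrightarrow> x \<in> W \<Longrightarrow> has_partial b f x"
    and "\<And>b. b \<in> Basis \<Longrightarrow> continuous_on W (partial_deriv b f)"
  using assms by simp_all

text \<open>The increment is made one coordinate at a time, and the mean value inequality is applied
  on each axis-parallel segment. The bound on the sum of the \<open>\<bar>c b\<bar>\<close> keeps
  the whole path inside the ball where the partial derivatives are close to those at
  \<open>x\<close>.\<close>

lemma C_1_on_partials_estimate:
  fixes f :: "'a::euclidean_space \<Rightarrow> 'b::real_normed_vector"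
  assumes "\<And>b y. b \<in> Basis \<Longrightarrow> dist y x < d \<Longrightarrow> has_partial b f y"
    and near: "\<And>b y. b \<in> Basis \<Longrightarrow> dist y x < d \<Longrightarrow> norm (partial_deriv b f y - partial_deriv b f x) \<le> e"
    and "finite S" "S \<subseteq> Basis" "(\<Sum>b\<in>S. \<bar>c b\<bar>) < d"
  shows "norm (f (x + (\<Sum>b\<in>S. c b *\<^sub>R b)) - f x - (\<Sum>b\<in>S. c b *\<^sub>R partial_deriv b f x))
           \<le> e * (\<Sum>b\<in>S. \<bar>c b\<bar>)"
  using assms(3-5)
proof (induction S rule: finite_induct)
  case empty
  then show ?case by simp
next
  case (insert b S)
  define p where "p = x + (\<Sum>b\<in>S. c b *\<^sub>R b)"
  have b: "b \<in> Basis" and le: "(\<Sum>b\<in>S. \<bar>c b\<bar>) + \<bar>c b\<bar> < d"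
    using insert by (auto simp: add.commute)
  have IH: "norm (f p - f x - (\<Sum>b\<in>S. c b *\<^sub>R partial_deriv b f x)) \<le> e * (\<Sum>b\<in>S. \<bar>c b\<bar>)"
    unfolding p_def using insert by auto
  have px: "norm (p - x) \<le> (\<Sum>b\<in>S. \<bar>c b\<bar>)"
    unfolding p_def using insert.prems by (auto intro!: sum_norm_le)
  have inball: "dist (p + t *\<^sub>R b) x < d" if "\<bar>t\<bar> \<le> \<bar>c b\<bar>" for t
  proof -
    have "norm (p + t *\<^sub>R b - x) \<le> norm (p - x) + norm (t *\<^sub>R b)"
      by (metis add_diff_eq add.commute norm_triangle_ineq)
    also have "\<dots> \<le> (\<Sum>b\<in>S. \<bar>c b\<bar>) + \<bar>c b\<bar>"
      using px that b by (simp add: add_mono)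
    finally show ?thesis using le by (simp add: dist_norm)
  qed
  have "norm (f (p + c b *\<^sub>R b) - f (p + 0 *\<^sub>R b) - (c b - 0) *\<^sub>R partial_deriv b f x) \<le> norm (c b - 0) * e"
  proof -
    \<comment> \<open>Subtracting the linear term first turns the closeness of the partial
      derivatives into a bound \<open>e\<close> on the derivative of a single function.\<close>
    have "((\<lambda>t. f (p + t *\<^sub>R b) - t *\<^sub>R partial_deriv b f x) has_derivative
        (\<lambda>h. h *\<^sub>R (partial_deriv b f (p + t *\<^sub>R b) - partial_deriv b f x))) (at t within closed_segment 0 (c b))"
      if "t \<in> closed_segment 0 (c b)" for t
      unfolding has_vector_derivative_def [symmetric]
      by (rule has_vector_derivative_at_within)
        (use that b in \<open>auto intro!: derivative_eq_intros has_partial_vector_derivative assms(1) inball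
          simp: closed_segment_eq_real_ivl split: if_splits\<close>)
    then have "norm ((f (p + c b *\<^sub>R b) - c b *\<^sub>R partial_deriv b f x) - (f (p + 0 *\<^sub>R b) - 0 *\<^sub>R partial_deriv b f x)) \<le> e * norm (c b - 0)"
    proof (rule differentiable_bound [OF convex_closed_segment])
      show "onorm (\<lambda>h. h *\<^sub>R (partial_deriv b f (p + t *\<^sub>R b) - partial_deriv b f x)) \<le> e"
        if "t \<in> closed_segment 0 (c b)" for t
        using near [OF b inball, of t] that
        by (auto intro!: onorm_le simp: closed_segment_eq_real_ivl mult.commute [of e] mult_left_mono split: if_splits)
    qed auto
    then show ?thesis by (simp add: algebra_simps)
  qed
  then have "norm (f (p + c b *\<^sub>R b) - f p - c b *\<^sub>R partial_deriv b f x) \<le> e * \<bar>c b\<bar>"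
    by (simp add: mult.commute)
  with IH have "norm ((f (p + c b *\<^sub>R b) - f p - c b *\<^sub>R partial_deriv b f x) +
      (f p - f x - (\<Sum>b\<in>S. c b *\<^sub>R partial_deriv b f x))) \<le> e * \<bar>c b\<bar> + e * (\<Sum>b\<in>S. \<bar>c b\<bar>)"
    by (intro norm_triangle_le) linarith
  moreover have "p + c b *\<^sub>R b = x + (\<Sum>b\<in>insert b S. c b *\<^sub>R b)"
    using insert.hyps by (simp add: p_def algebra_simps)
  ultimately show ?case
    using insert.hyps by (simp add: algebra_simps)
qed

text \<open>Smoothness is defined through partial derivatives only; this passes to the total
  derivative, so that the chain rule becomes available.\<close>

lemma C_1_on_has_derivative:
  fixes f :: "'a::euclidean_space \<Rightarrow> 'b::real_normed_vector"
  assumes "C_k_on 1 W f" "open W" "x \<in> W"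
  shows "(f has_derivative (\<lambda>v. \<Sum>b\<in>Basis. (v \<bullet> b) *\<^sub>R partial_deriv b f x)) (at x)"
proof -
  let ?F = "\<lambda>v. \<Sum>b\<in>Basis. (v \<bullet> b) *\<^sub>R partial_deriv b f x"
  note D = C_1_onD [OF assms(1)]
  have "\<exists>d>0. \<forall>y. norm (y - x) < d \<longrightarrow> norm (f y - f x - ?F (y - x)) \<le> e * norm (y - x)" if "e > 0" for e
  proof -
    \<comment> \<open>The sum of the absolute coordinates is at most \<open>N\<close> times the
      norm. Hence the accuracy \<open>e / N\<close> for the partial derivatives and the radius
      \<open>d / N\<close>.\<close>
    define N where "N = real DIM('a)"
    have N: "N > 0" by (simp add: N_def)
    have "eventually (\<lambda>y. norm (partial_deriv b f y - partial_deriv b f x) < e / N) (at x)" if "b \<in> Basis" for b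
    proof -
      have "isCont (partial_deriv b f) x"
        using D(3) [OF that] assms(2,3) continuous_on_eq_continuous_at by blast
      then have "(partial_deriv b f \<longlongrightarrow> partial_deriv b f x) (at x)"
        by (simp add: isCont_def)
      then show ?thesis
        using \<open>e > 0\<close> N by (auto simp: tendsto_iff dist_norm)
    qed
    then have "eventually (\<lambda>y. \<forall>b\<in>Basis. norm (partial_deriv b f y - partial_deriv b f x) < e / N) (at x)"
      by (simp add: eventually_ball_finite_distrib)
    moreover have "eventually (\<lambda>y. y \<in> W) (at x)"
      using assms(2,3) by (rule eventually_at_in_open')
    ultimately have "eventually (\<lambda>y. y \<in> W \<and> (\<forall>b\<in>Basis. norm (partial_deriv b f y - partial_deriv b f x) < e / N)) (at x)"
      by eventually_elim auto
    then obtain d where "d > 0" and d': "\<And>y. y \<noteq> x \<Longrightarrow> dist y x < d \<Longrightarrow>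
        y \<in> W \<and> (\<forall>b\<in>Basis. norm (partial_deriv b f y - partial_deriv b f x) < e / N)"
      unfolding eventually_at by blast
    have d: "y \<in> W" "\<And>b. b \<in> Basis \<Longrightarrow> norm (partial_deriv b f y - partial_deriv b f x) \<le> e / N" if "dist y x < d" for y
      using d' [of y] that assms(3) \<open>e > 0\<close> N by (cases "y = x"; force simp: less_imp_le)+
    have "norm (f y - f x - ?F (y - x)) \<le> e * norm (y - x)" if y: "norm (y - x) < d / N" for y
    proof -
      have "(\<Sum>b\<in>Basis. \<bar>(y - x) \<bullet> b\<bar>) \<le> (\<Sum>b\<in>(Basis::'a set). norm (y - x))"
        by (intro sum_mono) (simp add: Basis_le_norm)
      then have le: "(\<Sum>b\<in>Basis. \<bar>(y - x) \<bullet> b\<bar>) \<le> N * norm (y - x)"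
        by (simp add: N_def)
      also have "\<dots> < d"
        using y N by (simp add: field_simps)
      finally have "norm (f (x + (\<Sum>b\<in>Basis. ((y - x) \<bullet> b) *\<^sub>R b)) - f x - ?F (y - x))
          \<le> (e / N) * (\<Sum>b\<in>Basis. \<bar>(y - x) \<bullet> b\<bar>)"
        by (intro C_1_on_partials_estimate [where d = d] D(2) d) auto
      also have "\<dots> \<le> (e / N) * (N * norm (y - x))"
        using le \<open>e > 0\<close> N by (intro mult_left_mono) auto
      finally show ?thesis
        using N by (simp add: euclidean_representation)
    qed
    then show ?thesis
      using \<open>d > 0\<close> N by (intro exI [of _ "d / N"]) auto
  qed
  moreover have "bounded_linear ?F"
    by (intro bounded_linear_sum bounded_linear_scaleR_const bounded_linear_inner_left)
  ultimately show ?thesis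
    by (simp add: has_derivative_at_alt)
qed

lemma C_1_onI:
  fixes f :: "'a::euclidean_space \<Rightarrow> 'b::real_normed_vector"
  assumes "\<And>x. x \<in> W \<Longrightarrow> (f has_derivative f' x) (at x)"
    and "\<And>b. b \<in> Basis \<Longrightarrow> continuous_on W (\<lambda>x. f' x b)"
  shows "C_k_on 1 W f"
proof -
  have "continuous_on W f"
    by (meson assms(1) has_derivative_continuous_on has_derivative_at_withinI)
  moreover have "has_partial b f x" if "x \<in> W" for b x
    using assms(1) [OF that] by (rule has_derivative_imp_partial)
  moreover have "continuous_on W (partial_deriv b f)" if "b \<in> Basis" for b
    using assms(2) [OF that] by (rule continuous_on_eq) (simp add: has_derivative_imp_partial(2) [OF assms(1)])
  ultimately show ?thesis by simp
qed

section \<open>Defining functions and the uniqueness of the exterior normal\<close>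

lemma local_defining_functionD:
  fixes G :: "'a::euclidean_space set"
  assumes "local_defining_function G y W \<rho>"
  shows "open W" "y \<in> W" "C_k_on 1 W \<rho>"
    and "\<And>x. x \<in> W \<Longrightarrow> grad \<rho> x \<noteq> 0"
    and "\<And>x. x \<in> W \<Longrightarrow> x \<in> G \<longleftrightarrow> \<rho> x < 0"
    and "\<And>x. x \<in> W \<Longrightarrow> x \<in> frontier G \<longleftrightarrow> \<rho> x = 0"
  using assms unfolding local_defining_function_def smooth_on_def by blast+

lemma local_defining_function_mono:
  fixes G :: "'a::euclidean_space set"
  assumes "local_defining_function G y W \<rho>" "x \<in> W"
  shows "local_defining_function G x W \<rho>"
  using assms unfolding local_defining_function_def by blast

lemma C_1_on_has_derivative_grad:
  fixes \<rho> :: "'a::euclidean_space \<Rightarrow> real"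
  assumes "C_k_on 1 W \<rho>" "open W" "x \<in> W"
  shows "(\<rho> has_derivative (\<lambda>v. v \<bullet> grad \<rho> x)) (at x)"
  using C_1_on_has_derivative [OF assms] by (simp add: grad_def inner_sum_right mult.commute)

lemma C_1_on_continuous_grad:
  fixes \<rho> :: "'a::euclidean_space \<Rightarrow> real"
  assumes "C_k_on 1 W \<rho>"
  shows "continuous_on W (grad \<rho>)"
  unfolding grad_def [abs_def] by (intro continuous_intros C_1_onD(3) [OF assms])

text \<open>Along the line through \<open>y\<close> in direction \<open>v\<close> the defining
  function vanishes at \<open>y\<close> with positive slope, so it changes sign there. The
  conclusion mentions \<open>G\<close> only, which allows two defining functions to be
  compared.\<close>

lemma local_defining_function_sides:
  fixes G :: "'a::euclidean_space set"
  assumes "local_defining_function G y W \<rho>" "y \<in> frontier G" "v \<bullet> grad \<rho> y > 0"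
  shows "eventually (\<lambda>t. y - t *\<^sub>R v \<in> G \<and> y + t *\<^sub>R v \<notin> G) (at_right 0)"
proof -
  note D = local_defining_functionD [OF assms(1)]
  have "(\<rho> has_derivative (\<lambda>v. v \<bullet> grad \<rho> y)) (at y)"
    using D C_1_on_has_derivative_grad by blast
  then have 1: "(\<rho> has_derivative (\<lambda>v. v \<bullet> grad \<rho> y)) (at (y + 0 *\<^sub>R v))"
    by simp
  have "((\<lambda>t. y + t *\<^sub>R v) has_derivative (\<lambda>t. t *\<^sub>R v)) (at 0)"
    by (auto intro!: derivative_eq_intros)
  from has_derivative_compose [OF this 1]
  have "((\<lambda>t. \<rho> (y + t *\<^sub>R v)) has_derivative (\<lambda>t. t * (v \<bullet> grad \<rho> y))) (at 0)"
    unfolding inner_scaleR_left .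
  then have der: "DERIV (\<lambda>t. \<rho> (y + t *\<^sub>R v)) 0 :> v \<bullet> grad \<rho> y"
    by (simp add: has_field_derivative_def mult_commute_abs)
  have \<rho>0: "\<rho> y = 0" using D assms(2) by blast
  obtain d1 where d1: "d1 > 0" "\<And>h. h > 0 \<Longrightarrow> h < d1 \<Longrightarrow> 0 < \<rho> (y + h *\<^sub>R v)"
    using DERIV_pos_inc_right [OF der assms(3)] \<rho>0 by auto
  obtain d2 where d2: "d2 > 0" "\<And>h. h > 0 \<Longrightarrow> h < d2 \<Longrightarrow> \<rho> (y - h *\<^sub>R v) < 0"
    using DERIV_pos_inc_left [OF der assms(3)] \<rho>0 by auto
  have "((\<lambda>t. y + t *\<^sub>R v) \<longlongrightarrow> y + 0 *\<^sub>R v) (at_right 0)" "((\<lambda>t. y - t *\<^sub>R v) \<longlongrightarrow> y - 0 *\<^sub>R v) (at_right 0)"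
    by (intro tendsto_intros)+
  then have "eventually (\<lambda>t. y + t *\<^sub>R v \<in> W) (at_right 0)" "eventually (\<lambda>t. y - t *\<^sub>R v \<in> W) (at_right 0)"
    using D(1,2) by (auto dest!: topological_tendstoD)
  moreover have "eventually (\<lambda>t. t \<in> {0<..<min d1 d2}) (at_right (0::real))"
    using d1(1) d2(1) by (intro eventually_at_right_real) auto
  ultimately show ?thesis
  proof eventually_elim
    case (elim t)
    then show ?case using d1(2) [of t] d2(2) [of t] D(5) by (auto simp: not_less less_imp_le)
  qed
qed

text \<open>The definite description needs uniqueness. If two unit normals \<open>n1\<close> and
  \<open>n\<close> differed, the direction \<open>n1 - n\<close> would have positive product with
  the first gradient and negative product with the second. Short steps along it would then leave
  \<open>G\<close> by one defining function and enter \<open>G\<close> by the other.\<close>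

lemma exterior_normal_eq:
  fixes G :: "'a::euclidean_space set"
  assumes "local_defining_function G y W \<rho>" "y \<in> frontier G"
  shows "exterior_normal G y = sgn (grad \<rho> y)"
  unfolding exterior_normal_def
proof (rule the_equality)
  show "\<exists>W' \<rho>'. local_defining_function G y W' \<rho>' \<and> sgn (grad \<rho> y) = sgn (grad \<rho>' y)"
    using assms by blast
next
  fix n assume "\<exists>W \<rho>. local_defining_function G y W \<rho> \<and> n = sgn (grad \<rho> y)"
  then obtain W' \<rho>' where 1: "local_defining_function G y W' \<rho>'" and n: "n = sgn (grad \<rho>' y)"
    by blast
  define n1 where "n1 = sgn (grad \<rho> y)"
  have nz: "grad \<rho> y \<noteq> 0" "grad \<rho>' y \<noteq> 0"
    using local_defining_functionD [OF assms(1)] local_defining_functionD [OF 1] by blast+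
  then have norms: "norm n1 = 1" "norm n = 1"
    by (simp_all add: n1_def n norm_sgn)
  show "n = sgn (grad \<rho> y)"
  proof (rule ccontr)
    assume "n \<noteq> sgn (grad \<rho> y)"
    then have "0 < (norm (n - n1))\<^sup>2"
      by (simp add: n1_def)
    also have "\<dots> = 2 - 2 * (n \<bullet> n1)"
      by (simp add: power2_norm_eq_inner algebra_simps inner_commute) (simp add: norms flip: power2_norm_eq_inner)
    finally have lt: "n \<bullet> n1 < 1" by simp
    have "n1 \<bullet> n1 = 1" "n \<bullet> n = 1"
      using norms by (simp_all flip: power2_norm_eq_inner)
    then have "0 < (n1 - n) \<bullet> n1" "0 < (n - n1) \<bullet> n"
      using lt by (simp_all add: algebra_simps inner_commute)
    then have "0 < (n1 - n) \<bullet> grad \<rho> y" "0 < (n - n1) \<bullet> grad \<rho>' y"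
      using nz by (simp_all add: n1_def n sgn_div_norm zero_less_mult_iff)
    from eventually_conj [OF local_defining_function_sides [OF assms this(1)]
         local_defining_function_sides [OF 1 assms(2) this(2)]]
    have "eventually (\<lambda>t. False) (at_right (0::real))"
      by eventually_elim (auto simp: algebra_simps)
    then show False by simp
  qed
qed

text \<open>One defining function serves all boundary points near a given one, so locally the normal
  is a normalised continuous gradient. This makes the boundary integrands measurable.\<close>

lemma continuous_on_exterior_normal:
  fixes G :: "'a::euclidean_space set"
  assumes "smooth_boundary G"
  shows "continuous_on (frontier G) (exterior_normal G)"
proof -
  have "continuous (at y within frontier G) (exterior_normal G)" if y: "y \<in> frontier G" for y
  proof -
    obtain W \<rho> where L: "local_defining_function G y W \<rho>"
      using assms y unfolding smooth_boundary_def by blast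
    note D = local_defining_functionD [OF L]
    have "continuous_on (frontier G \<inter> W) (\<lambda>x. sgn (grad \<rho> x))"
      by (intro continuous_intros continuous_on_subset [OF C_1_on_continuous_grad [OF D(3)]])
        (auto simp: D(4))
    then have "continuous_on (frontier G \<inter> W) (exterior_normal G)"
      by (rule continuous_on_eq)
        (simp add: exterior_normal_eq [OF local_defining_function_mono [OF L]])
    then have "continuous (at y within frontier G \<inter> W) (exterior_normal G)"
      using y D(2) by (simp add: continuous_on_eq_continuous_within)
    moreover have "at y within frontier G \<inter> W = at y within frontier G"
      using D(1,2) by (intro at_within_nhd [of y W]) auto
    ultimately show ?thesis
      by (simp add: continuous_within)
  qed
  then show ?thesis
    by (simp add: continuous_on_eq_continuous_within)
qed


section \<open>Local graph representation of a smooth boundary\<close>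

text \<open>The map is the reflection in the hyperplane orthogonal to \<open>a - b\<close>; for
  \<open>a = b\<close> the convention \<open>x / 0 = 0\<close> turns the formula into the identity.
  An involution is its own inverse, and being orthogonal it is self-adjoint, which saves a separate
  inverse later.\<close>

lemma ex_isometry_involution:
  fixes a b :: "'a::euclidean_space"
  assumes "norm a = norm b"
  obtains R :: "'a \<Rightarrow> 'a" where "orthogonal_transformation R" "\<And>x. R (R x) = x" "R a = b"
proof
  define v where "v = a - b"
  define R where "R x = x - (2 * (x \<bullet> v) / (v \<bullet> v)) *\<^sub>R v" for x
  have ab: "a \<bullet> a = b \<bullet> b" using assms by (simp add: norm_eq)
  have inner: "R x \<bullet> R y = x \<bullet> y" for x y
    by (cases "v = 0") (simp_all add: R_def algebra_simps inner_commute)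
  have "linear R"
    by (intro linearI) (simp_all add: R_def algebra_simps add_divide_distrib)
  with inner show "orthogonal_transformation R"
    by (simp add: orthogonal_transformation_def)
  show "R (R x) = x" for x
    by (cases "v = 0") (simp_all add: R_def algebra_simps)
  show "R a = b"
  proof (cases "v = 0")
    case False
    have "v \<bullet> v = 2 * (a \<bullet> v)"
      using ab by (simp add: v_def algebra_simps inner_commute)
    then have "2 * (a \<bullet> v) / (v \<bullet> v) = (v \<bullet> v) / (v \<bullet> v)" by (simp only:)
    also have "\<dots> = 1" using False by simp
    finally have "2 * (a \<bullet> v) / (v \<bullet> v) = 1" .
    then have "R a = a - v" by (simp only: R_def scaleR_one)
    then show ?thesis by (simp add: v_def)
  qed (simp add: R_def v_def)
qed

section \<open>Gram determinants of graphs and of compositions\<close>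

text \<open>Conjugation by an orthogonal map that sends \<open>v\<close> to a multiple of a
  coordinate vector makes the matrix diagonal, with one entry \<open>1 + (norm v)\<^sup>2\<close>
  and ones elsewhere.\<close>

lemma det_id_plus_rank_one:
  fixes v :: "real^'m"
  shows "det (\<chi> i j. (if i = j then 1 else 0) + v $ i * v $ j) = 1 + (norm v)\<^sup>2"
proof -
  note [simp del] = transpose_matrix_vector
  fix k :: 'm
  have "norm v = norm (norm v *\<^sub>R axis k (1::real))" by simp
  then obtain Q where Q: "orthogonal_transformation Q" "Q v = norm v *\<^sub>R axis k (1::real)"
    by (rule orthogonal_transformation_exists)
  have orth: "orthogonal_matrix (matrix Q)" and lin: "linear Q"
    using Q(1) orthogonal_transformation_matrix by blast+
  have Qv: "matrix Q *v x = Q x" for x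
    using lin by (simp add: matrix_works linear_matrix_vector_mul_eq)
  define A where "A = (\<chi> i j. (if i = j then 1 else 0) + v $ i * v $ j)"
  define B where "B = matrix Q ** A ** transpose (matrix Q)"
  have Av: "A *v x = x + (v \<bullet> x) *\<^sub>R v" for x
  proof -
    have "(\<Sum>j\<in>UNIV. x $ j * (if i = j then 1 else 0)) = x $ i" for i
      by (simp add: if_distrib cong: if_cong)
    then show ?thesis
      by (simp add: A_def matrix_vector_mult_def vec_eq_iff inner_vec_def algebra_simps sum.distrib sum_distrib_left)
  qed
  have QQ: "Q (transpose (matrix Q) *v x) = x" for x
  proof -
    have "Q (transpose (matrix Q) *v x) = (matrix Q ** transpose (matrix Q)) *v x"
      by (simp only: Qv [symmetric] matrix_vector_mul_assoc)
    then show ?thesis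
      using orth by (simp add: orthogonal_matrix_def)
  qed
  have Bx: "B *v x = x + ((norm v)\<^sup>2 * x $ k) *\<^sub>R axis k 1" for x
  proof -
    let ?y = "transpose (matrix Q) *v x"
    have "B *v x = Q (A *v ?y)"
      by (simp add: B_def Qv flip: matrix_vector_mul_assoc)
    also have "\<dots> = x + (v \<bullet> ?y) *\<^sub>R Q v"
      using lin by (simp add: Av linear_add linear_scale QQ)
    also have "v \<bullet> ?y = Q v \<bullet> x"
      using Q(1) QQ [of x] by (metis orthogonal_transformation_def)
    finally show ?thesis
      by (simp add: Q(2) power2_eq_square inner_axis' mult.assoc mult.commute)
  qed
  have Bij: "B $ i $ j = (if i = j then if i = k then 1 + (norm v)\<^sup>2 else 1 else 0)" for i j
  proof -
    have "B $ i $ j = (B *v axis j 1) $ i"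
      by (simp add: matrix_vector_mul_component inner_axis)
    then show ?thesis by (auto simp: Bx axis_def)
  qed
  have "det B = (\<Prod>i\<in>UNIV. if i = k then 1 + (norm v)\<^sup>2 else 1)"
    by (subst det_diagonal) (auto simp: Bij)
  also have "\<dots> = 1 + (norm v)\<^sup>2" by simp
  finally have "det B = 1 + (norm v)\<^sup>2" .
  moreover have "det B = (det (matrix Q))\<^sup>2 * det A"
    by (simp add: B_def det_mul det_transpose power2_eq_square)
  moreover have "(det (matrix Q))\<^sup>2 = 1"
    using det_orthogonal_matrix [OF orth] by auto
  ultimately show ?thesis by (simp add: A_def)
qed

lemma gram_det_eq:
  assumes "(\<phi> has_derivative \<phi>') (at u)"
  shows "gram_det \<phi> u = det (\<chi> i j. \<phi>' (axis i 1) \<bullet> \<phi>' (axis j 1))"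
  by (simp add: gram_det_def has_derivative_imp_partial(2) [OF assms])

lemma gram_det_graph:
  fixes R :: "'m::finite hp \<Rightarrow> 'm hp"
  assumes R: "orthogonal_transformation R" and h: "(h has_derivative (\<lambda>v. v \<bullet> a)) (at u)"
  shows "((\<lambda>u. R (u, h u)) has_derivative (\<lambda>v. R (v, v \<bullet> a))) (at u)"
    and "gram_det (\<lambda>u. R (u, h u)) u = 1 + (norm a)\<^sup>2"
proof -
  have bl: "bounded_linear R"
    using R by (simp add: orthogonal_transformation_def linear_conv_bounded_linear)
  show der: "((\<lambda>u. R (u, h u)) has_derivative (\<lambda>v. R (v, v \<bullet> a))) (at u)"
    by (intro bounded_linear.has_derivative [OF bl] has_derivative_Pair has_derivative_ident h)
  have "R (axis i 1, axis i 1 \<bullet> a) \<bullet> R (axis j 1, axis j 1 \<bullet> a) = (if i = j then 1 else 0) + a $ i * a $ j" for i j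
    using R by (simp add: orthogonal_transformation_def inner_axis')
      (simp add: axis_def)
  then show "gram_det (\<lambda>u. R (u, h u)) u = 1 + (norm a)\<^sup>2"
    by (simp add: gram_det_eq [OF der] det_id_plus_rank_one)
qed

text \<open>By the chain rule the Gram matrix of the composition is the congruence of the Gram
  matrix of \<open>\<phi>\<close> by the Jacobian matrix of \<open>T\<close>.\<close>

lemma gram_det_compose:
  fixes T :: "real^'m \<Rightarrow> real^'m" and \<phi> :: "real^'m \<Rightarrow> 'm hp"
  assumes T: "(T has_derivative T') (at u)" and \<phi>: "(\<phi> has_derivative \<phi>') (at (T u))"
  shows "gram_det (\<lambda>u. \<phi> (T u)) u = (det (matrix T'))\<^sup>2 * gram_det \<phi> (T u)"
proof -
  interpret \<phi>': bounded_linear \<phi>' using \<phi> by (rule has_derivative_bounded_linear)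
  let ?M = "matrix T'"
  let ?G = "\<chi> k l. \<phi>' (axis k 1) \<bullet> \<phi>' (axis l 1)"
  have T'j: "T' (axis j 1) = (\<Sum>k\<in>UNIV. ?M $ k $ j *\<^sub>R axis k 1)" for j
    by (simp add: matrix_def vec_eq_iff axis_def if_distrib cong: if_cong)
  have "(\<chi> i j. \<phi>' (T' (axis i 1)) \<bullet> \<phi>' (T' (axis j 1))) = transpose ?M ** ?G ** ?M"
    by (simp add: T'j \<phi>'.sum \<phi>'.scaleR vec_eq_iff matrix_matrix_mult_def transpose_def inner_sum_left inner_sum_right
        sum_distrib_left sum_distrib_right algebra_simps)
  then show ?thesis
    by (simp add: gram_det_eq [OF \<phi>] gram_det_eq [OF has_derivative_compose [OF T \<phi>]]
      det_mul det_transpose power2_eq_square)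
qed


section \<open>Graph charts and the implicit function\<close>

text \<open>\<open>R\<close> turns the last coordinate axis into the chosen direction
  \<open>R (0, 1)\<close>; inside the cylinder over \<open>D\<close> the set \<open>G\<close> is the
  part strictly below the graph of \<open>h\<close>. The last clause says that the area density is
  the reciprocal of the cosine between normal and direction, which is what makes both cancel in the
  boundary integral.\<close>

definition graph_chart ::
    "'m::finite hp set \<Rightarrow> ('m hp \<Rightarrow> 'm hp) \<Rightarrow> (real^'m) set \<Rightarrow> real \<Rightarrow> real \<Rightarrow> (real^'m \<Rightarrow> real) \<Rightarrow> bool" where
  "graph_chart G R D \<alpha> \<beta> h \<longleftrightarrow> orthogonal_transformation R \<and> (\<forall>x. R (R x) = x) \<and> open D \<and> C_k_on 1 D h \<and>
     (\<forall>u\<in>D. \<alpha> < h u \<and> h u < \<beta>) \<and>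
     (\<forall>u\<in>D. \<forall>t\<in>{\<alpha><..<\<beta>}. (R (u, t) \<in> G \<longleftrightarrow> t < h u) \<and> (R (u, t) \<in> frontier G \<longleftrightarrow> t = h u)) \<and>
     (\<forall>u\<in>D. exterior_normal G (R (u, h u)) \<bullet> R (0, 1) * sqrt (gram_det (\<lambda>u. R (u, h u)) u) = 1)"

text \<open>In coordinates turned by \<open>R\<close> the defining function increases strictly in
  the last variable near \<open>y\<close>. Monotonicity gives uniqueness of its zero on each
  vertical segment, the intermediate value theorem gives existence, and the differentiability of the
  zero comes from the inverse of a straightening map.\<close>

lemma ex_graph_chart:
  fixes G :: "'m::finite hp set"
  assumes L: "local_defining_function G y W \<rho>" and y: "y \<in> frontier G"
    and b: "norm b = 1" "b \<bullet> grad \<rho> y > 0"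
  obtains R D \<alpha> \<beta> h where "graph_chart G R D \<alpha> \<beta> h" "R (0, 1) = b" "y \<in> R ` (D \<times> {\<alpha><..<\<beta>})"
proof -
  note LD = local_defining_functionD [OF L]
  have "norm ((0, 1) :: 'm hp) = norm b"
    using b by (simp add: norm_Pair)
  then obtain R :: "'m hp \<Rightarrow> 'm hp" where R: "orthogonal_transformation R" and RR: "\<And>x. R (R x) = x" and Rb: "R (0, 1) = b"
    by (rule ex_isometry_involution) (rule that)
  have lin: "linear R" using R by (simp add: orthogonal_transformation_def)
  have Rinner: "R v \<bullet> w = v \<bullet> R w" for v w
    using R RR [of w] by (metis orthogonal_transformation_def)
  have contR: "continuous_on X R" for X
    using lin by (simp add: linear_continuous_on linear_conv_bounded_linear)
  define W' where "W' = R -` W"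
  have W'o: "open W'"
    unfolding W'_def by (rule open_vimage [OF LD(1) contR])
  define g where "g z = R (grad \<rho> (R z))" for z
  define r where "r z = \<rho> (R z)" for z
  have der: "(r has_derivative (\<lambda>v. v \<bullet> g z)) (at z)" if "z \<in> W'" for z
  proof -
    have "(\<rho> has_derivative (\<lambda>v. v \<bullet> grad \<rho> (R z))) (at (R z))"
      using that LD by (intro C_1_on_has_derivative_grad) (auto simp: W'_def)
    from has_derivative_compose [OF linear_imp_has_derivative [OF lin] this] show ?thesis
      by (simp add: r_def [abs_def] g_def Rinner)
  qed
  have contg: "continuous_on W' g"
    unfolding g_def [abs_def] W'_def
    by (intro continuous_on_compose2 [OF contR [of UNIV]] continuous_on_compose2 [OF C_1_on_continuous_grad [OF LD(3)]] contR) auto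
  have contr: "continuous_on W' r"
    by (rule has_derivative_continuous_on) (rule has_derivative_at_withinI [OF der])
  obtain u0 t0 where z0: "R y = (u0, t0)" by (cases "R y")
  have z0W: "(u0, t0) \<in> W'"
    using LD(2) RR by (simp add: W'_def flip: z0)
  have "snd (g (u0, t0)) = (0, 1) \<bullet> g (R y)"
    by (simp add: z0 inner_prod_def)
  also have "\<dots> = b \<bullet> grad \<rho> y"
    by (simp add: g_def RR flip: Rinner Rb)
  finally have pos0: "snd (g (u0, t0)) > 0" using b by simp
  have "open {z \<in> W'. snd (g z) \<in> {0<..}}"
    by (rule continuous_open_preimage [OF _ W'o, unfolded vimage_def Int_def mem_Collect_eq]) (intro continuous_intros contg, simp)
  then obtain A B where AB: "open A" "open B" "(u0, t0) \<in> A \<times> B" "A \<times> B \<subseteq> {z \<in> W'. snd (g z) \<in> {0<..}}"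
    using z0W pos0 by (elim open_prod_elim [of _ "(u0, t0)"]) auto
  obtain e where e: "e > 0" "cball t0 e \<subseteq> B"
    using AB(2,3) open_contains_cball by blast
  define \<alpha> where "\<alpha> = t0 - e"
  define \<beta> where "\<beta> = t0 + e"
  have ab: "\<alpha> < t0" "t0 < \<beta>" "\<alpha> < \<beta>" using e by (auto simp: \<alpha>_def \<beta>_def)
  have box: "(u, t) \<in> W'" "snd (g (u, t)) > 0" if "u \<in> A" "t \<in> {\<alpha>..\<beta>}" for u t
    using AB(4) e(2) that by (force simp: \<alpha>_def \<beta>_def cball_def dist_real_def)+
  have der_t: "DERIV (\<lambda>t. r (u, t)) t :> snd (g (u, t))" if "u \<in> A" "t \<in> {\<alpha>..\<beta>}" for u t
  proof -
    have "((\<lambda>t. (u, t)) has_derivative (\<lambda>s. (0, s))) (at t)"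
      by (intro has_derivative_Pair has_derivative_ident has_derivative_const)
    from has_derivative_compose [OF this der [OF box(1) [OF that]]] show ?thesis
      by (simp add: has_field_derivative_def inner_prod_def mult_commute_abs)
  qed
  have mono: "r (u, s) < r (u, t)" if "u \<in> A" "s \<in> {\<alpha>..\<beta>}" "t \<in> {\<alpha>..\<beta>}" "s < t" for u s t
    by (rule DERIV_pos_imp_increasing [OF that(4)], intro exI conjI, rule der_t)
      (use that in \<open>auto intro!: box(2)\<close>)
  have slice_cont: "continuous_on A (\<lambda>u. r (u, t))" if "t \<in> {\<alpha>..\<beta>}" for t
    by (rule continuous_on_compose2 [OF contr]) (use box(1) that in \<open>auto intro!: continuous_intros\<close>)
  \<comment> \<open>Over these base points \<open>r\<close> has opposite signs at the two ends of
    the vertical segment, so the segment crosses the boundary strictly between them.\<close>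
  define D where "D = {u \<in> A. r (u, \<alpha>) < 0} \<inter> {u \<in> A. r (u, \<beta>) > 0}"
  have "open {u \<in> A. r (u, t) \<in> X}" if "t \<in> {\<alpha>..\<beta>}" "open X" for t X
    by (rule continuous_open_preimage [OF slice_cont [OF that(1)] AB(1) that(2), unfolded vimage_def Int_def mem_Collect_eq])
  from this [of \<alpha> "{..<0}"] this [of \<beta> "{0<..}"] have "open {u \<in> A. r (u, \<alpha>) < 0}" "open {u \<in> A. r (u, \<beta>) > 0}"
    using ab by simp_all
  then have Do: "open D" by (auto simp: D_def)
  have DA: "u \<in> A" if "u \<in> D" for u using that by (simp add: D_def)
  have "r (u0, t0) = 0"
    using LD(6) [OF LD(2)] y RR [of y] by (simp add: r_def flip: z0)
  then have u0D: "u0 \<in> D"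
    using mono [of u0 \<alpha> t0] mono [of u0 t0 \<beta>] AB(3) ab by (auto simp: D_def)
  define h where "h u = (SOME t. \<alpha> < t \<and> t < \<beta> \<and> r (u, t) = 0)" for u
  have h: "\<alpha> < h u \<and> h u < \<beta> \<and> r (u, h u) = 0" if u: "u \<in> D" for u
  proof -
    have "\<exists>t\<ge>\<alpha>. t \<le> \<beta> \<and> r (u, t) = 0"
      using u ab by (intro IVT) (auto simp: D_def intro!: DERIV_isCont [OF der_t])
    then obtain t where t: "\<alpha> \<le> t" "t \<le> \<beta>" "r (u, t) = 0" by blast
    moreover have "t \<noteq> \<alpha>" "t \<noteq> \<beta>" using t u by (auto simp: D_def)
    ultimately have "\<exists>t. \<alpha> < t \<and> t < \<beta> \<and> r (u, t) = 0" by force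
    then show ?thesis unfolding h_def by (rule someI_ex)
  qed
  have sign: "(r (u, t) < 0 \<longleftrightarrow> t < h u) \<and> (r (u, t) = 0 \<longleftrightarrow> t = h u)" if "u \<in> D" "t \<in> {\<alpha><..<\<beta>}" for u t
    using mono [of u t "h u"] mono [of u "h u" t] h [OF that(1)] that DA by (cases t "h u" rule: linorder_cases) auto
  \<comment> \<open>The gradient of \<open>h\<close> as implicit differentiation of
    \<open>r (u, h u) = 0\<close> predicts it.\<close>
  define a where "a u = (- 1 / snd (g (u, h u))) *\<^sub>R fst (g (u, h u))" for u
  have gpos: "snd (g (u, h u)) > 0" and hW: "(u, h u) \<in> W'" if "u \<in> D" for u
    using box [of u "h u"] h [OF that] DA [OF that] by auto
  have derh: "(h has_derivative (\<lambda>v. v \<bullet> a u)) (at u)" if u: "u \<in> D" for u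
  proof -
    define S where "S = D \<times> {\<alpha><..<\<beta>}"
    \<comment> \<open>\<open>\<Phi>\<close> straightens the boundary to the level 0. It is injective
      since \<open>r\<close> increases vertically, and \<open>h u\<close> is the second component of
      its inverse at \<open>(u, 0)\<close>; differentiating that inverse yields the derivative of
      \<open>h\<close> without prior continuity of \<open>h\<close>.\<close>
    define \<Phi> where "\<Phi> z = (fst z, r z)" for z
    define gg where "gg = g (u, h u)"
    have So: "open S" by (simp add: S_def open_Times Do)
    have SW: "S \<subseteq> W'" using box DA by (auto simp: S_def)
    have "inj_on \<Phi> S"
    proof (rule inj_onI, clarsimp simp: \<Phi>_def S_def)
      fix u s t assume "u \<in> D" "\<alpha> < s" "s < \<beta>" "\<alpha> < t" "t < \<beta>" "r (u, s) = r (u, t)"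
      then show "s = t"
        using mono [of u s t] mono [of u t s] DA by (cases s t rule: linorder_cases) auto
    qed
    then have inv: "inv_into S \<Phi> (\<Phi> z) = z" if "z \<in> S" for z
      using that by simp
    have uS: "(u, h u) \<in> S" using u h by (simp add: S_def)
    have \<Phi>h: "\<Phi> (u, h u) = (u, 0)" if "u \<in> D" for u using h [OF that] by (simp add: \<Phi>_def)
    have "(inv_into S \<Phi> has_derivative (\<lambda>v. (fst v, (snd v - fst v \<bullet> fst gg) / snd gg))) (at (\<Phi> (u, h u)))"
    proof (rule has_derivative_inverse_strong [OF So uS])
      show "inv_into S \<Phi> (\<Phi> z) = z" if "z \<in> S" for z
        by (rule inv [OF that])
      show "continuous_on S \<Phi>"
        unfolding \<Phi>_def [abs_def] by (intro continuous_intros continuous_on_subset [OF contr SW])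
      show "(\<Phi> has_derivative (\<lambda>v. (fst v, v \<bullet> gg))) (at (u, h u))"
        unfolding \<Phi>_def [abs_def] gg_def
        by (intro has_derivative_Pair der hW u has_derivative_fst has_derivative_ident)
      show "(\<lambda>v. (fst v, v \<bullet> gg)) \<circ> (\<lambda>v. (fst v, (snd v - fst v \<bullet> fst gg) / snd gg)) = id"
        using gpos [OF u] by (auto simp: fun_eq_iff inner_prod_def gg_def)
    qed
    then have inv_der: "(inv_into S \<Phi> has_derivative (\<lambda>v. (fst v, (snd v - fst v \<bullet> fst gg) / snd gg))) (at (u, 0))"
      by (simp add: \<Phi>h u)
    have "((\<lambda>u. (u, 0::real)) has_derivative (\<lambda>v. (v, 0))) (at u)"
      by (intro has_derivative_Pair has_derivative_ident has_derivative_const)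
    from has_derivative_snd [OF has_derivative_compose [OF this inv_der]]
    have "((\<lambda>u. snd (inv_into S \<Phi> (u, 0))) has_derivative (\<lambda>v. v \<bullet> a u)) (at u)"
      by (simp add: a_def gg_def)
    then show ?thesis
    proof (rule has_derivative_transform_within_open [OF _ Do u])
      fix u assume u: "u \<in> D"
      then have "(u, h u) \<in> S" using h by (simp add: S_def)
      from inv [OF this] show "snd (inv_into S \<Phi> (u, 0)) = h u"
        by (simp add: \<Phi>h u)
    qed
  qed
  have conth: "continuous_on D h"
    by (rule has_derivative_continuous_on) (rule has_derivative_at_withinI [OF derh])
  have contgh: "continuous_on D (\<lambda>u. g (u, h u))"
    by (rule continuous_on_compose2 [OF contg]) (use hW in \<open>auto intro!: continuous_intros conth\<close>)
  have C1h: "C_k_on 1 D h"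
  proof (rule C_1_onI [OF derh])
    show "continuous_on D (\<lambda>u. b \<bullet> a u)" for b
      unfolding a_def using gpos by (intro continuous_intros contgh) force
  qed
  have inRG: "(R (u, t) \<in> G \<longleftrightarrow> t < h u) \<and> (R (u, t) \<in> frontier G \<longleftrightarrow> t = h u)" if "u \<in> D" "t \<in> {\<alpha><..<\<beta>}" for u t
    using sign [OF that] LD(5,6) [of "R (u, t)"] box(1) [of u t] DA [OF that(1)] that(2) by (auto simp: r_def W'_def)
  \<comment> \<open>With \<open>gg\<close> the gradient in turned coordinates, the cosine between
    the normal and the direction is \<open>snd gg / norm gg\<close>, and the area density of the
    graph is \<open>norm gg / snd gg\<close>.\<close>
  have "exterior_normal G (R (u, h u)) \<bullet> R (0, 1) * sqrt (gram_det (\<lambda>u. R (u, h u)) u) = 1" if u: "u \<in> D" for u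
  proof -
    define gg where "gg = g (u, h u)"
    have sg: "snd gg > 0" using gpos [OF u] by (simp add: gg_def)
    then have ng: "norm gg > 0" by auto
    have "R (u, h u) \<in> frontier G" "R (u, h u) \<in> W"
      using inRG [OF u] h [OF u] hW [OF u] by (auto simp: W'_def)
    then have "exterior_normal G (R (u, h u)) = sgn (grad \<rho> (R (u, h u)))"
      using exterior_normal_eq local_defining_function_mono [OF L] by blast
    also have "\<dots> = R gg /\<^sub>R norm gg"
      using orthogonal_transformation_norm [OF R] by (simp add: sgn_div_norm gg_def g_def RR)
    finally have n: "exterior_normal G (R (u, h u)) = R gg /\<^sub>R norm gg" .
    have "R gg \<bullet> R (0, 1) = gg \<bullet> (0, 1)"
      using R unfolding orthogonal_transformation_def by blast
    also have "\<dots> = snd gg" by (simp add: inner_prod_def)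
    finally have "exterior_normal G (R (u, h u)) \<bullet> R (0, 1) = snd gg / norm gg"
      by (simp add: n divide_inverse mult.commute del: inner_Pair)
    moreover have "gram_det (\<lambda>u. R (u, h u)) u = (norm gg / snd gg)\<^sup>2"
    proof -
      have "(norm gg / snd gg)\<^sup>2 = ((norm (fst gg))\<^sup>2 + (snd gg)\<^sup>2) / (snd gg)\<^sup>2"
        by (simp add: norm_prod_def power_divide)
      also have "\<dots> = 1 + (norm (fst gg) / snd gg)\<^sup>2"
        using sg by (simp add: power_divide add_divide_distrib)
      also have "norm (fst gg) / snd gg = norm (a u)"
        using sg by (simp add: a_def flip: gg_def)
      finally show ?thesis
        by (simp add: gram_det_graph(2) [OF R derh [OF u]])
    qed
    ultimately show ?thesis using sg ng by simp
  qed
  then have "graph_chart G R D \<alpha> \<beta> h"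
    using R RR Do C1h h inRG by (simp add: graph_chart_def)
  moreover have "y \<in> R ` (D \<times> {\<alpha><..<\<beta>})"
    using RR [of y] z0 u0D ab by (intro image_eqI [of _ _ "(u0, t0)"]) auto
  ultimately show thesis using that Rb by blast
qed


section \<open>Isometries and change of variables\<close>

text \<open>A direct image under a homeomorphism is a preimage under its continuous inverse.\<close>

lemma homeomorphism_image_borel:
  fixes f :: "'a::euclidean_space \<Rightarrow> 'b::euclidean_space"
  assumes "homeomorphism V V' f g" "V' \<in> sets borel" "A \<in> sets borel" "A \<subseteq> V"
  shows "f ` A \<in> sets borel"
proof -
  have "g \<in> borel_measurable (restrict_space borel V')"
    using assms(1) by (intro borel_measurable_continuous_on_restrict) (auto simp: homeomorphism_def)
  from measurable_sets [OF this assms(3)] have "g -` A \<inter> V' \<in> sets (restrict_space borel V')"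
    by (simp add: space_restrict_space)
  then have "g -` A \<inter> V' \<in> sets borel"
    using assms(2) by (subst (asm) sets_restrict_space_iff) auto
  moreover have "f ` A = g -` A \<inter> V'"
    using assms(1,4) by (force simp: homeomorphism_def)
  ultimately show ?thesis by simp
qed

lemma nn_integral_lborel_add:
  fixes f :: "'a::euclidean_space \<Rightarrow> ennreal"
  assumes [measurable]: "f \<in> borel_measurable borel"
  shows "(\<integral>\<^sup>+x. f (c + x) \<partial>lborel) = (\<integral>\<^sup>+x. f x \<partial>lborel)"
proof -
  have "(\<integral>\<^sup>+x. f x \<partial>lborel) = (\<integral>\<^sup>+x. f x \<partial>distr lborel borel ((+) c))"
    by (simp add: lborel_distr_plus)
  then show ?thesis by (simp add: nn_integral_distr)
qed

lemma nn_integral_lborel_diff: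
  fixes f :: "'a::euclidean_space \<Rightarrow> ennreal"
  assumes [measurable]: "f \<in> borel_measurable borel"
  shows "(\<integral>\<^sup>+x. f (c - x) \<partial>lborel) = (\<integral>\<^sup>+x. f x \<partial>lborel)"
proof -
  have "(\<integral>\<^sup>+x. f x \<partial>lborel) = (\<integral>\<^sup>+x. f x \<partial>distr lborel borel (\<lambda>x. c + (-1) *\<^sub>R x))"
    by (subst lborel_affine [of "-1" c]) (simp_all add: density_1)
  then show ?thesis by (simp add: nn_integral_distr)
qed

lemma borel_measurable_linear:
  fixes R :: "'a::euclidean_space \<Rightarrow> 'b::real_normed_vector"
  assumes "linear R"
  shows "R \<in> borel_measurable borel"
  using assms by (intro borel_measurable_continuous_onI linear_continuous_on)
    (simp add: linear_conv_bounded_linear) 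

text \<open>Both measures are invariant under translations, so by Tonelli's theorem they are proportional;
  the factor is found from the unit ball.\<close>

lemma distr_lborel_isometry:
  fixes R :: "'a::euclidean_space \<Rightarrow> 'b::euclidean_space"
  assumes lin: "linear R" and nrm: "\<And>x. norm (R x) = norm x" and "surj R"
  shows "distr lborel borel R = lborel"
proof (rule measure_eqI)
  interpret R: linear R by fact
  have [measurable]: "R \<in> borel_measurable borel"
    by (rule borel_measurable_linear) fact
  have "inj R"
    using nrm by (metis linear_injective_0 lin norm_eq_zero)
  then have "dim (range R) = DIM('a)"
    using lin by (simp add: dim_image_eq)
  then have dim: "DIM('b) = DIM('a)"
    using \<open>surj R\<close> by simp
  fix A :: "'b set" assume "A \<in> sets (distr lborel borel R)"
  then have [measurable]: "A \<in> sets borel" by simp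
  let ?B = "ball 0 1 :: 'b set"
  have [measurable]: "?B \<in> sets borel" by simp
  have N: "emeasure (distr lborel borel R) X = (\<integral>\<^sup>+y. indicator X (R y) \<partial>lborel)" if "X \<in> sets borel" for X
  proof -
    have [measurable]: "X \<in> sets borel" by fact
    have [measurable]: "R -` X \<in> sets borel"
      using measurable_sets_borel [of R borel X] by simp
    have "emeasure (distr lborel borel R) X = (\<integral>\<^sup>+y. indicator (R -` X) y \<partial>lborel)"
      by (simp add: emeasure_distr)
    then show ?thesis by (simp add: indicator_vimage o_def)
  qed
  have RB: "R -` ?B = ball 0 1"
    using nrm by (auto simp: dist_norm)
  have NB: "emeasure (distr lborel borel R) ?B = emeasure lborel ?B"
    by (simp add: emeasure_distr RB emeasure_ball dim)
  have "emeasure lborel A * emeasure (distr lborel borel R) ?B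
      = (\<integral>\<^sup>+y. indicator ?B (R y) * (\<integral>\<^sup>+x. indicator A x \<partial>lborel) \<partial>lborel)"
  proof -
    have m: "(\<lambda>y. indicator ?B (R y) :: ennreal) \<in> borel_measurable borel"
      by measurable
    show ?thesis
      using m by (subst nn_integral_multc) (simp_all add: N mult.commute)
  qed
  also have "\<dots> = (\<integral>\<^sup>+y. (\<integral>\<^sup>+x. indicator ?B (R y) * indicator A (R y + x) \<partial>lborel) \<partial>lborel)"
    by (simp add: nn_integral_cmult nn_integral_lborel_add)
  also have "\<dots> = (\<integral>\<^sup>+x. (\<integral>\<^sup>+y. indicator ?B (R y) * indicator A (R y + x) \<partial>lborel) \<partial>lborel)"
    by (rule lborel_pair.Fubini') measurable
  \<comment> \<open>Surjectivity writes the shift \<open>x\<close> as \<open>R z\<close>, so it can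
    be absorbed by translating the variable \<open>y\<close>. Afterwards the shift sits in the
    factor of the ball instead of that of \<open>A\<close>.\<close>
  also have "\<dots> = (\<integral>\<^sup>+x. (\<integral>\<^sup>+y. indicator ?B (R y - x) * indicator A (R y) \<partial>lborel) \<partial>lborel)"
  proof (rule nn_integral_cong)
    fix x
    obtain z where z: "x = R z" using \<open>surj R\<close> by auto
    show "(\<integral>\<^sup>+y. indicator ?B (R y) * indicator A (R y + x) \<partial>lborel) = (\<integral>\<^sup>+y. indicator ?B (R y - x) * indicator A (R y) \<partial>lborel)"
      by (subst nn_integral_lborel_add [of "\<lambda>y. indicator ?B (R y - x) * indicator A (R y)" z, symmetric])
        (auto simp: z R.add add.commute)
  qed
  also have "\<dots> = (\<integral>\<^sup>+y. (\<integral>\<^sup>+x. indicator ?B (R y - x) * indicator A (R y) \<partial>lborel) \<partial>lborel)"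
    by (rule lborel_pair.Fubini') measurable
  also have "\<dots> = emeasure (distr lborel borel R) A * emeasure lborel ?B"
    by (simp add: N nn_integral_multc nn_integral_cmult nn_integral_lborel_diff mult.commute)
  finally have "emeasure lborel ?B * emeasure lborel A = emeasure lborel ?B * emeasure (distr lborel borel R) A"
    by (simp add: NB mult.commute)
  moreover have "emeasure lborel ?B \<noteq> 0" "emeasure lborel ?B \<noteq> \<infinity>"
    using unit_ball_vol_pos [of "real DIM('b)"] by (auto simp: emeasure_ball simp del: unit_ball_vol_pos)
  ultimately show "emeasure (distr lborel borel R) A = emeasure lborel A"
    by (simp add: ennreal_mult_cancel_left)
qed simp

lemma emeasure_lborel_isometry_image:
  fixes R :: "'a::euclidean_space \<Rightarrow> 'b::euclidean_space"
  assumes "linear R" "\<And>x. norm (R x) = norm x" "surj R" "A \<in> sets borel" "R ` A \<in> sets borel"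
  shows "emeasure lborel (R ` A) = emeasure lborel A"
proof -
  have "inj R"
    using assms by (metis linear_injective_0 norm_eq_zero)
  have [measurable]: "R \<in> borel_measurable borel"
    by (rule borel_measurable_linear) fact
  have "emeasure lborel (R ` A) = emeasure (distr lborel borel R) (R ` A)"
    by (simp add: distr_lborel_isometry [OF assms(1-3)])
  also have "\<dots> = emeasure lborel A"
    using assms \<open>inj R\<close> by (simp add: emeasure_distr inj_vimage_image_eq)
  finally show ?thesis .
qed

section \<open>Change of variables over an arbitrary finite linearly ordered index type\<close>

text \<open>Rows and columns are relabelled simultaneously; transporting permutations along
  \<open>f\<close> keeps both their signs and the products in the Leibniz formula.\<close>

lemma det_reindex:
  fixes A :: "real^'m^'m" and f :: "'k::finite \<Rightarrow> 'm::finite"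
  assumes "bij f"
  shows "det (\<chi> i j. A $ f i $ f j) = det A"
proof -
  have inj: "inj f" and surj: "surj f" using assms by (auto simp: bij_def)
  have mp: "map_permutation UNIV f p (f i) = f (p i)" for p i
    using inj by (simp add: map_permutation_def surj)
  show ?thesis
    unfolding det_def
  proof (rule sum.reindex_bij_witness [where j = "map_permutation UNIV f" and i = "map_permutation UNIV (inv f)"])
    fix p :: "'k \<Rightarrow> 'k" assume p: "p \<in> {p. p permutes UNIV}"
    show "map_permutation UNIV (inv f) (map_permutation UNIV f p) = p"
      using inj surj by (auto simp: map_permutation_def fun_eq_iff inv_inv_eq bij_imp_bij_inv assms surj_imp_inj_inv inj_imp_surj_inv)
    show "map_permutation UNIV f p \<in> {p. p permutes UNIV}"
      using map_permutation_permutes [of f UNIV UNIV p] p assms by (simp add: bij_betw_def bij_def)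
    have "sign (map_permutation UNIV f p) = sign p"
      using inj p by (intro sign_map_permutation) auto
    moreover have "(\<Prod>i\<in>UNIV. A $ i $ map_permutation UNIV f p i) = (\<Prod>i\<in>UNIV. A $ f i $ f (p i))"
      by (subst prod.reindex_bij_betw [OF assms, symmetric]) (simp add: mp)
    ultimately show "of_int (sign (map_permutation UNIV f p)) * (\<Prod>i\<in>UNIV. A $ i $ map_permutation UNIV f p i) =
        of_int (sign p) * (\<Prod>i\<in>UNIV. (\<chi> i j. A $ f i $ f j) $ i $ p i)"
      by simp
  next
    fix p :: "'m \<Rightarrow> 'm" assume p: "p \<in> {p. p permutes UNIV}"
    show "map_permutation UNIV f (map_permutation UNIV (inv f) p) = p"
      using inj surj by (auto simp: map_permutation_def fun_eq_iff inv_inv_eq bij_imp_bij_inv assms surj_imp_inj_inv inj_imp_surj_inv surj_f_inv_f)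
    show "map_permutation UNIV (inv f) p \<in> {p. p permutes UNIV}"
      using map_permutation_permutes [of "inv f" UNIV UNIV p] p bij_imp_bij_inv [OF assms] by (simp add: bij_betw_def bij_def)
  qed
qed

text \<open>The library's change of variables formula requires a well-ordered index type.\<close>

typedef 'm wo = "UNIV :: 'm set" ..

instance wo :: (finite) finite
proof
  have "range Abs_wo = (UNIV :: 'a wo set)"
    by (metis Rep_wo_inverse surjI)
  then show "finite (UNIV :: 'a wo set)"
    by (metis finite finite_imageI)
qed

instantiation wo :: ("{finite,linorder}") wellorder
begin

definition less_eq_wo :: "'a wo \<Rightarrow> 'a wo \<Rightarrow> bool" where
  "a \<le> b \<longleftrightarrow> Rep_wo a \<le> Rep_wo b"

definition less_wo :: "'a wo \<Rightarrow> 'a wo \<Rightarrow> bool" where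
  "a < b \<longleftrightarrow> Rep_wo a < Rep_wo b"

instance
proof
  fix P :: "'a wo \<Rightarrow> bool" and a :: "'a wo"
  assume step: "\<And>x. (\<And>y. y < x \<Longrightarrow> P y) \<Longrightarrow> P x"
  show "P a"
  \<comment> \<open>On a finite linear order the number of predecessors is a measure that decreases
    strictly along the order.\<close>
  proof (induction "card {z. Rep_wo z < Rep_wo a}" arbitrary: a rule: less_induct)
    case less
    show ?case
    proof (rule step)
      fix y assume "y < a"
      then have "{z. Rep_wo z < Rep_wo y} \<subset> {z. Rep_wo z < Rep_wo a}"
        by (auto simp: less_wo_def)
      then show "P y" by (intro less psubset_card_mono) auto
    qed
  qed
qed (auto simp: less_eq_wo_def less_wo_def simp flip: Rep_wo_inject)

end

text \<open>The formula for finite measures covers the case of an integrable Jacobian. If the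
  Jacobian is not integrable, the image cannot have finite measure either, and both sides are
  infinite.\<close>

lemma emeasure_differentiable_image_wellorder:
  fixes T :: "real^'n::{finite,wellorder} \<Rightarrow> real^'n::_"
  assumes S: "S \<in> sets borel" "T ` S \<in> sets borel"
    and der: "\<And>x. x \<in> S \<Longrightarrow> (T has_derivative T' x) (at x)"
    and inj: "inj_on T S"
    and meas: "(\<lambda>x. indicator S x * \<bar>det (matrix (T' x))\<bar>) \<in> borel_measurable borel"
  shows "emeasure lborel (T ` S) = (\<integral>\<^sup>+x. ennreal (indicator S x * \<bar>det (matrix (T' x))\<bar>) \<partial>lborel)"
proof -
  have SL: "S \<in> sets lebesgue" using S by auto
  have der': "\<And>x. x \<in> S \<Longrightarrow> (T has_derivative T' x) (at x within S)"
    using der has_derivative_at_withinI by blast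
  show ?thesis
  proof (cases "(\<lambda>x. \<bar>det (matrix (T' x))\<bar>) integrable_on S")
    case True
    then obtain I where I: "((\<lambda>x. \<bar>det (matrix (T' x))\<bar>) has_integral I) S" by blast
    with has_measure_differentiable_image [OF SL der' inj, of I]
    have "T ` S \<in> lmeasurable" "measure lebesgue (T ` S) = I" by auto
    then have "emeasure lebesgue (T ` S) = ennreal I"
      using emeasure_eq_ennreal_measure [OF fmeasurableD2] by blast
    then have "emeasure lborel (T ` S) = ennreal I"
      using S(2) by simp
    moreover have "(\<integral>\<^sup>+x. ennreal (indicator S x * \<bar>det (matrix (T' x))\<bar>) \<partial>lborel) = ennreal I"
      using nn_integral_has_integral_lebesgue [OF _ I] by simp
    ultimately show ?thesis by simp
  next
    case False
    then have "T ` S \<notin> lmeasurable"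
      using measurable_differentiable_image_eq [OF SL der' inj] by blast
    then have 1: "emeasure lborel (T ` S) = \<infinity>"
      using S(2) by (auto simp: fmeasurable_def simp flip: top.not_eq_extremum)
    have "(\<integral>\<^sup>+x. ennreal (indicator S x * \<bar>det (matrix (T' x))\<bar>) \<partial>lborel) = \<infinity>"
    proof (rule ccontr)
      assume "(\<integral>\<^sup>+x. ennreal (indicator S x * \<bar>det (matrix (T' x))\<bar>) \<partial>lborel) \<noteq> \<infinity>"
      then have "integrable lborel (\<lambda>x. indicator S x * \<bar>det (matrix (T' x))\<bar>)"
        using meas by (intro integrableI_bounded) (auto simp: less_top abs_mult)
      then have "(\<lambda>x. indicator S x * \<bar>det (matrix (T' x))\<bar>) integrable_on UNIV"
        by (rule integrable_on_lborel)
      then have "(\<lambda>x. if x \<in> S then \<bar>det (matrix (T' x))\<bar> else 0) integrable_on UNIV"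
        by (rule integrable_eq) (auto simp: indicator_def)
      with False show False by (simp add: integrable_restrict_UNIV)
    qed
    with 1 show ?thesis by simp
  qed
qed


text \<open>Relabelling coordinates by \<open>\<iota>\<close> is a linear isometry, so it preserves
  Lebesgue measure, and it changes the Jacobian matrix only by a simultaneous relabelling of rows
  and columns.\<close>

lemma emeasure_differentiable_image:
  fixes T :: "(real, 'm::{finite,linorder}) vec \<Rightarrow> (real, 'm) vec"
  assumes S: "S \<in> sets borel" "T ` S \<in> sets borel"
    and der: "\<And>x. x \<in> S \<Longrightarrow> (T has_derivative T' x) (at x)"
    and inj: "inj_on T S"
    and meas [measurable]: "(\<lambda>x. indicator S x * \<bar>det (matrix (T' x))\<bar>) \<in> borel_measurable borel"
  shows "emeasure lborel (T ` S) = (\<integral>\<^sup>+x. ennreal (indicator S x * \<bar>det (matrix (T' x))\<bar>) \<partial>lborel)"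
proof -
  define \<iota> :: "(real, 'm) vec \<Rightarrow> (real, 'm wo) vec" where "\<iota> x = (\<chi> k. x $ Rep_wo k)" for x
  define \<kappa> :: "(real, 'm wo) vec \<Rightarrow> (real, 'm) vec" where "\<kappa> y = (\<chi> i. y $ Abs_wo i)" for y
  have bij: "bij (Rep_wo :: 'm wo \<Rightarrow> 'm)"
    by (metis Abs_wo_inverse Rep_wo_inverse UNIV_I bijI')
  have inv [simp]: "\<kappa> (\<iota> x) = x" "\<iota> (\<kappa> y) = y" for x y
    by (simp_all add: \<iota>_def \<kappa>_def Abs_wo_inverse Rep_wo_inverse vec_eq_iff)
  have lin: "linear \<iota>" "linear \<kappa>"
    by (auto intro!: linearI simp: \<iota>_def \<kappa>_def vec_eq_iff)
  then have bl: "bounded_linear \<iota>" "bounded_linear \<kappa>"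
    by (simp_all add: linear_conv_bounded_linear)
  have [measurable]: "\<iota> \<in> borel_measurable borel" "\<kappa> \<in> borel_measurable borel"
    using lin by (simp_all add: borel_measurable_linear)
  have nrm: "norm (\<iota> x) = norm x" for x
    using sum.reindex_bij_betw [OF bij, of "\<lambda>i. (x $ i)\<^sup>2"] by (simp add: norm_vec_def L2_set_def \<iota>_def)
  have surj: "surj \<iota>" by (metis inv(2) surjI)
  have img: "\<iota> ` A = \<kappa> -` A" for A
    by force
  have img_borel: "\<iota> ` A \<in> sets borel" if "A \<in> sets borel" for A
    using measurable_sets_borel [OF \<open>\<kappa> \<in> borel_measurable borel\<close> that] by (simp add: img)
  define D where "D y = \<iota> \<circ> T' (\<kappa> y) \<circ> \<kappa>" for y
  have det: "det (matrix (D y)) = det (matrix (T' (\<kappa> y)))" for y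
  proof -
    have "\<kappa> (axis j 1) = axis (Rep_wo j) 1" for j
      by (auto simp: \<kappa>_def axis_def vec_eq_iff Abs_wo_inverse Rep_wo_inverse)
    then have "matrix (D y) = (\<chi> i j. matrix (T' (\<kappa> y)) $ Rep_wo i $ Rep_wo j)"
      by (simp add: matrix_def D_def \<iota>_def)
    then show ?thesis by (simp add: det_reindex [OF bij])
  qed
  have meas': "(\<lambda>y. indicator (\<iota> ` S) y * \<bar>det (matrix (D y))\<bar>) = (\<lambda>x. indicator S x * \<bar>det (matrix (T' x))\<bar>) \<circ> \<kappa>"
    by (simp add: img det fun_eq_iff indicator_vimage)
  have "emeasure lborel (T ` S) = emeasure lborel (\<iota> ` T ` S)"
    using S img_borel by (intro emeasure_lborel_isometry_image [symmetric] lin nrm surj) auto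
  also have "\<iota> ` T ` S = (\<iota> \<circ> T \<circ> \<kappa>) ` (\<iota> ` S)"
    by (simp add: image_comp o_def)
  also have "emeasure lborel \<dots> = (\<integral>\<^sup>+y. ennreal (indicator (\<iota> ` S) y * \<bar>det (matrix (D y))\<bar>) \<partial>lborel)"
  proof (rule emeasure_differentiable_image_wellorder)
    show "(\<iota> \<circ> T \<circ> \<kappa>) ` (\<iota> ` S) \<in> sets borel"
      using img_borel [OF S(2)] by (simp add: image_comp o_def)
    show "inj_on (\<iota> \<circ> T \<circ> \<kappa>) (\<iota> ` S)"
      using inj by (auto simp: inj_on_def) (metis inv(1))
    show "(\<iota> \<circ> T \<circ> \<kappa> has_derivative D y) (at y)" if "y \<in> \<iota> ` S" for y
      unfolding D_def o_def
      by (rule bounded_linear.has_derivative [OF bl(1)], rule has_derivative_compose [OF bounded_linear_imp_has_derivative [OF bl(2)]])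
        (use that in \<open>auto intro: der\<close>)
    show "(\<lambda>y. indicator (\<iota> ` S) y * \<bar>det (matrix (D y))\<bar>) \<in> borel_measurable borel"
      unfolding meas' by (rule measurable_comp) measurable
  qed (rule img_borel [OF S(1)])
  also have "\<dots> = (\<integral>\<^sup>+y. ennreal (indicator S (\<kappa> y) * \<bar>det (matrix (T' (\<kappa> y)))\<bar>) \<partial>lborel)"
    by (simp add: img det indicator_vimage)
  also have "\<dots> = (\<integral>\<^sup>+y. ennreal (indicator S (\<kappa> y) * \<bar>det (matrix (T' (\<kappa> y)))\<bar>) \<partial>distr lborel borel \<iota>)"
    by (simp add: distr_lborel_isometry lin nrm surj)
  also have "\<dots> = (\<integral>\<^sup>+x. ennreal (indicator S x * \<bar>det (matrix (T' x))\<bar>) \<partial>lborel)"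
    by (subst nn_integral_distr) simp_all
  finally show ?thesis .
qed

text \<open>Charts and densities are controlled only on an open set; extension by zero makes them
  Borel functions on the whole space, as pushforwards and densities require.\<close>

lemma borel_measurable_extend:
  fixes f :: "'a::topological_space \<Rightarrow> 'b::{topological_space,zero}"
  assumes "continuous_on V f" "V \<in> sets borel"
  shows "(\<lambda>x. if x \<in> V then f x else 0) \<in> borel_measurable borel"
  using assms borel_measurable_continuous_on_restrict [OF assms(1)]
  by (intro measurable_If_restrict_space_iff [THEN iffD2]) auto

text \<open>The formula for sets is read as an equality of two measures on the target: the
  pushforward of the Jacobian density and Lebesgue measure restricted to \<open>T\<close>
  V\<open>. Integrating\<close>F\<open>over\<close>T \<open>A\<close> against both gives the formula
  for functions.\<close>

lemma nn_integral_change_of_variables: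
  fixes T :: "(real, 'm::{finite,linorder}) vec \<Rightarrow> (real, 'm) vec"
  assumes V: "open V" and A [measurable]: "A \<in> sets borel" and AV: "A \<subseteq> V"
    and der: "\<And>x. x \<in> V \<Longrightarrow> (T has_derivative T' x) (at x)"
    and inj: "inj_on T V"
    and cont: "continuous_on V (\<lambda>x. det (matrix (T' x)))"
    and F [measurable]: "F \<in> borel_measurable borel"
  shows "T ` A \<in> sets borel"
    and "(\<integral>\<^sup>+u\<in>T ` A. F u \<partial>lborel) = (\<integral>\<^sup>+x\<in>A. ennreal \<bar>det (matrix (T' x))\<bar> * F (T x) \<partial>lborel)"
proof -
  have [measurable]: "V \<in> sets borel" using V by simp
  have contT: "continuous_on V T"
    by (rule has_derivative_continuous_on) (rule has_derivative_at_withinI [OF der])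
  obtain g where g: "homeomorphism V (T ` V) T g"
    using invariance_of_domain_homeomorphism [OF V contT _ inj] by auto
  have "open (T ` V)"
    using invariance_of_domain [OF contT V inj] .
  then have img [measurable]: "T ` B \<in> sets borel" if "B \<in> sets borel" "B \<subseteq> V" for B
    using homeomorphism_image_borel [OF g] that by simp
  then show TA: "T ` A \<in> sets borel" using A AV by simp
  define T1 where "T1 = (\<lambda>x. if x \<in> V then T x else 0)"
  have [measurable]: "T1 \<in> borel_measurable borel"
    unfolding T1_def by (intro borel_measurable_extend contT) measurable
  define J where "J x = indicator V x * \<bar>det (matrix (T' x))\<bar>" for x
  have "(\<lambda>x. if x \<in> V then \<bar>det (matrix (T' x))\<bar> else 0) \<in> borel_measurable borel"
    by (intro borel_measurable_extend continuous_intros cont) measurable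
  also have "(\<lambda>x. if x \<in> V then \<bar>det (matrix (T' x))\<bar> else 0) = J"
    by (auto simp: J_def indicator_def)
  finally have J [measurable]: "J \<in> borel_measurable borel" .
  have "distr (density lborel (\<lambda>x. ennreal (J x))) borel T1 = density lborel (indicator (T ` V))" (is "?N = _")
  proof (rule measure_eqI)
    fix B assume "B \<in> sets ?N"
    then have [measurable]: "B \<in> sets borel" by simp
    let ?S = "V \<inter> T1 -` B"
    have [measurable]: "?S \<in> sets borel"
      using measurable_sets_borel [of T1 borel B] by (intro sets.Int) auto
    have "emeasure ?N B = (\<integral>\<^sup>+x. ennreal (J x) * indicator B (T1 x) \<partial>lborel)"
      by (subst emeasure_distr, simp, simp, subst emeasure_density)
        (auto intro!: nn_integral_cong measurable_sets_borel [of T1 borel B] simp: indicator_def)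
    also have "\<dots> = (\<integral>\<^sup>+x. ennreal (indicator ?S x * \<bar>det (matrix (T' x))\<bar>) \<partial>lborel)"
      by (intro nn_integral_cong) (auto simp: J_def indicator_def)
    also have "\<dots> = emeasure lborel (T ` ?S)"
    proof (rule emeasure_differentiable_image [symmetric])
      have "(\<lambda>x. indicator ?S x * \<bar>det (matrix (T' x))\<bar>) = (\<lambda>x. indicator ?S x * J x)"
        by (auto simp: J_def indicator_def)
      then show "(\<lambda>x. indicator ?S x * \<bar>det (matrix (T' x))\<bar>) \<in> borel_measurable borel"
        by simp
    qed (auto intro: der inj_on_subset [OF inj])
    also have "T ` ?S = T ` V \<inter> B"
      by (auto simp: T1_def)
    also have "emeasure lborel \<dots> = emeasure (density lborel (indicator (T ` V))) B"
      by (subst emeasure_density) (auto intro!: img simp flip: nn_integral_indicator indicator_inter_arith)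
    finally show "emeasure ?N B = emeasure (density lborel (indicator (T ` V))) B" .
  qed simp
  then have "(\<integral>\<^sup>+u. F u * indicator (T ` A) u \<partial>?N) = (\<integral>\<^sup>+u. F u * indicator (T ` A) u \<partial>density lborel (indicator (T ` V)))"
    by simp
  also have "\<dots> = (\<integral>\<^sup>+u. F u * indicator (T ` A) u \<partial>lborel)"
    using TA img [of V] image_mono [OF AV, of T]
    by (subst nn_integral_density) (auto intro!: nn_integral_cong simp: indicator_def image_subset_iff)
  also have "(\<integral>\<^sup>+u. F u * indicator (T ` A) u \<partial>?N) = (\<integral>\<^sup>+x. ennreal (J x) * (F (T1 x) * indicator (T ` A) (T1 x)) \<partial>lborel)"
    using TA by (simp add: nn_integral_distr nn_integral_density)
  also have "\<dots> = (\<integral>\<^sup>+x\<in>A. ennreal \<bar>det (matrix (T' x))\<bar> * F (T x) \<partial>lborel)"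
    using AV inj by (intro nn_integral_cong) (auto simp: J_def T1_def indicator_def dest: inj_onD)
  finally show "(\<integral>\<^sup>+u\<in>T ` A. F u \<partial>lborel) = (\<integral>\<^sup>+x\<in>A. ennreal \<bar>det (matrix (T' x))\<bar> * F (T x) \<partial>lborel)"
    by simp
qed


section \<open>The surface measure\<close>

lemma graph_chartD:
  fixes G :: "'m::finite hp set"
  assumes "graph_chart G R D \<alpha> \<beta> h"
  shows "orthogonal_transformation R" "\<And>x. R (R x) = x" "open D" "C_k_on 1 D h"
    and "\<And>u. u \<in> D \<Longrightarrow> \<alpha> < h u \<and> h u < \<beta>"
    and "\<And>u t. u \<in> D \<Longrightarrow> \<alpha> < t \<Longrightarrow> t < \<beta> \<Longrightarrow> R (u, t) \<in> G \<longleftrightarrow> t < h u"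
    and "\<And>u t. u \<in> D \<Longrightarrow> \<alpha> < t \<Longrightarrow> t < \<beta> \<Longrightarrow> R (u, t) \<in> frontier G \<longleftrightarrow> t = h u"
    and "\<And>u. u \<in> D \<Longrightarrow> exterior_normal G (R (u, h u)) \<bullet> R (0, 1) * sqrt (gram_det (\<lambda>u. R (u, h u)) u) = 1"
  using assms unfolding graph_chart_def by auto

lemma continuous_on_orthogonal_transformation:
  fixes R :: "'a::euclidean_space \<Rightarrow> 'a"
  assumes "orthogonal_transformation R"
  shows "continuous_on X R"
  using assms by (simp add: orthogonal_transformation_def linear_continuous_on linear_conv_bounded_linear)

lemma open_cylinder:
  fixes R :: "'m::finite hp \<Rightarrow> 'm hp"
  assumes "orthogonal_transformation R" "open D"
  shows "open (R ` (D \<times> {\<alpha><..<\<beta>}))"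
  using assms by (intro open_surjective_linear_image open_Times)
    (auto simp: orthogonal_transformation_linear orthogonal_transformation_surj)

lemma graph_chart_image:
  fixes G :: "'m::finite hp set"
  assumes "graph_chart G R D \<alpha> \<beta> h"
  shows "(\<lambda>u. R (u, h u)) ` D = frontier G \<inter> R ` (D \<times> {\<alpha><..<\<beta>})"
  using graph_chartD(5,7) [OF assms] by (auto simp: image_iff)

text \<open>Every graph chart is one of the parametrisations in which the surface measure is
  prescribed. Its Gram determinant is \<open>1 + (norm (grad h u))\<^sup>2\<close>, which is
  positive, and its inverse is the projection \<open>fst\<close> after \<open>R\<close>.\<close>

lemma regular_parametrization_graph:
  fixes G :: "'m::finite hp set"
  assumes C: "graph_chart G R D \<alpha> \<beta> h"
  shows "regular_parametrization (frontier G) D (\<lambda>u. R (u, h u))"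
  unfolding regular_parametrization_def
proof (intro conjI ballI)
  note CD = graph_chartD [OF C]
  have derh: "(h has_derivative (\<lambda>v. v \<bullet> grad h u)) (at u)" if "u \<in> D" for u
    by (rule C_1_on_has_derivative_grad [OF CD(4) CD(3) that])
  note g = gram_det_graph [OF CD(1) derh]
  show "open D" by (rule CD(3))
  show C1: "C_k_on 1 D (\<lambda>u. R (u, h u))"
    by (rule C_1_onI [OF g(1)])
      (auto intro!: continuous_on_compose2 [OF continuous_on_orthogonal_transformation [OF CD(1), of UNIV]]
        continuous_intros C_1_on_continuous_grad CD(4) simp del: One_nat_def)
  show "gram_det (\<lambda>u. R (u, h u)) u \<noteq> 0" if "u \<in> D" for u
  proof -
    have "1 + (norm (grad h u))\<^sup>2 > 0" by (intro add_pos_nonneg) auto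
    then show ?thesis by (simp add: g(2) [OF that])
  qed
  show "openin (top_of_set (frontier G)) ((\<lambda>u. R (u, h u)) ` D)"
    by (subst graph_chart_image [OF C]) (intro openin_open_Int open_cylinder CD(1,3))
  have "homeomorphism D ((\<lambda>u. R (u, h u)) ` D) (\<lambda>u. R (u, h u)) (\<lambda>y. fst (R y))"
    using CD(2) C_1_onD(1) [OF C1]
    by (intro homeomorphismI) (auto intro!: continuous_intros continuous_on_orthogonal_transformation [OF CD(1)])
  then show "\<exists>\<psi>. homeomorphism D ((\<lambda>u. R (u, h u)) ` D) (\<lambda>u. R (u, h u)) \<psi>"
    by blast
qed

lemma regular_parametrizationD:
  fixes M :: "'m::finite hp set"
  assumes "regular_parametrization M V \<phi>"
  shows "open V" "C_k_on 1 V \<phi>" "continuous_on V \<phi>" "openin (top_of_set M) (\<phi> ` V)"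
    and "\<exists>\<psi>. homeomorphism V (\<phi> ` V) \<phi> \<psi>" "inj_on \<phi> V"
    and "\<And>u. u \<in> V \<Longrightarrow> (\<phi> has_derivative (\<lambda>v. \<Sum>b\<in>Basis. (v \<bullet> b) *\<^sub>R partial_deriv b \<phi> u)) (at u)"
    and "continuous_on V (gram_det \<phi>)"
proof -
  show 1: "open V" "C_k_on 1 V \<phi>" "openin (top_of_set M) (\<phi> ` V)" "\<exists>\<psi>. homeomorphism V (\<phi> ` V) \<phi> \<psi>"
    using assms by (simp_all add: regular_parametrization_def del: C_k_on.simps One_nat_def)
  then show "inj_on \<phi> V" by (metis homeomorphism_apply1 inj_on_inverseI)
  show "continuous_on V \<phi>" using C_1_onD [OF 1(2)] by blast
  show "(\<phi> has_derivative (\<lambda>v. \<Sum>b\<in>Basis. (v \<bullet> b) *\<^sub>R partial_deriv b \<phi> u)) (at u)" if "u \<in> V" for u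
    using C_1_on_has_derivative [OF 1(2) 1(1) that] .
  have "continuous_on V (\<lambda>u. partial_deriv (axis i 1) \<phi> u)" for i
    using C_1_onD(3) [OF 1(2)] by (simp add: axis_in_Basis_iff)
  then show "continuous_on V (gram_det \<phi>)"
    unfolding gram_det_def [abs_def] det_def by (intro continuous_intros) simp_all
qed

lemma regular_parametrization_image_borel:
  fixes M :: "'m::finite hp set"
  assumes P: "regular_parametrization M V \<phi>" and "closed M" "A \<in> sets borel" "A \<subseteq> V"
  shows "\<phi> ` A \<in> sets borel"
proof -
  note PD = regular_parametrizationD [OF P]
  obtain \<psi> where "homeomorphism V (\<phi> ` V) \<phi> \<psi>" using PD(5) by blast
  moreover obtain T where "open T" "\<phi> ` V = M \<inter> T" using PD(4) by (auto simp: openin_open)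
  then have "\<phi> ` V \<in> sets borel" using \<open>closed M\<close> by auto
  ultimately show ?thesis
    using homeomorphism_image_borel assms(3,4) by blast
qed

text \<open>The transition map into a graph is the given parametrisation followed by a linear projection,
  so no inverse function theorem is needed here.\<close>

lemma area_density_graph_chart:
  fixes G :: "'m::{finite,linorder} hp set"
  assumes C: "graph_chart G R D \<alpha> \<beta> h" and P: "regular_parametrization (frontier G) V \<phi>"
    and A [measurable]: "A \<in> sets borel" and AV: "A \<subseteq> V" and AC: "\<phi> ` A \<subseteq> R ` (D \<times> {\<alpha><..<\<beta>})"
  shows "(\<integral>\<^sup>+u\<in>{u \<in> D. R (u, h u) \<in> \<phi> ` A}. ennreal (sqrt (gram_det (\<lambda>u. R (u, h u)) u)) \<partial>lborel)
       = (\<integral>\<^sup>+u\<in>A. ennreal (sqrt (gram_det \<phi> u)) \<partial>lborel)"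
proof -
  note CD = graph_chartD [OF C] and PD = regular_parametrizationD [OF P]
  note Q = regular_parametrizationD [OF regular_parametrization_graph [OF C]]
  define C where "C = R ` (D \<times> {\<alpha><..<\<beta>})"
  define \<gamma> where "\<gamma> u = R (u, h u)" for u
  define T where "T v = fst (R (\<phi> v))" for v
  define V' where "V' = V \<inter> \<phi> -` C"
  have \<phi>M: "\<phi> ` V \<subseteq> frontier G" using PD(4) by (auto dest: openin_imp_subset)
  have "open C" unfolding C_def by (intro open_cylinder CD(1,3))
  then have V': "open V'" unfolding V'_def by (rule continuous_open_preimage [OF PD(3,1)])
  have AV': "A \<subseteq> V'" using AV AC by (auto simp: V'_def C_def)
  have TD: "T v \<in> D" "\<gamma> (T v) = \<phi> v" if "v \<in> V'" for v
  proof -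
    have "\<phi> v \<in> frontier G \<inter> C" using that \<phi>M by (auto simp: V'_def)
    then have "\<phi> v \<in> \<gamma> ` D" using graph_chart_image [OF C] by (simp add: C_def \<gamma>_def [abs_def])
    then show "T v \<in> D" "\<gamma> (T v) = \<phi> v" by (auto simp: T_def \<gamma>_def CD(2))
  qed
  have injT: "inj_on T V'"
    using PD(6) TD by (metis (no_types, lifting) IntD1 V'_def inj_on_def)
  define T' where "T' u v = fst (R (\<Sum>b\<in>Basis. (v \<bullet> b) *\<^sub>R partial_deriv b \<phi> u))" for u v
  have blR: "bounded_linear R"
    using CD(1) by (simp add: orthogonal_transformation_def linear_conv_bounded_linear)
  have derT: "(T has_derivative T' u) (at u)" if "u \<in> V'" for u
    unfolding T_def [abs_def] T'_def [abs_def]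
    using that by (intro has_derivative_fst bounded_linear.has_derivative [OF blR] PD(7)) (simp add: V'_def)
  have entry: "matrix (T' u) $ i $ j = fst (R (partial_deriv (axis j 1) \<phi> u)) $ i" for u i j
    by (simp add: matrix_def T'_def inner_Basis axis_in_Basis_iff if_distrib [of "\<lambda>c. c *\<^sub>R _"] cong: if_cong)
  have contJ: "continuous_on V' (\<lambda>u. det (matrix (T' u)))"
    unfolding det_def entry
    using C_1_onD(3) [OF PD(2)]
    by (intro continuous_intros continuous_on_compose2 [OF continuous_on_orthogonal_transformation [OF CD(1), of UNIV]]
        continuous_on_subset [of V _ V']) (auto simp: V'_def axis_in_Basis_iff)
  \<comment> \<open>On the open set \<open>V'\<close> the composition of \<open>\<gamma>\<close>
    with \<open>T\<close> is \<open>\<phi>\<close> itself, so both have the same derivative; the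
    rule for compositions then relates the two densities by the Jacobian of
    \<open>T\<close>.\<close>
  have gram: "sqrt (gram_det \<phi> u) = \<bar>det (matrix (T' u))\<bar> * sqrt (gram_det \<gamma> (T u))" if u: "u \<in> V'" for u
  proof -
    have "(\<gamma> has_derivative (\<lambda>v. \<Sum>b\<in>Basis. (v \<bullet> b) *\<^sub>R partial_deriv b \<gamma> (T u))) (at (T u))"
      unfolding \<gamma>_def [abs_def] using Q(7) TD(1) [OF u] by (simp add: \<gamma>_def [abs_def])
    note d\<gamma> = this
    have "gram_det (\<lambda>u. \<gamma> (T u)) u = (det (matrix (T' u)))\<^sup>2 * gram_det \<gamma> (T u)"
      by (rule gram_det_compose [OF derT [OF u] d\<gamma>])
    moreover have "gram_det (\<lambda>u. \<gamma> (T u)) u = gram_det \<phi> u"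
    proof -
      have d1: "((\<lambda>u. \<gamma> (T u)) has_derivative (\<lambda>v. \<Sum>b\<in>Basis. (T' u v \<bullet> b) *\<^sub>R partial_deriv b \<gamma> (T u))) (at u)"
        by (rule has_derivative_compose [OF derT [OF u] d\<gamma>])
      then have d2: "(\<phi> has_derivative (\<lambda>v. \<Sum>b\<in>Basis. (T' u v \<bullet> b) *\<^sub>R partial_deriv b \<gamma> (T u))) (at u)"
        by (rule has_derivative_transform_within_open [OF _ V' u]) (simp add: TD)
      show ?thesis by (simp only: gram_det_eq [OF d1] gram_det_eq [OF d2])
    qed
    ultimately show ?thesis by (simp add: real_sqrt_mult)
  qed
  define F where "F u = ennreal (if u \<in> D then sqrt (gram_det \<gamma> u) else 0)" for u
  have "(\<lambda>u. if u \<in> D then sqrt (gram_det \<gamma> u) else 0) \<in> borel_measurable borel"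
    using Q(8) CD(3) by (intro borel_measurable_extend continuous_intros) (auto simp: \<gamma>_def [abs_def])
  then have [measurable]: "F \<in> borel_measurable borel"
    unfolding F_def [abs_def] by measurable
  have set: "{u \<in> D. \<gamma> u \<in> \<phi> ` A} = T ` A"
  proof (intro equalityI subsetI)
    fix u assume "u \<in> {u \<in> D. \<gamma> u \<in> \<phi> ` A}"
    then obtain v where v: "u \<in> D" "v \<in> A" "\<gamma> u = \<phi> v" by auto
    then have "T v = u" by (simp add: T_def CD(2) \<gamma>_def flip: v(3))
    then show "u \<in> T ` A" using v by blast
  next
    fix u assume "u \<in> T ` A"
    then show "u \<in> {u \<in> D. \<gamma> u \<in> \<phi> ` A}" using TD AV' by auto
  qed
  have "(\<integral>\<^sup>+u\<in>{u \<in> D. \<gamma> u \<in> \<phi> ` A}. ennreal (sqrt (gram_det \<gamma> u)) \<partial>lborel) = (\<integral>\<^sup>+u\<in>T ` A. F u \<partial>lborel)"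
    unfolding set using TD(1) AV' by (intro nn_integral_cong) (auto simp: F_def indicator_def)
  also have "\<dots> = (\<integral>\<^sup>+u\<in>A. ennreal \<bar>det (matrix (T' u))\<bar> * F (T u) \<partial>lborel)"
    by (rule nn_integral_change_of_variables(2) [OF V' A AV' derT injT contJ]) measurable
  also have "\<dots> = (\<integral>\<^sup>+u\<in>A. ennreal (sqrt (gram_det \<phi> u)) \<partial>lborel)"
  proof (rule nn_integral_cong)
    fix u
    show "ennreal \<bar>det (matrix (T' u))\<bar> * F (T u) * indicator A u = ennreal (sqrt (gram_det \<phi> u)) * indicator A u"
      using TD(1) [of u] gram [of u] AV' by (cases "u \<in> A") (auto simp: F_def ennreal_mult')
  qed
  finally show ?thesis by (simp add: \<gamma>_def [abs_def])
qed


section \<open>Existence of the surface element and integration in a parametrisation\<close>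

text \<open>Compactness leaves finitely many cylinders, which cut the boundary into disjoint Borel
  pieces. Each piece receives the area of its graph, and the measure is the sum. For any other
  parametrisation the area formula is checked piece by piece, where it is the comparison with a
  graph.\<close>

lemma ex_surface_measure:
  fixes G :: "'m::{finite,linorder} hp set"
  assumes cpt: "compact (frontier G)" and smooth: "smooth_boundary G"
  shows "\<exists>\<mu>. is_surface_measure (frontier G) \<mu>"
proof -
  define M where "M = frontier G"
  have "closed M" by (simp add: M_def)
  have "\<exists>R D \<alpha> \<beta> h. graph_chart G R D \<alpha> \<beta> h \<and> y \<in> R ` (D \<times> {\<alpha><..<\<beta>})" if "y \<in> M" for y
  proof -
    have y: "y \<in> frontier G" using that by (simp add: M_def)
    then obtain W \<rho> where L: "local_defining_function G y W \<rho>"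
      using smooth unfolding smooth_boundary_def by blast
    have g: "grad \<rho> y \<noteq> 0" using local_defining_functionD(2,4) [OF L] by blast
    then have "norm (sgn (grad \<rho> y)) = 1" "sgn (grad \<rho> y) \<bullet> grad \<rho> y > 0"
      by (simp_all add: norm_sgn sgn_div_norm)
    then show ?thesis using ex_graph_chart [OF L y] by metis
  qed
  then obtain R D \<alpha> \<beta> h where ch: "\<And>y. y \<in> M \<Longrightarrow> graph_chart G (R y) (D y) (\<alpha> y) (\<beta> y) (h y)"
      and yC: "\<And>y. y \<in> M \<Longrightarrow> y \<in> R y ` (D y \<times> {\<alpha> y<..<\<beta> y})"
    by metis
  define C where "C y = R y ` (D y \<times> {\<alpha> y<..<\<beta> y})" for y
  have "open (C y)" if "y \<in> M" for y
    unfolding C_def using graph_chartD(1,3) [OF ch [OF that]] by (rule open_cylinder)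
  moreover have "M \<subseteq> (\<Union>y\<in>M. C y)" using yC by (auto simp: C_def)
  ultimately obtain Y where Y: "Y \<subseteq> M" "finite Y" "M \<subseteq> (\<Union>y\<in>Y. C y)"
    using cpt unfolding M_def [symmetric] by (metis compactE_image)
  obtain e :: "nat \<Rightarrow> 'm hp" and N where e: "Y = e ` {..<N}"
    using finite_imp_nat_seg_image_inj_on [OF Y(2)] by (metis lessThan_def)
  have eM: "e i \<in> M" if "i < N" for i using e Y(1) that by auto
  \<comment> \<open>A boundary point is assigned to the first cylinder that contains it.\<close>
  define P where "P i = M \<inter> C (e i) - (\<Union>j<i. C (e j))" for i
  have CB: "C (e i) \<in> sets borel" if "i < N" for i
    using \<open>\<And>y. y \<in> M \<Longrightarrow> open (C y)\<close> eM that by auto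
  have PB: "P i \<in> sets borel" if "i < N" for i
    using that \<open>closed M\<close> CB unfolding P_def by (intro sets.Diff sets.Int sets.finite_UN) auto
  have PM: "P i \<subseteq> M" "P i \<subseteq> C (e i)" for i by (auto simp: P_def)
  have Pdisj: "(\<Sum>i<N. indicator (P i) y :: ennreal) = 1" if "y \<in> M" for y
  proof -
    have "\<exists>i. i < N \<and> y \<in> C (e i)" using that Y(3) e by auto
    then obtain k where k: "k < N" "y \<in> C (e k)" "\<And>j. j < k \<Longrightarrow> \<not> (j < N \<and> y \<in> C (e j))"
      using exists_least_iff [of "\<lambda>i. i < N \<and> y \<in> C (e i)"] by blast
    have "indicator (P i) y = (if i = k then 1 else 0 :: ennreal)" if "i < N" for i
      using k that \<open>y \<in> M\<close> by (cases i k rule: linorder_cases) (auto simp: P_def indicator_def)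
    then have "(\<Sum>i<N. indicator (P i) y :: ennreal) = (\<Sum>i<N. if i = k then 1 else 0)"
      by (intro sum.cong) auto
    then show ?thesis using k(1) by simp
  qed
  define \<gamma> where "\<gamma> i u = R (e i) (u, h (e i) u)" for i u
  define w where "w i u = ennreal (if u \<in> D (e i) then sqrt (gram_det (\<gamma> i) u) else 0)" for i u
  \<comment> \<open>The default value 0 outside \<open>D (e i)\<close> may happen to lie in
    \<open>P i\<close>; the weight \<open>w i\<close> vanishes there, so no mass is added.\<close>
  define \<gamma>' where "\<gamma>' i u = (if u \<in> D (e i) then \<gamma> i u else 0)" for i u
  have reg: "regular_parametrization M (D (e i)) (\<gamma> i)" if "i < N" for i
    using regular_parametrization_graph [OF ch [OF eM [OF that]]] by (simp add: M_def \<gamma>_def [abs_def])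
  have w_meas: "w i \<in> borel_measurable borel" and \<gamma>_meas: "\<gamma>' i \<in> borel_measurable borel" if "i < N" for i
  proof -
    note rD = regular_parametrizationD [OF reg [OF that]]
    have "(\<lambda>u. if u \<in> D (e i) then sqrt (gram_det (\<gamma> i) u) else 0) \<in> borel_measurable borel"
      using rD(8,1) by (intro borel_measurable_extend continuous_intros) auto
    then show "w i \<in> borel_measurable borel" unfolding w_def [abs_def] by measurable
    show "\<gamma>' i \<in> borel_measurable borel"
      unfolding \<gamma>'_def [abs_def] using rD(3,1) by (intro borel_measurable_extend) auto
  qed
  define \<nu> where "\<nu> i = distr (density lborel (\<lambda>u. w i u * indicator (P i) (\<gamma>' i u))) borel (\<gamma>' i)" for i
  have \<nu>_eq: "emeasure (\<nu> i) B = (\<integral>\<^sup>+u. w i u * indicator (P i \<inter> B) (\<gamma>' i u) \<partial>lborel)" if "i < N" "B \<in> sets borel" for i B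
  proof -
    note [measurable] = w_meas [OF that(1)] \<gamma>_meas [OF that(1)] PB [OF that(1)] that(2)
    have [measurable]: "\<gamma>' i -` B \<in> sets borel"
      using measurable_sets_borel [of "\<gamma>' i" borel B] by simp
    have "emeasure (\<nu> i) B = (\<integral>\<^sup>+u. w i u * indicator (P i) (\<gamma>' i u) * indicator (\<gamma>' i -` B) u \<partial>lborel)"
      unfolding \<nu>_def by (subst emeasure_distr, simp, simp, subst emeasure_density) auto
    also have "\<dots> = (\<integral>\<^sup>+u. w i u * indicator (P i \<inter> B) (\<gamma>' i u) \<partial>lborel)"
      by (intro nn_integral_cong) (auto simp: indicator_def)
    finally show ?thesis .
  qed
  have \<nu>_sets: "sets (\<nu> i) = sets borel" for i by (simp add: \<nu>_def)
  define \<mu> where "\<mu> = measure_of UNIV (sets borel) (\<lambda>B. \<Sum>i<N. emeasure (\<nu> i) B)"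
  have sets: "sets \<mu> = sets borel"
    using sets.sigma_sets_eq [of "borel :: 'm hp measure"] by (simp add: \<mu>_def sets_measure_of_conv)
  have \<mu>_eq: "emeasure \<mu> B = (\<Sum>i<N. emeasure (\<nu> i) B)" if "B \<in> sets borel" for B
    unfolding \<mu>_def
  proof (rule emeasure_measure_of_sigma [OF _ _ _ that])
    show "sigma_algebra UNIV (sets (borel :: 'm hp measure))"
      using sets.sigma_algebra_axioms [of "borel :: 'm hp measure"] by simp
    show "positive (sets borel) (\<lambda>B. \<Sum>i<N. emeasure (\<nu> i) B)"
      by (simp add: positive_def)
    show "countably_additive (sets borel) (\<lambda>B. \<Sum>i<N. emeasure (\<nu> i) B)"
    proof (rule countably_additiveI)
      fix A :: "nat \<Rightarrow> 'm hp set" assume A: "range A \<subseteq> sets borel" "disjoint_family A"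
      have "(\<Sum>n. \<Sum>i<N. emeasure (\<nu> i) (A n)) = (\<Sum>i<N. \<Sum>n. emeasure (\<nu> i) (A n))"
        by (rule suminf_sum) simp
      also have "\<dots> = (\<Sum>i<N. emeasure (\<nu> i) (\<Union>n. A n))"
        using A by (intro sum.cong refl suminf_emeasure) (auto simp: \<nu>_sets)
      finally show "(\<Sum>n. \<Sum>i<N. emeasure (\<nu> i) (A n)) = (\<Sum>i<N. emeasure (\<nu> i) (\<Union>n. A n))" .
    qed
  qed
  have "is_surface_measure M \<mu>"
    unfolding is_surface_measure_def
  proof (intro conjI allI impI ballI)
    show "sets \<mu> = sets borel" by (rule sets)
    have "emeasure (\<nu> i) (- M) = 0" if "i < N" for i
    proof -
      have "P i \<inter> - M = {}" using PM by auto
      then show ?thesis using \<open>closed M\<close> that by (subst \<nu>_eq) auto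
    qed
    then show "emeasure \<mu> (- M) = 0"
      using \<open>closed M\<close> by (subst \<mu>_eq) auto
  next
    fix V \<phi> A assume reg\<phi>: "regular_parametrization M V \<phi>" and A [measurable]: "A \<in> sets borel" and AV: "A \<subseteq> V"
    note PD = regular_parametrizationD [OF reg\<phi>]
    have \<phi>A: "\<phi> ` B \<in> sets borel" if "B \<in> sets borel" "B \<subseteq> V" for B
      using regular_parametrization_image_borel [OF reg\<phi> \<open>closed M\<close> that] .
    have \<phi>M: "\<phi> ` V \<subseteq> M" using PD(4) by (auto dest: openin_imp_subset)
    have \<phi>_meas: "(\<lambda>u. if u \<in> V then \<phi> u else 0) \<in> borel_measurable borel"
      using PD(1,3) by (intro borel_measurable_extend) auto
    \<comment> \<open>The part of \<open>A\<close> that \<open>\<phi>\<close> maps into the piece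
      \<open>P i\<close>; for \<open>i < N\<close> these parts decompose \<open>A\<close>.\<close>
    define A' where "A' i = A \<inter> (\<lambda>u. if u \<in> V then \<phi> u else 0) -` P i" for i
    have A'B: "A' i \<in> sets borel" if "i < N" for i
      unfolding A'_def using measurable_sets_borel [OF \<phi>_meas PB [OF that]] by (intro sets.Int A) simp
    have A'i: "\<phi> ` A' i = \<phi> ` A \<inter> P i" "A' i \<subseteq> V" for i
      using AV by (auto simp: A'_def subset_iff)
    have gram_meas: "(\<lambda>u. if u \<in> V then sqrt (gram_det \<phi> u) else 0) \<in> borel_measurable borel"
      using PD(8,1) by (intro borel_measurable_extend continuous_intros) auto
    then have gm [measurable]: "(\<lambda>u. ennreal (if u \<in> V then sqrt (gram_det \<phi> u) else 0)) \<in> borel_measurable borel"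
      by measurable
    have piece: "emeasure (\<nu> i) (\<phi> ` A) = (\<integral>\<^sup>+u. ennreal (if u \<in> V then sqrt (gram_det \<phi> u) else 0) * indicator (A' i) u \<partial>lborel)"
      if i: "i < N" for i
    proof -
      have "emeasure (\<nu> i) (\<phi> ` A) = (\<integral>\<^sup>+u. w i u * indicator (P i \<inter> \<phi> ` A) (\<gamma>' i u) \<partial>lborel)"
        using i \<phi>A [OF A AV] by (rule \<nu>_eq)
      also have "\<dots> = (\<integral>\<^sup>+u\<in>{u \<in> D (e i). \<gamma> i u \<in> \<phi> ` A' i}. ennreal (sqrt (gram_det (\<gamma> i) u)) \<partial>lborel)"
        by (intro nn_integral_cong) (auto simp: w_def \<gamma>'_def A'i indicator_def)
      also have "\<dots> = (\<integral>\<^sup>+u\<in>A' i. ennreal (sqrt (gram_det \<phi> u)) \<partial>lborel)"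
      proof -
        have "\<phi> ` A' i \<subseteq> R (e i) ` (D (e i) \<times> {\<alpha> (e i)<..<\<beta> (e i)})"
          using PM(2) [of i] by (auto simp: A'i C_def)
        from area_density_graph_chart [OF ch [OF eM [OF i]] reg\<phi> [unfolded M_def] A'B [OF i] A'i(2) this]
        show ?thesis by (simp add: \<gamma>_def [abs_def])
      qed
      also have "\<dots> = (\<integral>\<^sup>+u. ennreal (if u \<in> V then sqrt (gram_det \<phi> u) else 0) * indicator (A' i) u \<partial>lborel)"
        using A'i(2) by (intro nn_integral_cong) (auto simp: indicator_def)
      finally show ?thesis .
    qed
    have "emeasure \<mu> (\<phi> ` A) = (\<Sum>i<N. \<integral>\<^sup>+u. ennreal (if u \<in> V then sqrt (gram_det \<phi> u) else 0) * indicator (A' i) u \<partial>lborel)"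
      by (simp add: \<mu>_eq \<phi>A [OF A AV] piece)
    also have "\<dots> = (\<integral>\<^sup>+u. (\<Sum>i<N. ennreal (if u \<in> V then sqrt (gram_det \<phi> u) else 0) * indicator (A' i) u) \<partial>lborel)"
      using A'B by (intro nn_integral_sum [symmetric]) (auto intro!: borel_measurable_times_ennreal gm)
    also have "\<dots> = (\<integral>\<^sup>+u\<in>A. ennreal (sqrt (gram_det \<phi> u)) \<partial>lborel)"
    proof (rule nn_integral_cong)
      fix u
      show "(\<Sum>i<N. ennreal (if u \<in> V then sqrt (gram_det \<phi> u) else 0) * indicator (A' i) u) = ennreal (sqrt (gram_det \<phi> u)) * indicator A u"
      proof (cases "u \<in> A")
        case True
        then have "u \<in> V" "\<phi> u \<in> M" using AV \<phi>M by auto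
        then have "(\<Sum>i<N. indicator (A' i) u :: ennreal) = (\<Sum>i<N. indicator (P i) (\<phi> u))"
          using True by (intro sum.cong) (auto simp: A'_def indicator_def)
        also have "\<dots> = 1" by (rule Pdisj) fact
        finally show ?thesis using True \<open>u \<in> V\<close> by (simp flip: sum_distrib_left)
      qed (simp add: A'_def)
    qed
    finally show "emeasure \<mu> (\<phi> ` A) = (\<integral>\<^sup>+u\<in>A. ennreal (sqrt (gram_det \<phi> u)) \<partial>lborel)" .
  qed
  then show ?thesis unfolding M_def by blast
qed

lemma is_surface_measure_surface_measure:
  fixes G :: "'m::{finite,linorder} hp set"
  assumes "compact (frontier G)" "smooth_boundary G"
  shows "is_surface_measure (frontier G) (surface_measure (frontier G))"
  unfolding surface_measure_def using ex_surface_measure [OF assms] by (rule someI_ex)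

text \<open>The area formula states that the pushforward of the density of \<open>\<phi>\<close> is
  the measure \<open>\<mu>\<close> restricted to the parametrised piece. A function vanishing off
  that piece has the same integral against both, and integrability transfers in the same
  way.\<close>

lemma surface_integral_parametrization:
  fixes M :: "'m::{finite,linorder} hp set" and H :: "'m hp \<Rightarrow> 'b::{banach,second_countable_topology}"
  assumes \<mu>: "is_surface_measure M \<mu>" and "closed M" and reg: "regular_parametrization M V \<phi>"
    and gram_nonneg: "\<And>u. u \<in> V \<Longrightarrow> gram_det \<phi> u \<ge> 0"
    and H: "H \<in> borel_measurable borel" and zero: "\<And>y. y \<notin> \<phi> ` V \<Longrightarrow> H y = 0"
  shows "integrable \<mu> H \<longleftrightarrow> integrable lborel (\<lambda>u. if u \<in> V then sqrt (gram_det \<phi> u) *\<^sub>R H (\<phi> u) else 0)"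
    and "(LINT y|\<mu>. H y) = (LINT u|lborel. (if u \<in> V then sqrt (gram_det \<phi> u) *\<^sub>R H (\<phi> u) else 0))"
proof -
  note PD = regular_parametrizationD [OF reg]
  have sets: "sets \<mu> = sets borel" using \<mu> by (simp add: is_surface_measure_def)
  note [measurable_cong] = sets
  have [measurable]: "H \<in> borel_measurable \<mu>" using H by simp
  have [measurable]: "V \<in> sets borel" using PD(1) by simp
  define \<phi>' where "\<phi>' u = (if u \<in> V then \<phi> u else 0)" for u
  \<comment> \<open>\<open>sqrt\<close> is an odd function, so the absolute value makes
    \<open>w\<close> nonnegative by its form alone; \<open>gram_nonneg\<close> removes it again at
    the end.\<close>
  define w where "w u = (if u \<in> V then sqrt \<bar>gram_det \<phi> u\<bar> else 0)" for u
  have [measurable]: "\<phi>' \<in> borel_measurable borel"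
    unfolding \<phi>'_def [abs_def] using PD(3) by (intro borel_measurable_extend) auto
  have [measurable]: "w \<in> borel_measurable borel"
    unfolding w_def [abs_def] using PD(8) by (intro borel_measurable_extend continuous_intros) auto
  have img [measurable]: "\<phi> ` V \<in> sets borel"
    using regular_parametrization_image_borel [OF reg \<open>closed M\<close>] by simp
  define ind where "ind y = (if y \<in> \<phi> ` V then 1 else 0 :: real)" for y
  have [measurable]: "ind \<in> borel_measurable \<mu>" unfolding ind_def [abs_def] by measurable
  have "distr (density lborel (\<lambda>u. ennreal (w u))) borel \<phi>' = density \<mu> (\<lambda>y. ennreal (ind y))" (is "?N = _")
  proof (rule measure_eqI)
    show "sets ?N = sets (density \<mu> (\<lambda>y. ennreal (ind y)))" by (simp add: sets)
    fix B assume "B \<in> sets ?N"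
    then have [measurable]: "B \<in> sets borel" by simp
    have VB [measurable]: "V \<inter> \<phi>' -` B \<in> sets borel"
      using measurable_sets_borel [of \<phi>' borel B] by (intro sets.Int) auto
    have "emeasure ?N B = (\<integral>\<^sup>+u. ennreal (w u) * indicator (\<phi>' -` B) u \<partial>lborel)"
      using measurable_sets_borel [of \<phi>' borel B]
      by (subst emeasure_distr, simp, simp, subst emeasure_density) auto
    also have "\<dots> = (\<integral>\<^sup>+u\<in>V \<inter> \<phi>' -` B. ennreal (sqrt (gram_det \<phi> u)) \<partial>lborel)"
      using gram_nonneg by (intro nn_integral_cong) (auto simp: w_def indicator_def)
    also have "\<dots> = emeasure \<mu> (\<phi> ` (V \<inter> \<phi>' -` B))"
    proof -
      have "\<And>A. A \<in> sets borel \<Longrightarrow> A \<subseteq> V \<Longrightarrow>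
          emeasure \<mu> (\<phi> ` A) = (\<integral>\<^sup>+u\<in>A. ennreal (sqrt (gram_det \<phi> u)) \<partial>lborel)"
        using \<mu> reg unfolding is_surface_measure_def by blast
      from this [OF VB] show ?thesis by simp
    qed
    also have "\<phi> ` (V \<inter> \<phi>' -` B) = \<phi> ` V \<inter> B"
      by (auto simp: \<phi>'_def)
    also have "emeasure \<mu> \<dots> = (\<integral>\<^sup>+y. ennreal (ind y) * indicator B y \<partial>\<mu>)"
    proof -
      have "(\<lambda>y. ennreal (ind y) * indicator B y) = indicator (\<phi> ` V \<inter> B)"
        by (auto simp: ind_def indicator_def fun_eq_iff)
      then show ?thesis by (simp add: sets)
    qed
    also have "\<dots> = emeasure (density \<mu> (\<lambda>y. ennreal (ind y))) B"
      by (subst emeasure_density) (auto simp: sets)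
    finally show "emeasure ?N B = emeasure (density \<mu> (\<lambda>y. ennreal (ind y))) B" .
  qed
  note eq = this
  have 1: "(\<lambda>y. ind y *\<^sub>R H y) = H" using zero by (auto simp: ind_def fun_eq_iff)
  have 2: "(\<lambda>u. w u *\<^sub>R H (\<phi>' u)) = (\<lambda>u. if u \<in> V then sqrt (gram_det \<phi> u) *\<^sub>R H (\<phi> u) else 0)"
    using gram_nonneg by (auto simp: w_def \<phi>'_def fun_eq_iff)
  have nn: "AE u in lborel. 0 \<le> w u" "AE y in \<mu>. 0 \<le> ind y" by (auto simp: w_def ind_def)
  have "integrable (density \<mu> (\<lambda>y. ennreal (ind y))) H \<longleftrightarrow> integrable \<mu> (\<lambda>y. ind y *\<^sub>R H y)"
    using nn(2) by (intro integrable_density) auto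
  moreover have "integrable ?N H \<longleftrightarrow> integrable lborel (\<lambda>u. w u *\<^sub>R H (\<phi>' u))"
    using nn(1) H by (simp add: integrable_distr_eq integrable_density)
  ultimately show "integrable \<mu> H \<longleftrightarrow> integrable lborel (\<lambda>u. if u \<in> V then sqrt (gram_det \<phi> u) *\<^sub>R H (\<phi> u) else 0)"
    by (simp only: 1 2 eq)
  have "integral\<^sup>L (density \<mu> (\<lambda>y. ennreal (ind y))) H = (LINT y|\<mu>. ind y *\<^sub>R H y)"
    using nn(2) by (intro integral_density) auto
  moreover have "integral\<^sup>L ?N H = (LINT u|lborel. w u *\<^sub>R H (\<phi>' u))"
    using nn(1) H by (simp add: integral_distr integral_density)
  ultimately show "(LINT y|\<mu>. H y) = (LINT u|lborel. (if u \<in> V then sqrt (gram_det \<phi> u) *\<^sub>R H (\<phi> u) else 0))"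
    by (simp only: 1 2 eq)
qed


section \<open>The divergence theorem\<close>

text \<open>The functions are total and differentiable on the whole space, so the fundamental
  theorem of calculus applies along entire lines. The derivative is carried as a second argument to
  name its value in any direction.\<close>

definition C1_supported_in ::
    "'a::euclidean_space set \<Rightarrow> ('a \<Rightarrow> 'b::real_normed_vector) \<Rightarrow> ('a \<Rightarrow> 'a \<Rightarrow> 'b) \<Rightarrow> bool" where
  "C1_supported_in U F F' \<longleftrightarrow> (\<forall>x. (F has_derivative F' x) (at x)) \<and>
     (\<forall>b\<in>Basis. continuous_on UNIV (\<lambda>x. F' x b)) \<and>
     (\<exists>K. compact K \<and> K \<subseteq> U \<and> (\<forall>x. x \<notin> K \<longrightarrow> F x = 0))"

text \<open>The Gauss formula for a single constant direction \<open>b\<close> and a vector-valued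
  \<open>F\<close>. Integrability is part of it because a Bochner integral that does not exist has
  the value 0.\<close>

definition divergence_identity ::
    "'m::{finite,linorder} hp set \<Rightarrow> 'm hp measure \<Rightarrow> ('m hp \<Rightarrow> 'b::euclidean_space) \<Rightarrow>
      ('m hp \<Rightarrow> 'm hp \<Rightarrow> 'b) \<Rightarrow> 'm hp \<Rightarrow> bool" where
  "divergence_identity G \<mu> F F' b \<longleftrightarrow>
     integrable \<mu> (\<lambda>y. indicator (frontier G) y *\<^sub>R ((exterior_normal G y \<bullet> b) *\<^sub>R F y)) \<and>
     (LINT x|lborel. indicator G x *\<^sub>R F' x b) =
       (LINT y|\<mu>. indicator (frontier G) y *\<^sub>R ((exterior_normal G y \<bullet> b) *\<^sub>R F y))"

lemma has_derivative_unique_zero: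
  assumes "(F has_derivative F') (at x)" "open S" "x \<in> S" "\<And>y. y \<in> S \<Longrightarrow> F y = 0"
  shows "F' = (\<lambda>_. 0)"
proof -
  have "((\<lambda>_. 0) has_derivative F') (at x)"
    using assms by (intro has_derivative_transform_within_open [OF assms(1-3)]) auto
  then show ?thesis
    using has_derivative_unique has_derivative_const by blast
qed

lemma continuous_on_derivative_direction:
  fixes F :: "'a::euclidean_space \<Rightarrow> 'b::real_normed_vector"
  assumes "\<And>x. x \<in> S \<Longrightarrow> (F has_derivative F' x) (at x)"
    and "\<And>b. b \<in> Basis \<Longrightarrow> continuous_on S (\<lambda>x. F' x b)"
  shows "continuous_on S (\<lambda>x. F' x v)"
proof -
  have "F' x v = (\<Sum>b\<in>Basis. (v \<bullet> b) *\<^sub>R F' x b)" if "x \<in> S" for x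
  proof -
    interpret bounded_linear "F' x" using assms(1) [OF that] by (rule has_derivative_bounded_linear)
    have "F' x v = F' x (\<Sum>b\<in>Basis. (v \<bullet> b) *\<^sub>R b)" by (simp add: euclidean_representation)
    then show ?thesis by (simp add: sum scaleR)
  qed
  moreover have "continuous_on S (\<lambda>x. \<Sum>b\<in>Basis. (v \<bullet> b) *\<^sub>R F' x b)"
    by (intro continuous_intros assms(2))
  ultimately show ?thesis by (simp cong: continuous_on_cong)
qed

lemma C1_supported_inE:
  fixes F :: "'a::euclidean_space \<Rightarrow> 'b::euclidean_space"
  assumes "C1_supported_in U F F'"
  obtains K where "compact K" "K \<subseteq> U" "\<And>x. x \<notin> K \<Longrightarrow> F x = 0" "\<And>x v. x \<notin> K \<Longrightarrow> F' x v = 0"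
    "\<And>x. (F has_derivative F' x) (at x)" "\<And>v. continuous_on UNIV (\<lambda>x. F' x v)" "continuous_on UNIV F"
    "\<And>S v. S \<in> sets borel \<Longrightarrow> integrable lborel (\<lambda>x. indicator S x *\<^sub>R F' x v)"
proof -
  obtain K where K: "compact K" "K \<subseteq> U" "\<And>x. x \<notin> K \<Longrightarrow> F x = 0" and der: "\<And>x. (F has_derivative F' x) (at x)"
    and cont: "\<And>b. b \<in> Basis \<Longrightarrow> continuous_on UNIV (\<lambda>x. F' x b)"
    using assms unfolding C1_supported_in_def by blast
  have z: "F' x v = 0" if "x \<notin> K" for x v
    using has_derivative_unique_zero [OF der open_Compl [OF compact_imp_closed [OF K(1)]], of x] K(3) that by simp
  have cv: "continuous_on UNIV (\<lambda>x. F' x v)" for v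
    by (rule continuous_on_derivative_direction [OF der cont])
  have "integrable lborel (\<lambda>x. indicator S x *\<^sub>R F' x v)" if "S \<in> sets borel" for S v
  proof -
    have "integrable lborel (\<lambda>x. indicator K x *\<^sub>R F' x v)"
      by (rule borel_integrable_compact [OF K(1) continuous_on_subset [OF cv]]) simp
    moreover have "(\<lambda>x. indicator K x *\<^sub>R F' x v) = (\<lambda>x. F' x v)"
      using z by (auto simp: indicator_def fun_eq_iff)
    ultimately show ?thesis using that by (intro integrable_mult_indicator) auto
  qed
  moreover have "continuous_on UNIV F"
    by (rule has_derivative_continuous_on) (rule has_derivative_at_withinI [OF der])
  ultimately show thesis using that K z der cv by blast
qed

lemma C1_supported_in_mono:
  assumes "C1_supported_in U F F'" "U \<subseteq> V"
  shows "C1_supported_in V F F'"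
proof -
  obtain K where "compact K" "K \<subseteq> U" "\<forall>x. x \<notin> K \<longrightarrow> F x = 0"
    using assms(1) unfolding C1_supported_in_def by blast
  then show ?thesis
    using assms unfolding C1_supported_in_def by blast
qed

text \<open>An isometry preserves Lebesgue measure, so the iterated integral may be taken with the
  direction \<open>R (0, 1)\<close> innermost.\<close>

lemma integral_isometry_Fubini:
  fixes R :: "'m::finite hp \<Rightarrow> 'm hp" and \<Phi> :: "'m hp \<Rightarrow> 'b::euclidean_space"
  assumes R: "orthogonal_transformation R" and int: "integrable lborel \<Phi>"
  shows "integrable lborel (\<lambda>u. (LINT t|lborel. \<Phi> (R (u, t))))"
    and "(LINT y|lborel. \<Phi> y) = (LINT u|lborel. (LINT t|lborel. \<Phi> (R (u, t))))"
proof -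
  have lin: "linear R" using R by (simp add: orthogonal_transformation_def)
  have [measurable]: "R \<in> borel_measurable borel" using lin by (rule borel_measurable_linear)
  have [measurable]: "\<Phi> \<in> borel_measurable borel" using int by simp
  have d: "distr lborel borel R = lborel"
    by (rule distr_lborel_isometry) (auto simp: lin orthogonal_transformation_norm [OF R] orthogonal_transformation_surj [OF R])
  have "integrable (distr lborel borel R) \<Phi>" using int by (simp add: d)
  then have i: "integrable (lborel \<Otimes>\<^sub>M lborel) (\<lambda>z. \<Phi> (R z))"
    by (simp add: integrable_distr_eq lborel_prod)
  show "integrable lborel (\<lambda>u. (LINT t|lborel. \<Phi> (R (u, t))))"
    using lborel_pair.integrable_fst' [OF i] by simp
  have "(LINT y|lborel. \<Phi> y) = (LINT y|distr lborel borel R. \<Phi> y)" by (simp add: d)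
  also have "\<dots> = (LINT z|(lborel \<Otimes>\<^sub>M lborel). \<Phi> (R z))"
    by (simp add: integral_distr lborel_prod)
  also have "\<dots> = (LINT u|lborel. (LINT t|lborel. \<Phi> (R (u, t))))"
    using lborel_pair.integral_fst' [OF i] by simp
  finally show "(LINT y|lborel. \<Phi> y) = (LINT u|lborel. (LINT t|lborel. \<Phi> (R (u, t))))" .
qed

lemma has_vector_derivative_along_line:
  fixes R :: "'m::finite hp \<Rightarrow> 'm hp"
  assumes R: "orthogonal_transformation R" and "\<And>x. (F has_derivative F' x) (at x)"
  shows "((\<lambda>t. F (R (u, t))) has_vector_derivative F' (R (u, t)) (R (0, 1))) (at t within X)"
proof -
  interpret R: linear R using R by (simp add: orthogonal_transformation_def)
  have "((\<lambda>t. (u, t)) has_derivative (\<lambda>s. (0, s))) (at t)"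
    by (intro has_derivative_Pair has_derivative_ident has_derivative_const)
  from has_derivative_compose [OF has_derivative_compose [OF this linear_imp_has_derivative [OF R.linear_axioms]] assms(2)]
  have d: "((\<lambda>t. F (R (u, t))) has_derivative (\<lambda>s. F' (R (u, t)) (R (0, s)))) (at t)" .
  interpret F': bounded_linear "F' (R (u, t))" using assms(2) by (rule has_derivative_bounded_linear)
  have "R (0, s) = s *\<^sub>R R (0, 1)" for s
    using R.scale [of s "(0, 1)"] by (simp only: scaleR_Pair scaleR_zero_right real_scaleR_def mult_1_right)
  then have "F' (R (u, t)) (R (0, s)) = s *\<^sub>R F' (R (u, t)) (R (0, 1))" for s
    by (subst F'.scaleR [symmetric]) (rule arg_cong)
  then have "(\<lambda>s. F' (R (u, t)) (R (0, s))) = (\<lambda>s. s *\<^sub>R F' (R (u, t)) (R (0, 1)))"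
    by (rule ext)
  with d have "((\<lambda>t. F (R (u, t))) has_vector_derivative F' (R (u, t)) (R (0, 1))) (at t)"
    by (simp only: has_vector_derivative_def)
  then show ?thesis by (rule has_vector_derivative_at_within)
qed

section \<open>The divergence identity near a point\<close>

text \<open>On each line in direction \<open>R (0, 1)\<close> the inner integral runs from below the
  support up to the graph, so only the value of \<open>F\<close> at the graph remains. Integration
  over the base turns into the boundary integral because normal component and area density
  cancel.\<close>

lemma divergence_identity_chart:
  fixes G :: "'m::{finite,linorder} hp set" and F :: "'m hp \<Rightarrow> 'b::euclidean_space"
  assumes \<mu>: "is_surface_measure (frontier G) \<mu>" and G: "open G" "smooth_boundary G"
    and C: "graph_chart G R D \<alpha> \<beta> h" and F: "C1_supported_in (R ` (D \<times> {\<alpha><..<\<beta>})) F F'"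
  shows "divergence_identity G \<mu> F F' (R (0, 1))"
proof -
  note CD = graph_chartD [OF C] and reg = regular_parametrization_graph [OF C]
  define M where "M = frontier G"
  define b where "b = R (0, 1)"
  define n where "n = exterior_normal G"
  obtain K where K: "compact K" "K \<subseteq> R ` (D \<times> {\<alpha><..<\<beta>})" "\<And>x. x \<notin> K \<Longrightarrow> F x = 0" "\<And>x v. x \<notin> K \<Longrightarrow> F' x v = 0"
    and der: "\<And>x. (F has_derivative F' x) (at x)" and contF': "\<And>v. continuous_on UNIV (\<lambda>x. F' x v)" and contF: "continuous_on UNIV F"
    and int: "\<And>S v. S \<in> sets borel \<Longrightarrow> integrable lborel (\<lambda>x. indicator S x *\<^sub>R F' x v)"
    using F by (rule C1_supported_inE) (rule that)
  have inK: "u \<in> D \<and> \<alpha> < t \<and> t < \<beta>" if "R (u, t) \<in> K" for u t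
  proof -
    have "R (u, t) \<in> R ` (D \<times> {\<alpha><..<\<beta>})" using that K(2) by blast
    then obtain z where "z \<in> D \<times> {\<alpha><..<\<beta>}" "R (u, t) = R z" by blast
    then have "(u, t) \<in> D \<times> {\<alpha><..<\<beta>}" using CD(2) by metis
    then show ?thesis by simp
  qed
  define f where "f u = (if u \<in> D then F (R (u, h u)) else 0)" for u
  have inner: "(LINT t|lborel. indicator G (R (u, t)) *\<^sub>R F' (R (u, t)) b) = f u" for u
  proof (cases "u \<in> D")
    case True
    have "(LINT t|lborel. indicator G (R (u, t)) *\<^sub>R F' (R (u, t)) b) = (LINT t|lborel. indicator {\<alpha>..h u} t *\<^sub>R F' (R (u, t)) b)"
    proof (rule integral_cong_AE)
      have [measurable]: "G \<in> sets borel" using G(1) by simp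
      have contRu: "continuous_on UNIV (\<lambda>t. R (u, t))"
        by (intro continuous_on_compose2 [OF continuous_on_orthogonal_transformation [OF CD(1), of UNIV]] continuous_intros) auto
      then have [measurable]: "(\<lambda>t. R (u, t)) \<in> borel_measurable borel"
        by (rule borel_measurable_continuous_onI)
      have [measurable]: "(\<lambda>t. F' (R (u, t)) b) \<in> borel_measurable borel"
        by (intro borel_measurable_continuous_onI continuous_on_compose2 [OF contF' contRu]) auto
      show "(\<lambda>t. indicator G (R (u, t)) *\<^sub>R F' (R (u, t)) b) \<in> borel_measurable lborel"
           "(\<lambda>t. indicator {\<alpha>..h u} t *\<^sub>R F' (R (u, t)) b) \<in> borel_measurable lborel"
        by measurable
      \<comment> \<open>The point on the graph is not in \<open>G\<close> but belongs to the closed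
        interval; a single point is a null set.\<close>
      have "AE t in lborel. t \<noteq> h u" by (rule AE_lborel_singleton)
      then show "AE t in lborel. indicator G (R (u, t)) *\<^sub>R F' (R (u, t)) b = indicator {\<alpha>..h u} t *\<^sub>R F' (R (u, t)) b"
      proof eventually_elim
        case (elim t)
        show ?case
        proof (cases "R (u, t) \<in> K")
          case True
          from inK [OF this] elim show ?thesis
            using CD(6) [of u t] by (auto simp: indicator_def)
        qed (simp add: K(4))
      qed
    qed
    also have "\<dots> = F (R (u, h u)) - F (R (u, \<alpha>))"
      unfolding b_def
    proof (rule integral_FTC_Icc)
      show "\<alpha> \<le> h u" using CD(5) [OF True] by simp
      show "continuous_on {\<alpha>..h u} (\<lambda>t. F' (R (u, t)) (R (0, 1)))"
        by (intro continuous_on_compose2 [OF contF'] continuous_on_compose2 [OF continuous_on_orthogonal_transformation [OF CD(1), of UNIV]]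
           continuous_intros) auto
    qed (rule has_vector_derivative_along_line [OF CD(1) der])
    \<comment> \<open>The lower end of the segment is outside the open cylinder and therefore
      outside the support.\<close>
    also have "R (u, \<alpha>) \<notin> K" using inK [of u \<alpha>] by auto
    then have "F (R (u, \<alpha>)) = 0" by (rule K(3))
    finally show ?thesis using True by (simp add: f_def)
  next
    case False
    then have "R (u, t) \<notin> K" for t using inK by blast
    then show ?thesis using False by (simp add: f_def K(4))
  qed
  have intG: "integrable lborel (\<lambda>x. indicator G x *\<^sub>R F' x b)" using G(1) by (intro int) auto
  have f_int: "integrable lborel f" and L: "(LINT x|lborel. indicator G x *\<^sub>R F' x b) = (LINT u|lborel. f u)"
    using integral_isometry_Fubini [OF CD(1) intG] by (simp_all add: inner)
  define H where "H y = indicator M y *\<^sub>R ((n y \<bullet> b) *\<^sub>R F y)" for y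
  have "continuous_on M (\<lambda>y. (n y \<bullet> b) *\<^sub>R F y)"
    unfolding M_def n_def by (intro continuous_intros continuous_on_exterior_normal G continuous_on_subset [OF contF]) auto
  then have H_meas: "H \<in> borel_measurable borel"
    unfolding H_def [abs_def] by (intro borel_measurable_continuous_on_indicator) (simp_all add: M_def)
  have gram: "(if u \<in> D then sqrt (gram_det (\<lambda>u. R (u, h u)) u) *\<^sub>R H (R (u, h u)) else 0) = f u" for u
  proof (cases "u \<in> D")
    case True
    have "R (u, h u) \<in> M" using CD(5,7) [OF True] by (simp add: M_def)
    moreover have "sqrt (gram_det (\<lambda>u. R (u, h u)) u) * (n (R (u, h u)) \<bullet> b) = 1"
      using CD(8) [OF True] by (simp add: n_def b_def mult.commute)
    ultimately show ?thesis using True by (simp add: H_def f_def)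
  qed (simp add: f_def)
  have gram_nonneg: "gram_det (\<lambda>u. R (u, h u)) u \<ge> 0" if "u \<in> D" for u
    using gram_det_graph(2) [OF CD(1) C_1_on_has_derivative_grad [OF CD(4,3) that]] by simp
  have zero: "H y = 0" if "y \<notin> (\<lambda>u. R (u, h u)) ` D" for y
    using that K(2) K(3) [of y] unfolding graph_chart_image [OF C] by (auto simp: H_def M_def)
  note S = surface_integral_parametrization [OF \<mu> frontier_closed reg gram_nonneg H_meas zero]
  have "integrable \<mu> H \<and> (LINT x|lborel. indicator G x *\<^sub>R F' x b) = (LINT y|\<mu>. H y)"
    using S f_int L unfolding gram by simp
  then show ?thesis
    by (simp add: divergence_identity_def H_def [abs_def] M_def b_def n_def)
qed

text \<open>Along every line \<open>F\<close> vanishes at both ends, so the volume integral is zero.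
  The boundary integrand vanishes too, since the support lies in the open set \<open>G\<close> and
  misses its frontier.\<close>

lemma divergence_identity_interior:
  fixes G :: "'m::{finite,linorder} hp set" and F :: "'m hp \<Rightarrow> 'b::euclidean_space"
  assumes G: "open G" and F: "C1_supported_in G F F'" and b: "norm b = 1"
  shows "divergence_identity G \<mu> F F' b"
proof -
  obtain K where K: "compact K" "K \<subseteq> G" "\<And>x. x \<notin> K \<Longrightarrow> F x = 0" "\<And>x v. x \<notin> K \<Longrightarrow> F' x v = 0"
    and der: "\<And>x. (F has_derivative F' x) (at x)" and contF': "\<And>v. continuous_on UNIV (\<lambda>x. F' x v)" and contF: "continuous_on UNIV F"
    and int: "\<And>S v. S \<in> sets borel \<Longrightarrow> integrable lborel (\<lambda>x. indicator S x *\<^sub>R F' x v)"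
    using F by (rule C1_supported_inE) (rule that)
  have "norm ((0, 1) :: 'm hp) = norm b" using b by (simp add: norm_Pair)
  then obtain R :: "'m hp \<Rightarrow> 'm hp" where R: "orthogonal_transformation R" and Rb: "R (0, 1) = b"
    by (rule ex_isometry_involution) (rule that)
  obtain c where c: "c > 0" "\<And>x. x \<in> K \<Longrightarrow> norm x < c"
    using compact_imp_bounded [OF K(1)] by (auto simp: bounded_pos_less)
  have out: "R (u, t) \<notin> K" if "\<bar>t\<bar> \<ge> c" for u t
  proof
    assume "R (u, t) \<in> K"
    then have "norm (u, t) < c" using c(2) orthogonal_transformation_norm [OF R] by metis
    moreover have "\<bar>t\<bar> \<le> norm (u, t)" by (metis norm_snd_le real_norm_def snd_conv)
    ultimately show False using that by simp
  qed
  have inner: "(LINT t|lborel. indicator G (R (u, t)) *\<^sub>R F' (R (u, t)) b) = 0" for u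
  proof -
    have "indicator G (R (u, t)) *\<^sub>R F' (R (u, t)) b = indicator {-c..c} t *\<^sub>R F' (R (u, t)) b" for t
    proof (cases "R (u, t) \<in> K")
      case True
      then have "R (u, t) \<in> G" "\<not> \<bar>t\<bar> \<ge> c" using K(2) out [of t u] by auto
      then have "R (u, t) \<in> G" "t \<in> {-c..c}" by auto
      then show ?thesis by (simp add: indicator_def)
    qed (simp add: K(4))
    then have "(LINT t|lborel. indicator G (R (u, t)) *\<^sub>R F' (R (u, t)) b) = (LINT t|lborel. indicator {-c..c} t *\<^sub>R F' (R (u, t)) b)"
      by (simp only:)
    also have "\<dots> = F (R (u, c)) - F (R (u, -c))"
      unfolding Rb [symmetric]
    proof (rule integral_FTC_Icc)
      show "-c \<le> c" using c by simp
      show "continuous_on {-c..c} (\<lambda>t. F' (R (u, t)) (R (0, 1)))"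
        by (intro continuous_on_compose2 [OF contF'] continuous_on_compose2 [OF continuous_on_orthogonal_transformation [OF R, of UNIV]]
           continuous_intros) auto
    qed (rule has_vector_derivative_along_line [OF R der])
    also have "\<dots> = 0" using out [of c u] out [of "-c" u] K(3) c(1) by simp
    finally show ?thesis .
  qed
  have intG: "integrable lborel (\<lambda>x. indicator G x *\<^sub>R F' x b)" using G(1) by (intro int) auto
  have "(LINT x|lborel. indicator G x *\<^sub>R F' x b) = 0"
    using integral_isometry_Fubini(2) [OF R intG] by (simp add: inner)
  moreover have "(\<lambda>y. indicator (frontier G) y *\<^sub>R ((exterior_normal G y \<bullet> b) *\<^sub>R F y)) = (\<lambda>_. 0)"
    using K(2,3) G by (auto simp: fun_eq_iff indicator_def frontier_def interior_open)
  ultimately show ?thesis by (simp add: divergence_identity_def)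
qed

text \<open>Both sides are linear in the direction, once the integrals for \<open>b1\<close> and
  \<open>b2\<close> exist.\<close>

lemma divergence_identity_lincomb:
  fixes G :: "'m::{finite,linorder} hp set" and F :: "'m hp \<Rightarrow> 'b::euclidean_space"
  assumes G: "open G" and F: "C1_supported_in U F F'"
    and b: "divergence_identity G \<mu> F F' b1" "divergence_identity G \<mu> F F' b2"
  shows "divergence_identity G \<mu> F F' (p *\<^sub>R b1 + q *\<^sub>R b2)"
proof -
  obtain K where der: "\<And>x. (F has_derivative F' x) (at x)"
    and int: "\<And>S v. S \<in> sets borel \<Longrightarrow> integrable lborel (\<lambda>x. indicator S x *\<^sub>R F' x v)"
    using F by (rule C1_supported_inE) (rule that)
  define H where "H b y = indicator (frontier G) y *\<^sub>R ((exterior_normal G y \<bullet> b) *\<^sub>R F y)" for b y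
  define D where "D b x = indicator G x *\<^sub>R F' x b" for b x
  have H: "H (p *\<^sub>R b1 + q *\<^sub>R b2) = (\<lambda>y. p *\<^sub>R H b1 y + q *\<^sub>R H b2 y)"
    by (simp add: H_def fun_eq_iff algebra_simps)
  have "F' x (p *\<^sub>R b1 + q *\<^sub>R b2) = p *\<^sub>R F' x b1 + q *\<^sub>R F' x b2" for x
  proof -
    interpret bounded_linear "F' x" using der by (rule has_derivative_bounded_linear)
    show ?thesis by (simp add: add scaleR)
  qed
  then have D: "D (p *\<^sub>R b1 + q *\<^sub>R b2) = (\<lambda>y. p *\<^sub>R D b1 y + q *\<^sub>R D b2 y)"
    by (simp add: D_def fun_eq_iff algebra_simps)
  have "integrable lborel (D b1)" "integrable lborel (D b2)" using G by (auto intro!: int simp: D_def [abs_def])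
  moreover have iff: "divergence_identity G \<mu> F F' b \<longleftrightarrow> integrable \<mu> (H b) \<and> integral\<^sup>L lborel (D b) = integral\<^sup>L \<mu> (H b)" for b
    by (simp only: divergence_identity_def H_def [abs_def] D_def [abs_def])
  ultimately show ?thesis
    using b unfolding iff H D by simp
qed

text \<open>At a boundary point, charts give the identity for the normalised gradient and for a
  second transversal direction, and \<open>c\<close> is a combination of the two. The radius is
  chosen before \<open>F\<close>, so that it can later determine the supports of a partition of
  unity.\<close>

lemma divergence_identity_local:
  fixes G :: "'m::{finite,linorder} hp set"
  assumes \<mu>: "is_surface_measure (frontier G) \<mu>" and G: "open G" "smooth_boundary G" and y: "y \<in> closure G"
  shows "\<exists>r>0. \<forall>(F :: 'm hp \<Rightarrow> 'b::euclidean_space) F'. C1_supported_in (ball y r) F F' \<longrightarrow> divergence_identity G \<mu> F F' c"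
proof (cases "y \<in> G")
  case True
  then obtain r where r: "r > 0" "ball y r \<subseteq> G" using G open_contains_ball by blast
  have "divergence_identity G \<mu> F F' c" if "C1_supported_in (ball y r) F F'" for F :: "'m hp \<Rightarrow> 'b" and F'
  proof -
    have F: "C1_supported_in G F F'" using that r(2) by (rule C1_supported_in_mono)
    show ?thesis
    proof (cases "c = 0")
      case True
      have "norm ((0, 1) :: 'm hp) = 1" by (simp add: norm_Pair)
      note d = divergence_identity_interior [OF G(1) F this]
      from divergence_identity_lincomb [OF G(1) F d d, where p = 0 and q = 0 and \<mu> = \<mu>] True show ?thesis by (simp add: zero_prod_def)
    next
      case False
      then have "norm (sgn c) = 1" by (simp add: norm_sgn)
      note d = divergence_identity_interior [OF G(1) F this]
      from divergence_identity_lincomb [OF G(1) F d d, where p = "norm c" and q = 0 and \<mu> = \<mu>] False show ?thesis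
        by (simp add: sgn_div_norm)
    qed
  qed
  with r(1) show ?thesis by blast
next
  case False
  then have yM: "y \<in> frontier G" using y G(1) by (simp add: frontier_def interior_open)
  then obtain W \<rho> where L: "local_defining_function G y W \<rho>"
    using G(2) unfolding smooth_boundary_def by blast
  define g where "g = grad \<rho> y"
  have g: "g \<bullet> g > 0" using local_defining_functionD(2,4) [OF L] by (simp add: g_def)
  have one: "\<exists>r>0. \<forall>(F :: 'm hp \<Rightarrow> 'b) F'. C1_supported_in (ball y r) F F' \<longrightarrow> divergence_identity G \<mu> F F' (sgn v)"
    if v: "v \<bullet> g > 0" for v
  proof -
    have "v \<noteq> 0" using v by auto
    then have "norm (sgn v) = 1" "sgn v \<bullet> grad \<rho> y > 0"
      using v by (simp_all add: norm_sgn sgn_div_norm g_def)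
    then obtain R D \<alpha> \<beta> h where C: "graph_chart G R D \<alpha> \<beta> h" and R1: "R (0, 1) = sgn v" and yR: "y \<in> R ` (D \<times> {\<alpha><..<\<beta>})"
      by (rule ex_graph_chart [OF L yM]) (rule that)
    have "open (R ` (D \<times> {\<alpha><..<\<beta>}))" using graph_chartD(1,3) [OF C] by (rule open_cylinder)
    then obtain r where r: "r > 0" "ball y r \<subseteq> R ` (D \<times> {\<alpha><..<\<beta>})" using yR open_contains_ball by blast
    have "divergence_identity G \<mu> F F' (sgn v)" if "C1_supported_in (ball y r) F F'" for F :: "'m hp \<Rightarrow> 'b" and F'
    proof -
      have "C1_supported_in (R ` (D \<times> {\<alpha><..<\<beta>})) F F'" using that r(2) by (rule C1_supported_in_mono)
      from divergence_identity_chart [OF \<mu> G C this] show ?thesis by (simp add: R1)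
    qed
    with r(1) show ?thesis by blast
  qed
  \<comment> \<open>Chosen so that \<open>v \<bullet> g\<close> becomes
    \<open>c \<bullet> g + \<bar>c \<bullet> g\<bar> + 1\<close>, which is at least 1.\<close>
  define l where "l = (\<bar>c \<bullet> g\<bar> + 1) / (g \<bullet> g)"
  define v where "v = c + l *\<^sub>R g"
  have "v \<bullet> g = c \<bullet> g + (\<bar>c \<bullet> g\<bar> + 1)" using g by (simp add: v_def l_def inner_add_left)
  then have vg: "v \<bullet> g > 0" by linarith
  obtain r1 where r1: "r1 > 0" "\<And>(F :: 'm hp \<Rightarrow> 'b) F'. C1_supported_in (ball y r1) F F' \<Longrightarrow> divergence_identity G \<mu> F F' (sgn v)"
    using one [OF vg] by blast
  obtain r2 where r2: "r2 > 0" "\<And>(F :: 'm hp \<Rightarrow> 'b) F'. C1_supported_in (ball y r2) F F' \<Longrightarrow> divergence_identity G \<mu> F F' (sgn g)"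
    using one [OF g] by blast
  have "divergence_identity G \<mu> F F' c" if F: "C1_supported_in (ball y (min r1 r2)) F F'" for F :: "'m hp \<Rightarrow> 'b" and F'
  proof -
    have "ball y (min r1 r2) \<subseteq> ball y r1" "ball y (min r1 r2) \<subseteq> ball y r2" by auto
    then have "C1_supported_in (ball y r1) F F'" "C1_supported_in (ball y r2) F F'"
      using F by (auto intro: C1_supported_in_mono)
    from divergence_identity_lincomb [OF G(1) F r1(2) [OF this(1)] r2(2) [OF this(2)], where p = "norm v" and q = "- l * norm g"]
    have "divergence_identity G \<mu> F F' (norm v *\<^sub>R sgn v + (- l * norm g) *\<^sub>R sgn g)" .
    also have "norm v *\<^sub>R sgn v + (- l * norm g) *\<^sub>R sgn g = norm v *\<^sub>R sgn v - l *\<^sub>R (norm g *\<^sub>R sgn g)"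
      by simp
    also have "\<dots> = v - l *\<^sub>R g"
    proof -
      have "norm x *\<^sub>R sgn x = x" for x :: "'m hp"
        by (cases "x = 0") (simp_all add: sgn_div_norm)
      then show ?thesis by (simp only:)
    qed
    also have "\<dots> = c" by (simp add: v_def)
    finally show ?thesis .
  qed
  then show ?thesis using r1(1) r2(1) by (intro exI [of _ "min r1 r2"]) auto
qed


section \<open>Continuously differentiable cutoffs and the global divergence theorem\<close>

text \<open>At the corner 0 the difference quotient is bounded by \<open>\<bar>h\<bar>\<close>.
  Squaring the positive part is thus enough to make a truncation continuously
  differentiable.\<close>

lemma has_real_derivative_square_pos_part:
  "((\<lambda>t. (max 0 t)\<^sup>2) has_real_derivative 2 * max 0 t) (at t)" for t :: real
proof (cases "t = 0")
  case True
  have "((\<lambda>h. (max 0 h)\<^sup>2 / h) \<longlongrightarrow> (0::real)) (at 0)"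
  proof (rule Lim_null_comparison)
    show "\<forall>\<^sub>F h in at 0. norm ((max 0 h)\<^sup>2 / h) \<le> \<bar>h\<bar>"
      by (rule always_eventually) (auto simp: max_def power2_eq_square)
    show "((\<lambda>h. \<bar>h\<bar>) \<longlongrightarrow> (0::real)) (at 0)"
      by (rule tendsto_eq_intros) (auto intro: tendsto_intros)
  qed
  with True show ?thesis by (simp add: DERIV_def)
next
  case False
  then consider "t > 0" | "t < 0" by linarith
  then show ?thesis
  proof cases
    case 1
    have "((\<lambda>t. t\<^sup>2) has_real_derivative 2 * t) (at t)" by (auto intro!: derivative_eq_intros)
    then have "((\<lambda>t. (max 0 t)\<^sup>2) has_real_derivative 2 * t) (at t)"
      by (rule has_field_derivative_transform_within_open [where S = "{0<..}"]) (use 1 in auto)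
    then show ?thesis using 1 by simp
  next
    case 2
    have "((\<lambda>t. 0) has_real_derivative 0) (at t)" by simp
    then have "((\<lambda>t. (max 0 t)\<^sup>2) has_real_derivative 0) (at t)"
      by (rule has_field_derivative_transform_within_open [where S = "{..<0}"]) (use 2 in auto)
    then show ?thesis using 2 by simp
  qed
qed

lemma has_derivative_square_pos_part_compose:
  fixes f :: "'a::real_normed_vector \<Rightarrow> real"
  assumes "(f has_derivative f') (at x)"
  shows "((\<lambda>x. (max 0 (f x))\<^sup>2) has_derivative (\<lambda>v. 2 * max 0 (f x) * f' v)) (at x)"
  by (rule has_derivative_compose [OF assms has_real_derivative_square_pos_part [unfolded has_field_derivative_def]])

text \<open>A truncated quadratic, squared: one continuous derivative is enough for the partition of
  unity, and the derivative is explicit.\<close>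

definition bump :: "'a::euclidean_space \<Rightarrow> real \<Rightarrow> 'a \<Rightarrow> real" where
  "bump y s x = (max 0 (s\<^sup>2 - (x - y) \<bullet> (x - y)))\<^sup>2"

lemma bump_pos_iff: "s > 0 \<Longrightarrow> bump y s x > 0 \<longleftrightarrow> x \<in> ball y s"
  by (auto simp: bump_def zero_less_power2 max_def dist_norm norm_minus_commute power2_norm_eq_inner
      power_mono_iff abs_le_square_iff not_le simp flip: power2_norm_eq_inner
      intro: power2_less_imp_less power_strict_mono)

lemma bump_nonneg: "bump y s x \<ge> 0"
  by (simp add: bump_def)

lemma bump_C1:
  obtains g where "\<And>x. (bump y s has_derivative (\<lambda>v. v \<bullet> g x)) (at x)" "continuous_on UNIV g"
proof
  fix x
  have "((\<lambda>x. s\<^sup>2 - (x - y) \<bullet> (x - y)) has_derivative (\<lambda>v. - 2 * (v \<bullet> (x - y)))) (at x)"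
    by (auto intro!: derivative_eq_intros simp: inner_commute)
  from has_derivative_square_pos_part_compose [OF this]
  show "(bump y s has_derivative (\<lambda>v. v \<bullet> ((- 4 * max 0 (s\<^sup>2 - (x - y) \<bullet> (x - y))) *\<^sub>R (x - y)))) (at x)"
    by (simp add: bump_def [abs_def] mult.assoc mult.left_commute)
next
  show "continuous_on UNIV (\<lambda>x. (- 4 * max 0 (s\<^sup>2 - (x - y) \<bullet> (x - y))) *\<^sub>R (x - y))"
    by (intro continuous_intros)
qed

text \<open>\<open>F\<close> is known only on \<open>W\<close>, so the product with the cutoff is
  continued by zero. The open sets \<open>W\<close> and \<open>- K\<close> cover the space, and on
  their overlap the product and its derivative are zero as well.\<close>

lemma C1_supported_in_cutoff:
  fixes F :: "'a::euclidean_space \<Rightarrow> 'b::euclidean_space" and \<chi>' :: "'a \<Rightarrow> real"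
  assumes W: "open W" and F: "\<And>x. x \<in> W \<Longrightarrow> (F has_derivative F' x) (at x)"
    and F': "\<And>b. b \<in> Basis \<Longrightarrow> continuous_on W (\<lambda>x. F' x b)"
    and c: "\<And>x. (c has_derivative (\<lambda>v. v \<bullet> g x)) (at x)" "continuous_on UNIV g"
    and K: "compact K" "K \<subseteq> W" "K \<subseteq> U" "\<And>x. x \<notin> K \<Longrightarrow> c x = 0"
  shows "C1_supported_in U (\<lambda>x. if x \<in> W then c x *\<^sub>R F x else 0)
           (\<lambda>x v. if x \<in> W then c x *\<^sub>R F' x v + (v \<bullet> g x) *\<^sub>R F x else 0)"
proof -
  let ?H = "\<lambda>x. if x \<in> W then c x *\<^sub>R F x else 0"
  let ?H' = "\<lambda>x v. if x \<in> W then c x *\<^sub>R F' x v + (v \<bullet> g x) *\<^sub>R F x else 0"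
  have oK: "open (- K)" by (rule open_Compl [OF compact_imp_closed [OF K(1)]])
  have H'0: "?H' x v = 0" if "x \<notin> K" for x v
    using has_derivative_unique_zero [OF c(1) oK, of x] K(4) that by (simp add: fun_eq_iff)
  have der: "(?H has_derivative ?H' x) (at x)" for x
  proof (cases "x \<in> W")
    case True
    have "((\<lambda>x. c x *\<^sub>R F x) has_derivative (\<lambda>v. c x *\<^sub>R F' x v + (v \<bullet> g x) *\<^sub>R F x)) (at x)"
      by (rule has_derivative_scaleR [OF c(1) F [OF True]])
    then have "(?H has_derivative (\<lambda>v. c x *\<^sub>R F' x v + (v \<bullet> g x) *\<^sub>R F x)) (at x)"
      by (rule has_derivative_transform_within_open [OF _ W True]) simp
    then show ?thesis using True by simp
  next
    case False
    then have "x \<in> - K" using K(2) by auto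
    have "((\<lambda>_. 0) has_derivative (\<lambda>_. 0)) (at x)" by simp
    then have "(?H has_derivative (\<lambda>_. 0)) (at x)"
      by (rule has_derivative_transform_within_open [OF _ oK \<open>x \<in> - K\<close>]) (simp add: K(4))
    then show ?thesis using False by simp
  qed
  have "continuous_on UNIV (\<lambda>x. ?H' x b)" if b: "b \<in> Basis" for b
  proof -
    have contF: "continuous_on W F"
      by (rule has_derivative_continuous_on) (rule has_derivative_at_withinI [OF F])
    have contc: "continuous_on UNIV c"
      by (rule has_derivative_continuous_on) (rule has_derivative_at_withinI [OF c(1)])
    have "continuous_on W (\<lambda>x. c x *\<^sub>R F' x b + (b \<bullet> g x) *\<^sub>R F x)"
      by (intro continuous_intros F' b contF continuous_on_subset [OF contc] continuous_on_subset [OF c(2)]) auto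
    then have "continuous_on W (\<lambda>x. ?H' x b)" by (simp cong: continuous_on_cong)
    moreover have "continuous_on (- K) (\<lambda>x. ?H' x b)"
      using continuous_on_const [of "- K" 0] by (rule continuous_on_eq) (metis (no_types) ComplD H'0)
    ultimately have "continuous_on (W \<union> - K) (\<lambda>x. ?H' x b)"
      by (rule continuous_on_open_Un [OF W oK])
    moreover have "W \<union> - K = UNIV" using K(2) by auto
    ultimately show ?thesis by simp
  qed
  then show ?thesis
    unfolding C1_supported_in_def using der K by (intro conjI allI ballI exI [of _ K]) auto
qed

text \<open>A partition of unity on the compact closure splits \<open>F\<close> into pieces
  supported in balls where the identity is known. The pieces need to add up to \<open>F\<close> on
  the closure of \<open>G\<close> only, since both integrals live there.\<close>

theorem divergence_theorem:
  fixes G :: "'m::{finite,linorder} hp set" and F :: "'m hp \<Rightarrow> 'b::euclidean_space"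
  assumes \<mu>: "is_surface_measure (frontier G) \<mu>"
    and G: "open G" "bounded G" "smooth_boundary G" "G \<noteq> {}"
    and W: "open W" "closure G \<subseteq> W"
    and F: "\<And>x. x \<in> W \<Longrightarrow> (F has_derivative F' x) (at x)"
    and F': "\<And>b. b \<in> Basis \<Longrightarrow> continuous_on W (\<lambda>x. F' x b)"
  shows "divergence_identity G \<mu> F F' e"
    and "integrable lborel (\<lambda>x. indicator G x *\<^sub>R F' x e)"
proof -
  have cpt: "compact (closure G)" using G(2) by (simp add: compact_closure)
  have "\<exists>r>0. cball y r \<subseteq> W \<and> (\<forall>(F :: 'm hp \<Rightarrow> 'b) F'. C1_supported_in (ball y r) F F' \<longrightarrow> divergence_identity G \<mu> F F' e)"
    if y: "y \<in> closure G" for y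
  proof -
    obtain r1 where r1: "r1 > 0" "\<And>(F :: 'm hp \<Rightarrow> 'b) F'. C1_supported_in (ball y r1) F F' \<Longrightarrow> divergence_identity G \<mu> F F' e"
      using divergence_identity_local [OF \<mu> G(1,3) y, where 'b = 'b] by blast
    obtain r2 where r2: "r2 > 0" "cball y r2 \<subseteq> W"
      using W y open_contains_cball by blast
    have "ball y (min r1 r2) \<subseteq> ball y r1" "cball y (min r1 r2) \<subseteq> cball y r2" by auto
    then have "cball y (min r1 r2) \<subseteq> W"
      "\<And>(F :: 'm hp \<Rightarrow> 'b) F'. C1_supported_in (ball y (min r1 r2)) F F' \<Longrightarrow> divergence_identity G \<mu> F F' e"
      using r2(2) r1(2) [OF C1_supported_in_mono] by blast+
    then show ?thesis
      using r1(1) r2(1) by (intro exI [of _ "min r1 r2"]) simp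
  qed
  then obtain r where r: "\<And>y. y \<in> closure G \<Longrightarrow> r y > 0" "\<And>y. y \<in> closure G \<Longrightarrow> cball y (r y) \<subseteq> W"
    and div: "\<And>y (F :: 'm hp \<Rightarrow> 'b) F'. y \<in> closure G \<Longrightarrow> C1_supported_in (ball y (r y)) F F' \<Longrightarrow> divergence_identity G \<mu> F F' e"
    by metis
  \<comment> \<open>Half the radius, so that the closed ball containing the support of the bump lies
    in the open ball of radius \<open>r y\<close>.\<close>
  define s where "s y = r y / 2" for y
  have "closure G \<subseteq> (\<Union>y\<in>closure G. ball y (s y))" using r(1) by (force simp: s_def)
  then obtain Y where Y: "Y \<subseteq> closure G" "finite Y" "closure G \<subseteq> (\<Union>y\<in>Y. ball y (s y))"
    using cpt by (metis (no_types, lifting) compactE_image open_ball)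
  have s: "s y > 0" if "y \<in> Y" for y using r(1) [of y] Y(1) that by (auto simp: s_def)
  obtain gb where gb: "\<And>y x. (bump y (s y) has_derivative (\<lambda>v. v \<bullet> gb y x)) (at x)" "\<And>y. continuous_on UNIV (gb y)"
  proof -
    have "\<exists>g. (\<forall>x. (bump y (s y) has_derivative (\<lambda>v. v \<bullet> g x)) (at x)) \<and> continuous_on UNIV g" for y
      using bump_C1 [of y "s y"] by blast
    then obtain gb where "\<forall>y. (\<forall>x. (bump y (s y) has_derivative (\<lambda>v. v \<bullet> gb y x)) (at x)) \<and> continuous_on UNIV (gb y)"
      by (rule choice [THEN exE, OF allI])
    then show thesis using that by blast
  qed
  define S where "S x = (\<Sum>y\<in>Y. bump y (s y) x)" for x
  define gS where "gS x = (\<Sum>y\<in>Y. gb y x)" for x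
  have S: "(S has_derivative (\<lambda>v. v \<bullet> gS x)) (at x)" for x
    unfolding S_def [abs_def] gS_def inner_sum_right by (intro has_derivative_sum gb)
  have contS: "continuous_on UNIV S"
    by (rule has_derivative_continuous_on) (rule has_derivative_at_withinI [OF S])
  have contgS: "continuous_on UNIV gS" unfolding gS_def [abs_def] by (intro continuous_intros gb)
  have S_nonneg: "S x \<ge> 0" for x unfolding S_def by (intro sum_nonneg bump_nonneg)
  have S_pos: "S x > 0" if x: "x \<in> closure G" for x
  proof -
    obtain y where y: "y \<in> Y" "x \<in> ball y (s y)" using Y(3) x by blast
    have "bump y (s y) x > 0" using bump_pos_iff [OF s [OF y(1)]] y(2) by blast
    then show ?thesis
      unfolding S_def by (rule sum_pos2 [OF Y(2) y(1) _ bump_nonneg])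
  qed
  have "closure G \<noteq> {}" using G(4) by simp
  then obtain x0 where x0: "x0 \<in> closure G" "\<And>x. x \<in> closure G \<Longrightarrow> S x0 \<le> S x"
    using continuous_attains_inf [OF cpt _ continuous_on_subset [OF contS]] by blast
  define m where "m = S x0"
  have m: "m > 0" "\<And>x. x \<in> closure G \<Longrightarrow> m \<le> S x" using x0 S_pos by (auto simp: m_def)
  text \<open>Modifying the denominator where \<open>S < m\<close> keeps the partition functions continuously
    differentiable on the whole space.\<close>
  define d where "d x = S x + (max 0 (m - S x))\<^sup>2" for x
  \<comment> \<open>\<open>S\<close> is nonnegative, and where it vanishes the added term equals the
    positive number \<open>m\<^sup>2\<close>.\<close>
  have d_pos: "d x > 0" for x
  proof (cases "S x = 0")
    case False
    then show ?thesis using S_nonneg [of x] by (simp add: d_def add_pos_nonneg)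
  qed (use m in \<open>simp add: d_def\<close>)
  define gd where "gd x = (1 - 2 * max 0 (m - S x)) *\<^sub>R gS x" for x
  have d: "(d has_derivative (\<lambda>v. v \<bullet> gd x)) (at x)" for x
  proof -
    have "((\<lambda>x. m - S x) has_derivative (\<lambda>v. - (v \<bullet> gS x))) (at x)"
      using has_derivative_diff [OF has_derivative_const S [of x], of m] by simp
    from has_derivative_add [OF S has_derivative_square_pos_part_compose [OF this]]
    show ?thesis by (simp add: d_def [abs_def] gd_def algebra_simps)
  qed
  define c where "c y x = bump y (s y) x / d x" for y x
  define gc where "gc y x = (1 / d x) *\<^sub>R gb y x - (bump y (s y) x / (d x)\<^sup>2) *\<^sub>R gd x" for y x
  have c: "(c y has_derivative (\<lambda>v. v \<bullet> gc y x)) (at x)" for y x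
    unfolding c_def [abs_def]
    by (rule has_derivative_eq_rhs [OF has_derivative_divide [OF gb(1) d]])
      (use d_pos [of x] in \<open>auto simp: gc_def fun_eq_iff inner_diff_right divide_inverse power2_eq_square algebra_simps\<close>)
  have contd: "continuous_on UNIV d"
    by (rule has_derivative_continuous_on) (rule has_derivative_at_withinI [OF d])
  have contb: "continuous_on UNIV (bump y (s y))" for y
    by (rule has_derivative_continuous_on) (rule has_derivative_at_withinI [OF gb(1)])
  have contgc: "continuous_on UNIV (gc y)" for y
    unfolding gc_def [abs_def] gd_def
    using d_pos by (intro continuous_intros gb contd contb contS contgS) (auto simp: less_imp_neq [symmetric])
  define H where "H y x = (if x \<in> W then c y x *\<^sub>R F x else 0)" for y x
  define H' where "H' y x v = (if x \<in> W then c y x *\<^sub>R F' x v + (v \<bullet> gc y x) *\<^sub>R F x else 0)" for y x v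
  have supp: "C1_supported_in (ball y (r y)) (H y) (H' y)" if "y \<in> Y" for y
    unfolding H_def [abs_def] H'_def [abs_def]
  proof (rule C1_supported_in_cutoff [OF W(1) F F' c contgc])
    have y: "y \<in> closure G" using that Y(1) by auto
    show "compact (cball y (s y))" by simp
    have "s y < r y" using r(1) [OF y] by (simp add: s_def)
    then show "cball y (s y) \<subseteq> ball y (r y)" by auto
    then show "cball y (s y) \<subseteq> W" using r(2) [OF y] by force
    show "c y x = 0" if "x \<notin> cball y (s y)" for x
    proof -
      have "\<not> bump y (s y) x > 0" using that by (subst bump_pos_iff [OF s [OF \<open>y \<in> Y\<close>]]) auto
      then show ?thesis using bump_nonneg [of y "s y" x] by (simp add: c_def)
    qed
  qed
  have sumH: "(\<Sum>y\<in>Y. H y x) = F x" if "x \<in> closure G" for x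
  proof -
    have "x \<in> W" "d x = S x" "S x > 0" using that W m(2) S_pos by (auto simp: d_def)
    then have "(\<Sum>y\<in>Y. H y x) = ((\<Sum>y\<in>Y. bump y (s y) x) / S x) *\<^sub>R F x"
      by (simp add: H_def c_def sum_divide_distrib scaleR_left.sum)
    then show ?thesis using \<open>S x > 0\<close> by (simp flip: S_def)
  qed
  have derH: "(H y has_derivative H' y x) (at x)" if "y \<in> Y" for y x
    using supp [OF that] unfolding C1_supported_in_def by blast
  \<comment> \<open>Each \<open>H'\<close> contains the derivative of its partition function. These
    contributions cancel because the sum equals \<open>F\<close> on the open set \<open>G\<close>,
    where derivatives are unique.\<close>
  have sumH': "(\<Sum>y\<in>Y. H' y x e) = F' x e" if x: "x \<in> G" for x
  proof -
    have "((\<lambda>x. \<Sum>y\<in>Y. H y x) has_derivative (\<lambda>v. \<Sum>y\<in>Y. H' y x v)) (at x)"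
      by (intro has_derivative_sum derH)
    then have "(F has_derivative (\<lambda>v. \<Sum>y\<in>Y. H' y x v)) (at x)"
      by (rule has_derivative_transform_within_open [OF _ G(1) x]) (use sumH closure_subset in blast)
    moreover have "x \<in> W" using W(2) closure_subset x by blast
    ultimately have "(\<lambda>v. \<Sum>y\<in>Y. H' y x v) = F' x" using F has_derivative_unique by blast
    then show ?thesis by (rule fun_cong)
  qed
  define J where "J P y = indicator (frontier G) y *\<^sub>R ((exterior_normal G y \<bullet> e) *\<^sub>R P y)" for P :: "'m hp \<Rightarrow> 'b" and y
  have dH: "integrable \<mu> (J (H y))" "(LINT x|lborel. indicator G x *\<^sub>R H' y x e) = integral\<^sup>L \<mu> (J (H y))" if "y \<in> Y" for y
    using div [OF _ supp [OF that]] Y(1) that by (auto simp: divergence_identity_def J_def [abs_def])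
  have iH: "integrable lborel (\<lambda>x. indicator G x *\<^sub>R H' y x e)" if "y \<in> Y" for y
    using supp [OF that] by (rule C1_supported_inE) (use G(1) in auto)
  have J: "J F = (\<lambda>x. \<Sum>y\<in>Y. J (H y) x)"
  proof
    fix x
    have "x \<in> frontier G \<Longrightarrow> x \<in> closure G" by (simp add: frontier_def)
    then show "J F x = (\<Sum>y\<in>Y. J (H y) x)"
      by (auto simp: J_def indicator_def scaleR_right.sum simp flip: sumH)
  qed
  have D: "(\<lambda>x. indicator G x *\<^sub>R F' x e) = (\<lambda>x. \<Sum>y\<in>Y. indicator G x *\<^sub>R H' y x e)"
    by (auto simp: fun_eq_iff indicator_def sumH')
  show "integrable lborel (\<lambda>x. indicator G x *\<^sub>R F' x e)" unfolding D by (intro Bochner_Integration.integrable_sum iH)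
  have "integrable \<mu> (J F)" unfolding J by (intro Bochner_Integration.integrable_sum dH)
  moreover have "(LINT x|lborel. indicator G x *\<^sub>R F' x e) = integral\<^sup>L \<mu> (J F)"
    unfolding D J by (simp add: Bochner_Integration.integral_sum iH dH)
  ultimately show "divergence_identity G \<mu> F F' e"
    by (simp add: divergence_identity_def J_def [abs_def])
qed


section \<open>Clifford algebra and the kernel profile\<close>

lemma bounded_bilinear_cl_mult: "bounded_bilinear (cl_mult :: 'g::{finite,linorder} clifford \<Rightarrow> _)"
  by (rule bilinear_conv_bounded_bilinear [THEN iffD1])
    (auto simp: bilinear_def intro!: linearI
      simp: cl_mult_add_left cl_mult_add_right cl_mult_scaleR_left cl_mult_scaleR_right)

interpretation cl_mult: bounded_bilinear "cl_mult :: 'g::{finite,linorder} clifford \<Rightarrow> _"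
  by (rule bounded_bilinear_cl_mult)

lemma linear_para: "linear para"
  by (intro linearI) (simp_all add: para_def scaleR_add_left sum.distrib scaleR_sum_right scaleR_add_right)

lemma linear_conj_pv: "linear conj_pv"
  by (intro linearI) (auto simp: conj_pv_def vec_eq_iff)

lemma linear_lift: "linear (lift w)"
  by (intro linearI) (auto simp: lift_def algebra_simps)

lemma norm_lift:
  assumes "norm w = 1"
  shows "norm (lift w z) = norm z"
  using assms by (simp add: lift_def norm_prod_def)

text \<open>The double sum is added to its transpose. The anticommutation relations remove all mixed
  terms and leave -2 times a square on the diagonal; halving gives the result.\<close>

lemma vector_square:
  fixes c :: "'g::{finite,linorder} \<Rightarrow> real"
  shows "(\<Sum>a\<in>UNIV. c a *\<^sub>R cl_gen a) \<star> (\<Sum>a\<in>UNIV. c a *\<^sub>R cl_gen a) = - (\<Sum>a\<in>UNIV. (c a)\<^sup>2) *\<^sub>R cl_one"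
proof -
  let ?v = "\<Sum>a\<in>UNIV. c a *\<^sub>R cl_gen a"
  have sq: "?v \<star> ?v = (\<Sum>a\<in>UNIV. \<Sum>b\<in>UNIV. (c a * c b) *\<^sub>R (cl_gen a \<star> cl_gen b))"
    by (simp add: cl_mult_sum_left cl_mult_sum_right cl_mult_scaleR_left cl_mult_scaleR_right scaleR_sum_right)
      (subst sum.swap, simp add: mult.commute)
  have sq': "?v \<star> ?v = (\<Sum>a\<in>UNIV. \<Sum>b\<in>UNIV. (c a * c b) *\<^sub>R (cl_gen b \<star> cl_gen a))"
    unfolding sq by (subst sum.swap) (simp add: mult.commute)
  have "?v \<star> ?v + ?v \<star> ?v = (\<Sum>a\<in>UNIV. \<Sum>b\<in>UNIV. (c a * c b) *\<^sub>R (cl_gen a \<star> cl_gen b + cl_gen b \<star> cl_gen a))"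
    by (subst (1) sq, subst (1) sq') (simp add: sum.distrib scaleR_add_right)
  also have "\<dots> = (\<Sum>a\<in>UNIV. \<Sum>b\<in>UNIV. if a = b then (- 2 * (c a)\<^sup>2) *\<^sub>R cl_one else 0)"
    unfolding cl_gen_relations by (intro sum.cong refl) (simp add: power2_eq_square)
  also have "\<dots> = (\<Sum>a\<in>UNIV. (- 2 * (c a)\<^sup>2) *\<^sub>R cl_one)"
    by simp
  also have "\<dots> = (- 2 * (\<Sum>a\<in>UNIV. (c a)\<^sup>2)) *\<^sub>R cl_one"
    by (simp add: sum_distrib_left scaleR_left.sum)
  finally have "2 *\<^sub>R (?v \<star> ?v) = 2 *\<^sub>R (- (\<Sum>a\<in>UNIV. (c a)\<^sup>2) *\<^sub>R cl_one)"
    by (simp add: scaleR_2)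
  then show ?thesis by (simp only: scaleR_cancel_left) simp
qed

lemma sum_gen:
  fixes \<phi> :: "'m::{finite,linorder} + 'q::{finite,linorder} \<Rightarrow> 'b::comm_monoid_add"
  shows "(\<Sum>a\<in>UNIV. \<phi> (Rep_gen (a :: ('m, 'q) gen))) = (\<Sum>i\<in>UNIV - {ix0}. \<phi> (Inl i)) + (\<Sum>j\<in>UNIV. \<phi> (Inr j))"
proof -
  have "{s :: 'm + 'q. s \<noteq> Inl ix0} = (UNIV - {ix0}) <+> UNIV"
  proof (rule set_eqI)
    show "s \<in> {s. s \<noteq> Inl ix0} \<longleftrightarrow> s \<in> (UNIV - {ix0}) <+> UNIV" for s :: "'m + 'q"
      by (cases s) auto
  qed
  then have range: "range (Rep_gen :: ('m, 'q) gen \<Rightarrow> _) = (UNIV - {ix0}) <+> UNIV"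
    by (simp only: type_definition.Rep_range [OF type_definition_gen])
  have "inj (Rep_gen :: ('m, 'q) gen \<Rightarrow> _)"
    by (simp add: inj_def Rep_gen_inject)
  from sum.reindex [OF this, of \<phi>]
  have "(\<Sum>a\<in>UNIV. \<phi> (Rep_gen (a :: ('m, 'q) gen))) = sum \<phi> ((UNIV - {ix0}) <+> UNIV)"
    unfolding range by (simp add: o_def)
  then show ?thesis by (simp add: sum.Plus)
qed

text \<open>With \<open>x0\<close> the scalar part and \<open>v\<close> the rest, the product is (x0
  - v)(x0 + v) = x0^2 - v^2, and the square of \<open>v\<close> is minus its squared length.\<close>

lemma conj_mult_para:
  fixes x :: "('m::{finite,linorder}, 'q::{finite,linorder}) pv"
  shows "para (conj_pv x) \<star> para x = (norm x)\<^sup>2 *\<^sub>R cl_one"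
proof -
  define c where "c s = (case s of Inl i \<Rightarrow> fst x $ i | Inr j \<Rightarrow> snd x $ j)" for s
  define v where "v = (\<Sum>a\<in>UNIV. c (Rep_gen a) *\<^sub>R cl_gen (a :: ('m, 'q) gen))"
  define x0 where "x0 = fst x $ ix0"
  have v: "v = (\<Sum>i\<in>UNIV - {ix0}. fst x $ i *\<^sub>R eP i) + (\<Sum>j\<in>UNIV. snd x $ j *\<^sub>R eQ j)"
  proof -
    have "v = (\<Sum>a\<in>UNIV. (\<lambda>s. c s *\<^sub>R cl_gen (Abs_gen s)) (Rep_gen (a :: ('m, 'q) gen)))"
      by (simp add: v_def Rep_gen_inverse)
    also have "\<dots> = (\<Sum>i\<in>UNIV - {ix0}. fst x $ i *\<^sub>R eP i) + (\<Sum>j\<in>UNIV. snd x $ j *\<^sub>R eQ j)"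
      by (subst sum_gen) (simp add: c_def eP_def eQ_def)
    finally show ?thesis .
  qed
  have split: "(\<Sum>i\<in>UNIV. \<psi> i) = \<psi> ix0 + (\<Sum>i\<in>UNIV - {ix0}. \<psi> i)" for \<psi> :: "'m \<Rightarrow> 'b::comm_monoid_add"
    by (rule sum.remove) auto
  have px: "para x = x0 *\<^sub>R cl_one + v"
    unfolding para_def v by (subst split) (simp add: x0_def eP_def add.assoc)
  have "(\<Sum>i\<in>UNIV - {ix0}. (if i = ix0 then fst x $ i else - (fst x $ i)) *\<^sub>R eP i) = - (\<Sum>i\<in>UNIV - {ix0}. fst x $ i *\<^sub>R (eP i :: ('m, 'q) gen clifford))"
    by (simp flip: sum_negf)
  then have pc: "para (conj_pv x) = x0 *\<^sub>R cl_one - v"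
    unfolding para_def v by (subst split) (simp add: x0_def eP_def conj_pv_def sum_negf)
  have "v \<star> v = - (\<Sum>a\<in>UNIV. (c (Rep_gen (a :: ('m, 'q) gen)))\<^sup>2) *\<^sub>R cl_one"
    unfolding v_def by (rule vector_square)
  also have "(\<Sum>a\<in>UNIV. (c (Rep_gen (a :: ('m, 'q) gen)))\<^sup>2) = (\<Sum>i\<in>UNIV - {ix0}. (fst x $ i)\<^sup>2) + (\<Sum>j\<in>UNIV. (snd x $ j)\<^sup>2)"
    by (subst sum_gen) (simp add: c_def)
  also have "\<dots> = (norm x)\<^sup>2 - x0\<^sup>2"
  proof -
    have "(norm x)\<^sup>2 = (\<Sum>i\<in>UNIV. (fst x $ i)\<^sup>2) + (\<Sum>j\<in>UNIV. (snd x $ j)\<^sup>2)"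
      by (simp add: norm_prod_def norm_vec_def L2_set_def sum_nonneg)
    then show ?thesis by (subst (asm) split) (simp add: x0_def)
  qed
  finally have vv: "v \<star> v = (x0\<^sup>2 - (norm x)\<^sup>2) *\<^sub>R cl_one" by simp
  have "para (conj_pv x) \<star> para x = (x0 * x0) *\<^sub>R cl_one - v \<star> v"
    unfolding px pc
    by (simp add: cl_mult.diff_left cl_mult_add_right cl_mult_scaleR_left cl_mult_scaleR_right cl_one_left cl_one_right scaleR_diff_right)
  then show ?thesis
    by (simp add: vv power2_eq_square flip: scaleR_diff_left)
qed

lemma sum_Basis_hp:
  fixes \<phi> :: "'m::finite hp \<Rightarrow> 'b::comm_monoid_add"
  shows "(\<Sum>b\<in>Basis. \<phi> b) = (\<Sum>i\<in>UNIV. \<phi> (axis i 1, 0)) + \<phi> (0, 1)"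
proof -
  have B: "(Basis :: 'm hp set) = insert (0, 1) (range (\<lambda>i. (axis i 1, 0)))"
    by (auto simp: Basis_prod_def Basis_vec_def)
  have "inj (\<lambda>i :: 'm. (axis i (1::real), 0::real))"
    by (auto simp: inj_def axis_eq_axis)
  from sum.reindex [OF this, of \<phi>] show ?thesis
    unfolding B by (subst sum.insert) (auto simp: o_def add.commute)
qed

text \<open>Treating all p + 2 coordinate directions alike matches the directional form of the
  divergence theorem, which is applied once for each basis vector.\<close>

lemma slice_dirac_eq:
  fixes w :: "(real, 'q::{finite,linorder}) vec" and g :: "'m::{finite,linorder} hp \<Rightarrow> ('m, 'q) gen clifford"
  shows "slice_dirac w g z = (\<Sum>b\<in>Basis. para (lift w b) \<star> partial_deriv b g z)"
proof -
  have "para (lift w (axis i 1, 0)) = (eP i :: ('m, 'q) gen clifford)" for i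
    by (simp add: para_def lift_def axis_def if_distrib [of "\<lambda>c. c *\<^sub>R _"] cong: if_cong)
  moreover have "para (lift w (0, 1)) = (para (0, w) :: ('m, 'q) gen clifford)"
    by (simp add: lift_def)
  ultimately show ?thesis by (simp add: slice_dirac_def sum_Basis_hp)
qed

text \<open>The profile agrees with \<open>s powr (- n / 2)\<close>, that is \<open>\<bar>z\<bar> powr (- n)\<close> for \<open>s = \<bar>z\<bar>\<^sup>2\<close>, outside the unit
  ball, and continues it by its tangent at \<open>s = 1\<close>.\<close>

definition kernel_profile :: "real \<Rightarrow> real \<Rightarrow> real" where
  "kernel_profile n s = (if s < 1 then 1 + n / 2 * (1 - s) else s powr (- n / 2))"

definition kernel_profile_deriv :: "real \<Rightarrow> real \<Rightarrow> real" where
  "kernel_profile_deriv n s = (if s < 1 then - n / 2 else - n / 2 * s powr (- n / 2 - 1))"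

text \<open>At \<open>s = 1\<close> the two branches share the value 1 and the slope
  \<open>- n / 2\<close>.\<close>

lemma has_real_derivative_kernel_profile:
  "(kernel_profile n has_real_derivative kernel_profile_deriv n s) (at s)"
proof -
  have "((\<lambda>s. if s \<in> {..<1} then 1 + n / 2 * (1 - s) else s powr (- n / 2)) has_vector_derivative
      (if s \<in> {..<1} then - n / 2 else - n / 2 * s powr (- n / 2 - 1))) (at s within UNIV)"
    by (rule has_vector_derivative_If_within_closures [where T = "{1..}"])
      (auto simp flip: has_real_derivative_iff_has_vector_derivative
        intro!: derivative_eq_intros has_real_derivative_powr' DERIV_subset [OF has_real_derivative_powr])
  then show ?thesis
    by (simp add: has_real_derivative_iff_has_vector_derivative kernel_profile_def [abs_def] kernel_profile_deriv_def)
qed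

lemma continuous_kernel_profile_deriv: "continuous_on UNIV (kernel_profile_deriv n)"
proof -
  have eq: "kernel_profile_deriv n = (\<lambda>s. if s \<le> 1 then - n / 2 else - n / 2 * s powr (- n / 2 - 1))"
    by (auto simp: kernel_profile_deriv_def fun_eq_iff)
  have "continuous_on ({..1} \<union> {1..}) (kernel_profile_deriv n)"
    unfolding eq by (rule continuous_on_If) (auto intro!: continuous_intros)
  moreover have "{..1} \<union> {1..} = (UNIV :: real set)" by auto
  ultimately show ?thesis by simp
qed

text \<open>Up to scaling, the left side is the Dirac derivative of k(|z|^2) conj(z) at |z|^2 =
  \<open>s\<close>. It vanishes for the power \<open>s powr (- n / 2)\<close>, and for the tangent
  line it is a multiple of \<open>1 - s\<close>.\<close>

lemma kernel_profile_divergence: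
  assumes "s \<ge> 0"
  shows "n * kernel_profile n s + 2 * s * kernel_profile_deriv n s = n * (n + 2) / 2 * max 0 (1 - s)"
proof (cases "s < 1")
  case False
  then have "s * s powr (- n / 2 - 1) = s powr (- n / 2)"
    by (simp add: powr_diff)
  then show ?thesis using False by (simp add: kernel_profile_def kernel_profile_deriv_def)
qed (simp add: kernel_profile_def kernel_profile_deriv_def field_simps)

section \<open>The mass of the bump and the area of the unit sphere\<close>

text \<open>The integrand is the length of the interval from |y - x|^2/r^2 to 1. Tonelli's theorem
  exchanges the integrals; the set of \<open>y\<close> belonging to a level \<open>t\<close> is the
  ball of radius \<open>r * sqrt t\<close>, which leaves the integral of
  \<open>t powr (n / 2)\<close> over the unit interval.\<close>

lemma nn_integral_ball_profile:
  fixes x :: "'a::euclidean_space"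
  assumes "r > 0"
  shows "(\<integral>\<^sup>+y. ennreal (max 0 (1 - (norm (y - x))\<^sup>2 / r\<^sup>2)) \<partial>lborel)
       = ennreal (unit_ball_vol (real DIM('a)) * r ^ DIM('a) / (real DIM('a) / 2 + 1))"
proof -
  define n where "n = DIM('a)"
  have pos: "0 \<le> t" if "(norm (y - x))\<^sup>2 < r\<^sup>2 * t" for y t
    using le_less_trans [OF zero_le_power2 that] assms by (simp add: zero_less_mult_iff)
  have iff: "(norm (y - x))\<^sup>2 / r\<^sup>2 < t \<longleftrightarrow> (norm (y - x))\<^sup>2 < r\<^sup>2 * t" for y t
    using assms by (simp add: pos_divide_less_eq mult.commute)
  have "(\<integral>\<^sup>+y. ennreal (max 0 (1 - (norm (y - x))\<^sup>2 / r\<^sup>2)) \<partial>lborel)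
      = (\<integral>\<^sup>+y. (\<integral>\<^sup>+t. indicator {(norm (y - x))\<^sup>2 / r\<^sup>2<..1} t \<partial>lborel) \<partial>lborel)"
    by (intro nn_integral_cong) (simp add: max_def)
  also have "\<dots> = (\<integral>\<^sup>+y. (\<integral>\<^sup>+t. indicator {0..1} t * indicator {p. (norm (fst p - x))\<^sup>2 < r\<^sup>2 * snd p} (y, t) \<partial>lborel) \<partial>lborel)"
    by (intro nn_integral_cong) (auto simp: indicator_def iff dest: pos)
  also have "\<dots> = (\<integral>\<^sup>+t. (\<integral>\<^sup>+y. indicator {0..1} t * indicator {p. (norm (fst p - x))\<^sup>2 < r\<^sup>2 * snd p} (y, t) \<partial>lborel) \<partial>lborel)"
  proof -
    have "open {p :: 'a \<times> real. (norm (fst p - x))\<^sup>2 < r\<^sup>2 * snd p}"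
      by (intro open_Collect_less continuous_intros)
    then have [measurable]: "{p :: 'a \<times> real. (norm (fst p - x))\<^sup>2 < r\<^sup>2 * snd p} \<in> sets (borel \<Otimes>\<^sub>M borel)"
      unfolding borel_prod by (rule borel_open)
    show ?thesis
      by (rule lborel_pair.Fubini') measurable
  qed
  also have "\<dots> = (\<integral>\<^sup>+t. ennreal (t powr (real n / 2)) * indicator {0..1} t * ennreal (unit_ball_vol (real n) * r ^ n) \<partial>lborel)"
  proof (rule nn_integral_cong)
    fix t :: real
    show "(\<integral>\<^sup>+y. indicator {0..1} t * indicator {p. (norm (fst p - x))\<^sup>2 < r\<^sup>2 * snd p} (y, t) \<partial>lborel)
        = ennreal (t powr (real n / 2)) * indicator {0..1} t * ennreal (unit_ball_vol (real n) * r ^ n)"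
    proof (cases "t \<in> {0..1}")
      case True
      have "(norm (y - x))\<^sup>2 < r\<^sup>2 * t \<longleftrightarrow> y \<in> ball x (r * sqrt t)" for y
      proof -
        have "(norm (y - x))\<^sup>2 < r\<^sup>2 * t \<longleftrightarrow> (norm (y - x))\<^sup>2 < (r * sqrt t)\<^sup>2"
          using True by (simp add: power_mult_distrib)
        also have "\<dots> \<longleftrightarrow> norm (y - x) < r * sqrt t"
        proof
          assume "(norm (y - x))\<^sup>2 < (r * sqrt t)\<^sup>2"
          then show "norm (y - x) < r * sqrt t"
            by (rule power_less_imp_less_base) (use True assms in simp)
        next
          assume "norm (y - x) < r * sqrt t"
          then show "(norm (y - x))\<^sup>2 < (r * sqrt t)\<^sup>2"
            by (rule power_strict_mono) simp_all
        qed
        finally show ?thesis by (simp add: dist_norm norm_minus_commute)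
      qed
      then have "(\<lambda>y. indicator {p. (norm (fst p - x))\<^sup>2 < r\<^sup>2 * snd p} (y, t) :: ennreal) = indicator (ball x (r * sqrt t))"
        by (auto simp: indicator_def fun_eq_iff)
      then have "(\<integral>\<^sup>+y. indicator {0..1} t * indicator {p. (norm (fst p - x))\<^sup>2 < r\<^sup>2 * snd p} (y, t) \<partial>lborel)
          = ennreal (unit_ball_vol (real n) * (r * sqrt t) ^ n)"
        using True assms by (simp add: emeasure_ball n_def)
      also have "(r * sqrt t) ^ n = t powr (real n / 2) * r ^ n"
      proof (cases "t = 0")
        case False
        then have "t > 0" using True by simp
        then have "sqrt t ^ n = t powr (real n / 2)"
          by (simp add: powr_half_sqrt [symmetric] powr_powr flip: powr_realpow)
        then show ?thesis by (simp add: power_mult_distrib)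
      qed (simp add: n_def)
      finally show ?thesis using True assms by (simp add: mult_ac flip: ennreal_mult')
    qed simp
  qed
  also have "\<dots> = (\<integral>\<^sup>+t. ennreal (t powr (real n / 2)) * indicator {0..1} t \<partial>lborel) * ennreal (unit_ball_vol (real n) * r ^ n)"
    by (rule nn_integral_multc) measurable
  also have "(\<integral>\<^sup>+t. ennreal (t powr (real n / 2)) * indicator {0..1} t \<partial>lborel) = ennreal (1 / (real n / 2 + 1))"
  proof -
    have "((\<lambda>t. t powr (real n / 2)) has_integral (1 powr (real n / 2 + 1) / (real n / 2 + 1))) {0..1}"
      by (rule has_integral_powr_from_0) auto
    from nn_integral_has_integral_lebesgue [OF _ this] show ?thesis
      by (simp add: ennreal_mult' ennreal_indicator mult.commute)
  qed
  finally show ?thesis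
    using assms by (simp add: n_def ennreal_mult' [symmetric])
qed

text \<open>This rests on \<open>Gamma (1/2) = sqrt pi\<close> and on the functional equation of the
  Gamma function at n/2.\<close>

lemma sigma_const_eq:
  assumes "n > 0"
  shows "sigma_const n = real n * unit_ball_vol (real n)"
proof -
  have "sqrt pi ^ n = pi powr (real n / 2)"
    by (simp add: powr_half_sqrt [symmetric] powr_powr flip: powr_realpow)
  then have "sigma_const n = 2 * (pi powr (real n / 2) / Gamma (real n / 2))"
    by (simp add: sigma_const_def Gamma_one_half_real)
  moreover have "Gamma (real n / 2 + 1) = real n / 2 * Gamma (real n / 2)"
    using assms by (intro Gamma_plus1) (auto dest!: nonpos_Ints_nonpos)
  then have "pi powr (real n / 2) / Gamma (real n / 2 + 1) = (2 / real n) * (pi powr (real n / 2) / Gamma (real n / 2))"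
    by (simp only:) simp
  then have "unit_ball_vol (real n) = (2 / real n) * (pi powr (real n / 2) / Gamma (real n / 2))"
    unfolding unit_ball_vol_def by simp
  ultimately show ?thesis using assms by simp
qed


section \<open>The Cauchy integral formula\<close>

text \<open>The profile takes the squared norm as its argument, which keeps the composition
  differentiable at \<open>y = x\<close>.\<close>

lemma has_derivative_kernel_profile_norm:
  fixes x :: "'a::euclidean_space"
  shows "((\<lambda>y. kernel_profile n ((norm (y - x))\<^sup>2 / r)) has_derivative
     (\<lambda>v. kernel_profile_deriv n ((norm (y - x))\<^sup>2 / r) * (2 * (v \<bullet> (y - x)) / r))) (at y)"
proof -
  have "((\<lambda>y. (y - x) \<bullet> (y - x) / r) has_derivative (\<lambda>v. 2 * (v \<bullet> (y - x)) / r)) (at y)"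
    by (auto intro!: derivative_eq_intros simp: inner_commute divide_inverse algebra_simps)
  from has_derivative_compose [OF this has_real_derivative_kernel_profile [unfolded has_field_derivative_def]]
  show ?thesis by (simp add: power2_norm_eq_inner)
qed

lemma kernel_profile_outside:
  assumes "r > 0" "norm z \<ge> r"
  shows "kernel_profile (real n) ((norm z)\<^sup>2 / r\<^sup>2) / r ^ n = 1 / norm z ^ n"
proof -
  define a where "a = norm z / r"
  have a: "a \<ge> 1" using assms by (simp add: a_def)
  then have "a\<^sup>2 \<ge> 1" by simp
  have "(a\<^sup>2) powr (- real n / 2) = 1 / a ^ n"
  proof -
    have "(a\<^sup>2) powr (- real n / 2) = a powr (- real n)"
      using a by (simp add: powr_powr flip: powr_numeral)
    then show ?thesis using a by (simp add: powr_minus_divide powr_realpow)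
  qed
  then have "kernel_profile (real n) (a\<^sup>2) = 1 / a ^ n"
    using \<open>a\<^sup>2 \<ge> 1\<close> by (simp add: kernel_profile_def)
  then show ?thesis
    using assms by (simp add: a_def power_divide)
qed

text \<open>The regularised kernel coincides with the Cauchy kernel outside the ball of radius \<open>r\<close>, and its
  Dirac derivative is a nonnegative bump of total mass one inside it.\<close>

definition reg_kernel ::
    "(real, 'q) vec \<Rightarrow> real \<Rightarrow> 'm hp \<Rightarrow> 'm hp \<Rightarrow> ('m::{finite,linorder}, 'q::{finite,linorder}) gen clifford" where
  "reg_kernel w r x y = (kernel_profile (real (CARD('m) + 1)) ((norm (y - x))\<^sup>2 / r\<^sup>2) /
     (sigma_const (CARD('m) + 1) * r ^ (CARD('m) + 1))) *\<^sub>R para (conj_pv (lift w (y - x)))"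

definition reg_delta :: "real \<Rightarrow> 'm::finite hp \<Rightarrow> 'm hp \<Rightarrow> real" where
  "reg_delta r x y = real (CARD('m) + 1) * (real (CARD('m) + 1) + 2) / 2 * max 0 (1 - (norm (y - x))\<^sup>2 / r\<^sup>2) /
     (sigma_const (CARD('m) + 1) * r ^ (CARD('m) + 1))"

lemma sigma_const_pos: "n > 0 \<Longrightarrow> sigma_const n > 0"
  by (simp add: sigma_const_eq)

lemma reg_kernel_outside:
  fixes x y :: "'m::{finite,linorder} hp" and w :: "(real, 'q::{finite,linorder}) vec"
  assumes w: "norm w = 1" and r: "r > 0" "norm (y - x) \<ge> r"
  shows "reg_kernel w r x y = (cauchy_E (lift w y - lift w x) :: ('m, 'q) gen clifford)"
proof -
  define N where "N = CARD('m) + 1"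
  have "lift w y - lift w x = lift w (y - x)"
    by (simp add: lift_def algebra_simps)
  moreover have "kernel_profile (real N) ((norm (y - x))\<^sup>2 / r\<^sup>2) / (sigma_const N * r ^ N)
      = 1 / sigma_const N * (kernel_profile (real N) ((norm (y - x))\<^sup>2 / r\<^sup>2) / r ^ N)"
    by simp
  ultimately show ?thesis
    unfolding reg_kernel_def cauchy_E_def N_def [symmetric]
    by (simp add: kernel_profile_outside [OF r] norm_lift [OF w])
qed

text \<open>The basis paravectors stand on the right of \<open>K'\<close>: the kernel will be the
  left factor of a product, so it is its right Dirac derivative that occurs.\<close>

lemma has_derivative_reg_kernel:
  fixes x y :: "'m::{finite,linorder} hp" and w :: "(real, 'q::{finite,linorder}) vec"
  assumes w: "norm w = 1" and r: "r > 0"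
  obtains K' where "\<And>y. (reg_kernel w r x has_derivative K' y) (at y)" "\<And>v. continuous_on UNIV (\<lambda>y. K' y v)"
    "\<And>y. (\<Sum>b\<in>Basis. K' y b \<star> para (lift w b)) = reg_delta r x y *\<^sub>R cl_one"
proof
  define n where "n = real (CARD('m) + 1)"
  define C where "C = sigma_const (CARD('m) + 1) * r ^ (CARD('m) + 1)"
  define s where "s y = (norm (y - x))\<^sup>2 / r\<^sup>2" for y
  define c where "c z = para (conj_pv (lift w z))" for z :: "'m hp"
  have "linear c"
    unfolding c_def [abs_def] using linear_compose [OF linear_compose [OF linear_lift linear_conj_pv] linear_para] by (simp add: o_def)
  then have c: "bounded_linear c" by (simp add: linear_conv_bounded_linear)
  interpret c: bounded_linear c by (rule c)
  define K' where "K' y v = ((kernel_profile_deriv n (s y) * (2 * (v \<bullet> (y - x)) / r\<^sup>2)) / C) *\<^sub>R c (y - x) +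
      (kernel_profile n (s y) / C) *\<^sub>R c v" for y v
  have K_eq: "reg_kernel w r x = (\<lambda>y. (kernel_profile n (s y) / C) *\<^sub>R c (y - x))"
    by (simp add: fun_eq_iff reg_kernel_def n_def C_def s_def c_def)
  show "(reg_kernel w r x has_derivative K' y) (at y)" for y
  proof -
    have "((\<lambda>y. kernel_profile n (s y) / C) has_derivative (\<lambda>v. (kernel_profile_deriv n (s y) * (2 * (v \<bullet> (y - x)) / r\<^sup>2)) / C)) (at y)"
      unfolding s_def [abs_def] divide_inverse [of _ C]
      by (intro has_derivative_mult_left has_derivative_kernel_profile_norm)
    moreover have "((\<lambda>y. c (y - x)) has_derivative c) (at y)"
      by (rule bounded_linear.has_derivative [OF c, of "\<lambda>y. y - x" "\<lambda>v. v"]) (auto intro!: derivative_eq_intros)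
    ultimately have "((\<lambda>y. (kernel_profile n (s y) / C) *\<^sub>R c (y - x)) has_derivative
        (\<lambda>v. (kernel_profile n (s y) / C) *\<^sub>R c v + ((kernel_profile_deriv n (s y) * (2 * (v \<bullet> (y - x)) / r\<^sup>2)) / C) *\<^sub>R c (y - x))) (at y)"
      by (rule has_derivative_scaleR)
    then show ?thesis
      unfolding K_eq K'_def [abs_def] by (simp only: add.commute)
  qed
  have conts: "continuous_on UNIV s"
    unfolding s_def [abs_def] using r by (intro continuous_intros) auto
  have contk: "continuous_on UNIV (kernel_profile n)"
    by (rule has_derivative_continuous_on)
      (rule has_derivative_at_withinI [OF has_real_derivative_kernel_profile [unfolded has_field_derivative_def]])
  have C: "C > 0" unfolding C_def using r sigma_const_pos [of "CARD('m) + 1"] by simp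
  show "continuous_on UNIV (\<lambda>y. K' y v)" for v
    unfolding K'_def using r C
    by (intro continuous_intros continuous_on_compose2 [OF contk conts] continuous_on_compose2 [OF continuous_kernel_profile_deriv conts]
        c.continuous_on) auto
  show "(\<Sum>b\<in>Basis. K' y b \<star> para (lift w b)) = reg_delta r x y *\<^sub>R cl_one" for y
  proof -
    define e where "e z = (para (lift w z) :: ('m, 'q) gen clifford)" for z :: "'m hp"
    have "linear e"
      unfolding e_def [abs_def] using linear_compose [OF linear_lift linear_para] by (simp add: o_def)
    have e_sum: "(\<Sum>b\<in>Basis. (z \<bullet> b) *\<^sub>R e b) = e z" for z
    proof -
      have "e z = e (\<Sum>b\<in>Basis. (z \<bullet> b) *\<^sub>R b)" by (simp add: euclidean_representation)
      then show ?thesis using \<open>linear e\<close> by (simp add: linear_sum linear_scale)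
    qed
    have ce: "c z \<star> e z = (norm z)\<^sup>2 *\<^sub>R cl_one" for z
      using conj_mult_para [of "lift w z"] by (simp add: c_def e_def norm_lift [OF w])
    have t: "kernel_profile_deriv n (s y) * (2 * (b \<bullet> (y - x)) / r\<^sup>2) / C = (2 * kernel_profile_deriv n (s y) / (r\<^sup>2 * C)) * ((y - x) \<bullet> b)" for b
      by (simp add: inner_commute)
    have "(\<Sum>b\<in>Basis. K' y b \<star> e b) = (\<Sum>b\<in>Basis. (2 * kernel_profile_deriv n (s y) / (r\<^sup>2 * C)) *\<^sub>R (c (y - x) \<star> (((y - x) \<bullet> b) *\<^sub>R e b))
        + (kernel_profile n (s y) / C) *\<^sub>R (c b \<star> e b))"
      unfolding K'_def t by (simp add: cl_mult_add_left cl_mult_scaleR_left cl_mult_scaleR_right)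
    \<comment> \<open>Differentiating the scalar factor gives conj(z) times the sum of
      \<open>(z \<bullet> b) *\<^sub>R e b\<close>, that is |z|^2 for z = \<open>y - x\<close>.
      Differentiating the linear factor gives conj(b) b = 1 for each of the n basis vectors.\<close>
    also have "\<dots> = (2 * kernel_profile_deriv n (s y) / (r\<^sup>2 * C)) *\<^sub>R (c (y - x) \<star> e (y - x)) + (kernel_profile n (s y) / C * n) *\<^sub>R cl_one"
    proof -
      have "(\<Sum>b\<in>Basis. (kernel_profile n (s y) / C) *\<^sub>R (c b \<star> e b)) = (\<Sum>b\<in>(Basis :: 'm hp set). (kernel_profile n (s y) / C) *\<^sub>R cl_one)"
        by (intro sum.cong refl) (simp add: ce)
      also have "\<dots> = (kernel_profile n (s y) / C * n) *\<^sub>R cl_one"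
        by (simp add: sum_constant_scaleR n_def mult.commute del: sum_constant)
      finally show ?thesis
        by (simp add: sum.distrib e_sum flip: scaleR_sum_right cl_mult_sum_right)
    qed
    also have "\<dots> = ((n * kernel_profile n (s y) + 2 * s y * kernel_profile_deriv n (s y)) / C) *\<^sub>R cl_one"
      using r C by (simp add: ce s_def field_simps flip: scaleR_add_left)
    also have "n * kernel_profile n (s y) + 2 * s y * kernel_profile_deriv n (s y) = n * (n + 2) / 2 * max 0 (1 - s y)"
      by (rule kernel_profile_divergence) (simp add: s_def)
    finally show ?thesis
      by (simp only: e_def reg_delta_def n_def C_def s_def)
  qed
qed

text \<open>Here the constant of the Cauchy kernel is confirmed: the factor n(n + 2)/2 meets the
  integral of the bump, which is the unit ball volume times r^n divided by (n + 2)/2, and n times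
  that volume is \<open>sigma_const n\<close>.\<close>

lemma reg_delta_mass:
  fixes x :: "'m::finite hp"
  assumes r: "r > 0"
  shows "integrable lborel (reg_delta r x)" "(LINT y|lborel. reg_delta r x y) = 1"
proof -
  define n where "n = CARD('m) + 1"
  define C where "C = real n * (real n + 2) / 2 / (sigma_const n * r ^ n)"
  have n: "n > 0" by (simp add: n_def)
  have C: "C > 0" using n r sigma_const_pos [OF n] by (simp add: C_def)
  have eq: "reg_delta r x y = C * max 0 (1 - (norm (y - x))\<^sup>2 / r\<^sup>2)" for y
    by (simp add: reg_delta_def n_def C_def)
  have V: "unit_ball_vol (real n) \<noteq> 0" using unit_ball_vol_pos [of "real n"] by linarith
  have m [measurable]: "reg_delta r x \<in> borel_measurable borel"
    unfolding eq [abs_def] using r by (intro borel_measurable_continuous_onI continuous_intros) auto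
  have nonneg: "0 \<le> reg_delta r x y" for y using C by (simp add: eq)
  have "(\<integral>\<^sup>+y. ennreal (reg_delta r x y) \<partial>lborel) = ennreal C * (\<integral>\<^sup>+y. ennreal (max 0 (1 - (norm (y - x))\<^sup>2 / r\<^sup>2)) \<partial>lborel)"
    using C by (simp add: eq ennreal_mult nn_integral_cmult)
  also have "\<dots> = ennreal C * ennreal (unit_ball_vol (real n) * r ^ n / (real n / 2 + 1))"
    by (subst nn_integral_ball_profile [OF r]) (simp add: n_def)
  also have "\<dots> = ennreal (C * (unit_ball_vol (real n) * r ^ n / (real n / 2 + 1)))"
    by (rule ennreal_mult' [symmetric]) (use C in simp)
  also have "C * (unit_ball_vol (real n) * r ^ n / (real n / 2 + 1)) = 1"
  proof -
    have "real n / 2 + 1 = (real n + 2) / 2" by simp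
    then show ?thesis
      using n r V by (simp add: C_def sigma_const_eq [OF n])
  qed
  finally have *: "(\<integral>\<^sup>+y. ennreal (reg_delta r x y) \<partial>lborel) = ennreal 1" .
  show "integrable lborel (reg_delta r x)"
    using * nonneg by (intro integrableI_nonneg) auto
  show "(LINT y|lborel. reg_delta r x y) = 1"
    using * nonneg by (subst integral_eq_nn_integral) auto
qed

text \<open>The divergence theorem is applied in direction \<open>b\<close> to the product of
  kernel, \<open>e b\<close> and \<open>g\<close>, and summed over the basis. The derivatives of
  \<open>g\<close> assemble to its Dirac derivative, which vanishes; those of the kernel assemble to
  the bump.\<close>

lemma cauchy_integral_slice:
  fixes G :: "'m::{finite,linorder} hp set" and w :: "(real, 'q::{finite,linorder}) vec"
    and g :: "'m hp \<Rightarrow> ('m, 'q) gen clifford"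
  assumes \<mu>: "is_surface_measure (frontier G) \<mu>" and w: "norm w = 1"
    and G: "open G" "bounded G" "smooth_boundary G" and x: "x \<in> G"
    and W: "open W" "closure G \<subseteq> W" and g: "C_k_on 1 W g" and dirac: "\<And>y. y \<in> W \<Longrightarrow> slice_dirac w g y = 0"
  defines "h \<equiv> (\<lambda>y. indicator (frontier G) y *\<^sub>R
      (cauchy_E (lift w y - lift w x) \<star> para (lift w (exterior_normal G y)) \<star> g y))"
  shows "integrable \<mu> h" "integral\<^sup>L \<mu> h = g x"
proof -
  define e where "e z = (para (lift w z) :: ('m, 'q) gen clifford)" for z :: "'m hp"
  have "linear e"
    unfolding e_def [abs_def] using linear_compose [OF linear_lift linear_para] by (simp add: o_def)
  have e_sum: "(\<Sum>b\<in>Basis. (z \<bullet> b) *\<^sub>R e b) = e z" for z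
  proof -
    have "e z = e (\<Sum>b\<in>Basis. (z \<bullet> b) *\<^sub>R b)" by (simp add: euclidean_representation)
    then show ?thesis using \<open>linear e\<close> by (simp add: linear_sum linear_scale)
  qed
  define g' where "g' y v = (\<Sum>b\<in>Basis. (v \<bullet> b) *\<^sub>R partial_deriv b g y)" for y v
  have g': "(g has_derivative g' y) (at y)" if "y \<in> W" for y
    unfolding g'_def [abs_def] by (rule C_1_on_has_derivative [OF g W(1) that])
  have g'b: "g' y b = partial_deriv b g y" if "y \<in> W" for y b
    using has_derivative_imp_partial(2) [OF g' [OF that]] by simp
  have contg': "continuous_on W (\<lambda>y. g' y v)" for v
    unfolding g'_def by (intro continuous_intros C_1_onD(3) [OF g])
  have contg: "continuous_on W g" by (rule C_1_onD(1) [OF g])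
  have Gne: "G \<noteq> {}" using x by auto
  have xW: "x \<in> W" using x W(2) closure_subset by blast
  have formula: "integrable \<mu> h \<and> integrable lborel (\<lambda>y. indicator G y *\<^sub>R (reg_delta r x y *\<^sub>R g y)) \<and>
      (LINT y|lborel. indicator G y *\<^sub>R (reg_delta r x y *\<^sub>R g y)) = integral\<^sup>L \<mu> h"
    if r: "r > 0" and rG: "cball x r \<subseteq> G" for r
  proof -
    obtain K' where K': "\<And>y. (reg_kernel w r x has_derivative K' y) (at y)" "\<And>v. continuous_on UNIV (\<lambda>y. K' y v)"
      and div: "\<And>y. (\<Sum>b\<in>Basis. K' y b \<star> para (lift w b)) = (reg_delta r x y *\<^sub>R cl_one :: ('m, 'q) gen clifford)"
      by (rule has_derivative_reg_kernel [OF w r]) (rule that)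
    define K where "K = (reg_kernel w r x :: _ \<Rightarrow> ('m, 'q) gen clifford)"
    have contK: "continuous_on UNIV K"
      unfolding K_def by (rule has_derivative_continuous_on) (rule has_derivative_at_withinI [OF K'(1)])
    \<comment> \<open>The factor \<open>e b\<close> stands between kernel and \<open>g\<close>, so
      that without commutativity one product yields both the right Dirac derivative of the kernel
      and the left one of \<open>g\<close>.\<close>
    define F where "F b y = K y \<star> e b \<star> g y" for b y
    define F' where "F' b y v = K y \<star> e b \<star> g' y v + K' y v \<star> e b \<star> g y" for b y v
    have F: "(F b has_derivative F' b y) (at y)" if "y \<in> W" for b y
      unfolding F_def [abs_def] F'_def [abs_def]
      by (intro cl_mult.FDERIV g' that bounded_linear.has_derivative [OF cl_mult.bounded_linear_left] K'(1) [folded K_def])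
    have contF': "continuous_on W (\<lambda>y. F' b y v)" for b v
      unfolding F'_def
      by (intro continuous_intros cl_mult.continuous_on contg' contg continuous_on_subset [OF contK] continuous_on_subset [OF K'(2)]) auto
    note D = divergence_theorem [OF \<mu> G Gne W F contF']
    define H where "H b y = indicator (frontier G) y *\<^sub>R ((exterior_normal G y \<bullet> b) *\<^sub>R F b y)" for b y
    have H: "integrable \<mu> (H b)" "(LINT y|lborel. indicator G y *\<^sub>R F' b y b) = integral\<^sup>L \<mu> (H b)" for b
      using D(1) [of b b] by (simp_all add: divergence_identity_def H_def [abs_def])
    have sumH: "(\<lambda>y. \<Sum>b\<in>Basis. H b y) = h"
    proof
      fix y
      show "(\<Sum>b\<in>Basis. H b y) = h y"
      proof (cases "y \<in> frontier G")
        case True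
        \<comment> \<open>Boundary points lie outside the open set \<open>G\<close>, hence at
          distance at least \<open>r\<close> from \<open>x\<close>, where the regularised kernel is
          the Cauchy kernel.\<close>
        then have "y \<notin> G" using G(1) by (simp add: frontier_def interior_open)
        then have "norm (y - x) \<ge> r" using rG by (force simp: dist_norm norm_minus_commute)
        then have "K y = cauchy_E (lift w y - lift w x)"
          unfolding K_def by (rule reg_kernel_outside [OF w r])
        moreover have "(\<Sum>b\<in>Basis. H b y) = K y \<star> (\<Sum>b\<in>Basis. (exterior_normal G y \<bullet> b) *\<^sub>R e b) \<star> g y"
          using True by (simp add: H_def F_def cl_mult_sum_left cl_mult_sum_right cl_mult_scaleR_left cl_mult_scaleR_right)
        ultimately show ?thesis using True by (simp add: h_def e_sum) (simp add: e_def)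
      qed (simp add: H_def h_def)
    qed
    have sumF': "(\<Sum>b\<in>Basis. indicator G y *\<^sub>R F' b y b) = indicator G y *\<^sub>R (reg_delta r x y *\<^sub>R g y)" for y
    proof (cases "y \<in> G")
      case True
      then have y: "y \<in> W" using W(2) closure_subset by blast
      have "(\<Sum>b\<in>Basis. F' b y b) = K y \<star> (\<Sum>b\<in>Basis. e b \<star> g' y b) + (\<Sum>b\<in>Basis. K' y b \<star> e b) \<star> g y"
        by (simp add: F'_def sum.distrib cl_mult_sum_left cl_mult_sum_right cl_mult_assoc)
      also have "(\<Sum>b\<in>Basis. e b \<star> g' y b) = 0"
        using dirac [OF y] by (simp add: slice_dirac_eq e_def g'b [OF y])
      also have "(\<Sum>b\<in>Basis. K' y b \<star> e b) = reg_delta r x y *\<^sub>R cl_one"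
        using div by (simp add: e_def)
      finally have "(\<Sum>b\<in>Basis. F' b y b) = reg_delta r x y *\<^sub>R g y"
        by (simp add: cl_mult.zero_right cl_mult_scaleR_left cl_one_left)
      then show ?thesis by (simp flip: scaleR_sum_right)
    qed simp
    have "integrable \<mu> (\<lambda>y. \<Sum>b\<in>Basis. H b y)"
      by (intro Bochner_Integration.integrable_sum H)
    moreover have "integrable lborel (\<lambda>y. \<Sum>b\<in>Basis. indicator G y *\<^sub>R F' b y b)"
      by (intro Bochner_Integration.integrable_sum D(2))
    moreover have "(LINT y|lborel. (\<Sum>b\<in>Basis. indicator G y *\<^sub>R F' b y b)) = (LINT y|\<mu>. (\<Sum>b\<in>Basis. H b y))"
    proof -
      have "(LINT y|lborel. (\<Sum>b\<in>Basis. indicator G y *\<^sub>R F' b y b)) = (\<Sum>b\<in>Basis. LINT y|lborel. indicator G y *\<^sub>R F' b y b)"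
        by (rule Bochner_Integration.integral_sum) (rule D(2))
      also have "\<dots> = (\<Sum>b\<in>Basis. integral\<^sup>L \<mu> (H b))"
        by (simp only: H(2))
      also have "\<dots> = (LINT y|\<mu>. (\<Sum>b\<in>Basis. H b y))"
        by (rule Bochner_Integration.integral_sum [symmetric]) (rule H(1))
      finally show ?thesis .
    qed
    ultimately show ?thesis unfolding sumH sumF' by blast
  qed
  obtain r0 where r0: "r0 > 0" "cball x r0 \<subseteq> G" using G(1) x open_contains_cball by blast
  show "integrable \<mu> h" using formula [OF r0] by blast
  \<comment> \<open>Since \<open>h\<close> does not involve the radius, it may be shrunk for each
    \<open>\<eta>\<close>. Unit mass allows \<open>g x\<close> to be written as an integral of the
    bump times \<open>g x\<close>, which reduces the claim to continuity of \<open>g\<close> at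
    \<open>x\<close>.\<close>
  have "norm (integral\<^sup>L \<mu> h - g x) \<le> \<eta>" if "\<eta> > 0" for \<eta>
  proof -
    have "isCont g x" using contg W(1) xW continuous_on_eq_continuous_at by blast
    then obtain d where d: "d > 0" "\<And>y. dist y x < d \<Longrightarrow> dist (g y) (g x) < \<eta>"
      using \<open>\<eta> > 0\<close> unfolding continuous_at_eps_delta by metis
    define r where "r = min r0 d"
    have r: "r > 0" "cball x r \<subseteq> G" using r0 d(1) by (auto simp: r_def)
    have zero: "reg_delta r x y = 0" if "\<not> norm (y - x) < r" for y
    proof -
      have "r\<^sup>2 \<le> (norm (y - x))\<^sup>2" using that r(1) by (intro power_mono) auto
      then show ?thesis using r(1) by (simp add: reg_delta_def)
    qed
    have nonneg: "reg_delta r x y \<ge> 0" for y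
      using r(1) sigma_const_pos [of "CARD('m) + 1"] by (simp add: reg_delta_def)
    note mass = reg_delta_mass [OF r(1), of x]
    have "integral\<^sup>L \<mu> h - g x = (LINT y|lborel. indicator G y *\<^sub>R (reg_delta r x y *\<^sub>R g y)) - (LINT y|lborel. reg_delta r x y *\<^sub>R g x)"
      using formula [OF r] mass by simp
    also have "\<dots> = (LINT y|lborel. indicator G y *\<^sub>R (reg_delta r x y *\<^sub>R g y) - reg_delta r x y *\<^sub>R g x)"
      using formula [OF r] mass by (subst Bochner_Integration.integral_diff) auto
    also have "norm \<dots> \<le> (LINT y|lborel. \<eta> * reg_delta r x y)"
    proof (rule order_trans [OF Bochner_Integration.integral_norm_bound], rule Bochner_Integration.integral_mono)
      show "integrable lborel (\<lambda>y. norm (indicator G y *\<^sub>R (reg_delta r x y *\<^sub>R g y) - reg_delta r x y *\<^sub>R g x))"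
        using formula [OF r] mass by (intro integrable_norm Bochner_Integration.integrable_diff) auto
      show "integrable lborel (\<lambda>y. \<eta> * reg_delta r x y)" using mass by simp
      fix y
      show "norm (indicator G y *\<^sub>R (reg_delta r x y *\<^sub>R g y) - reg_delta r x y *\<^sub>R g x) \<le> \<eta> * reg_delta r x y"
      proof (cases "norm (y - x) < r")
        case True
        then have "y \<in> G" using r(2) by (force simp: dist_norm norm_minus_commute)
        then have "norm (indicator G y *\<^sub>R (reg_delta r x y *\<^sub>R g y) - reg_delta r x y *\<^sub>R g x) = reg_delta r x y * norm (g y - g x)"
          using nonneg [of y] by (simp flip: scaleR_diff_right)
        also have "\<dots> \<le> reg_delta r x y * \<eta>"
          using d(2) [of y] True nonneg by (intro mult_left_mono) (auto simp: dist_norm r_def)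
        finally show ?thesis by (simp add: mult.commute)
      qed (simp add: zero)
    qed
    also have "\<dots> = \<eta>" using mass by simp
    finally show ?thesis .
  qed
  then have "norm (integral\<^sup>L \<mu> h - g x) \<le> 0" by (rule field_le_epsilon) simp
  then show "integral\<^sup>L \<mu> h = g x" by simp
qed

theorem theorem3p30:
  fixes \<Omega> U :: "('m::{finite,linorder}, 'q::{finite,linorder}) pv set"
    and f :: "('m, 'q) pv \<Rightarrow> ('m, 'q) gen clifford"
    and w :: "(real, 'q) vec"
  assumes "slice_domain \<Omega>"
    and "p_symmetric \<Omega>"
    and "gen_partial_slice_monogenic \<Omega> f"
    and "is_domain U"
    and "w \<in> pv_sphere"
    and "slice w U \<subseteq> slice w \<Omega>"
    and "is_domain (slice w U)"
    and "bounded (slice w U)"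
    and "smooth_boundary (slice w U)"
    and "frontier (slice w U) \<subseteq> slice w \<Omega>"
  shows "\<forall>x \<in> slice w U.
    (let S = frontier (slice w U);
         g = (\<lambda>y. cauchy_E (lift w y - lift w x) \<star>
                   para (lift w (exterior_normal (slice w U) y)) \<star> f (lift w y))
     in set_integrable (surface_measure S) S g \<and>
        f (lift w x) = (LINT y:S|surface_measure S. g y))"
proof
  fix x assume x: "x \<in> slice w U"
  have "norm w = 1" using assms(5) by (simp add: pv_sphere_def)
  moreover have "compact (frontier (slice w U))"
    using assms(8) by (rule compact_frontier_bounded)
  then have "is_surface_measure (frontier (slice w U)) (surface_measure (frontier (slice w U)))"
    using assms(9) by (rule is_surface_measure_surface_measure)
  moreover have "open (slice w U)" using assms(7) by (simp add: is_domain_def)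
  moreover have "open (slice w \<Omega>)" using assms(1,5) by (simp add: slice_domain_def is_domain_def)
  \<comment> \<open>The slice and its frontier together form the closure, so the monogenic function
    is C^1 on an open neighbourhood of the closed region.\<close>
  moreover have "closure (slice w U) \<subseteq> slice w \<Omega>"
    using assms(6,10) by (simp add: closure_Un_frontier)
  moreover have "C_k_on 1 (slice w \<Omega>) (\<lambda>z. f (lift w z))"
      "\<And>y. y \<in> slice w \<Omega> \<Longrightarrow> slice_dirac w (\<lambda>z. f (lift w z)) y = 0"
    using assms(3,5) unfolding gen_partial_slice_monogenic_def by blast+
  ultimately show "let S = frontier (slice w U);
         g = (\<lambda>y. cauchy_E (lift w y - lift w x) \<star>
                   para (lift w (exterior_normal (slice w U) y)) \<star> f (lift w y))
     in set_integrable (surface_measure S) S g \<and>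
        f (lift w x) = (LINT y:S|surface_measure S. g y)"
    using cauchy_integral_slice [of "slice w U" "surface_measure (frontier (slice w U))" w x "slice w \<Omega>" "\<lambda>z. f (lift w z)"]
      assms(8,9) x
    by (simp add: Let_def set_integrable_def set_lebesgue_integral_def del: One_nat_def)
qed

end
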